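(* The rational self-map $\lambda_{\{2\},\{3\}}:\mathcal{R}_7\dashrightarrow\mathcal{R}_7$ (equivalently of the quartic surface $Z_7$) is a dominant rational map of degree $4$.
   Context: Over $\mathbb{C}$. For a line arrangement $\mathcal{C}$, $\Lambda_{\{2\},\{3\}}(\mathcal{C})$ is the union of lines containing exactly three double points (points where exactly two lines meet) of $\mathcal{C}$. $M_7$ is the rank-3 matroid on $\{1,\dots,7,1',\dots,7'\}$ in which every 3-subset is a basis except the triples $\{a,b,c'\}$ with $a\neq b\in\{1,\dots,7\}$, $a+b\equiv 2c\pmod 7$. A realization is a labeled family of 14 distinct lines such that three are concurrent iff their labels form a non-basis; $\mathcal{R}_7$ is the moduli space of $\mathrm{PGL}_3$-orbits of realizations. It is known that $\mathcal{R}_7$ is a dense open subset of the quartic surface $Z_7\subset\mathbb{P}^3$: $y_1^2y_2^2+y_1^2y_2y_3-y_1y_2^2y_3-y_1y_2y_3^2-y_1^2y_2y_4-y_1y_2^2y_4+y_1y_2y_3y_4-y_2y_3^2y_4+y_1y_2y_4^2+y_3^2y_4^2=0$. For a generic realization $(\ell_1,\dots,\ell_7,\ell'_1,\dots,\ell'_7)$, setting $\ell''_j=\Lambda_{\{2\},\{3\}}(\sum_{k\neq j}\ell'_k)$ yields a realization $(\ell'_1,\dots,\ell'_7,\ell''_1,\dots,\ell''_7)$; $\lambda_{\{2\},\{3\}}$ is the induced rational map on $\mathcal{R}_7$ sending the class of the first to the class of the second. *)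

theory Defs
  imports "HOL-Analysis.Analysis"
begin

text \<open>Lines and points of the complex projective plane are represented by nonzero
  vectors in complex^3 (homogeneous coordinates); a point p lies on a line a iff
  the bilinear pairing of p and a vanishes.\<close>

type_synonym vec3 = "complex ^ 3"

definition dot3 :: "vec3 \<Rightarrow> vec3 \<Rightarrow> complex" where
  "dot3 p a = (\<Sum>i\<in>UNIV. p $ i * a $ i)"

definition ray :: "vec3 \<Rightarrow> vec3 set" where
  "ray v = range (\<lambda>c. c *s v)"

definition same_line :: "vec3 \<Rightarrow> vec3 \<Rightarrow> bool" where
  "same_line a b \<longleftrightarrow> (\<exists>c. b = c *s a)"

definition concurrent :: "vec3 \<Rightarrow> vec3 \<Rightarrow> vec3 \<Rightarrow> bool" where
  "concurrent a b c \<longleftrightarrow> (\<exists>p. p \<noteq> 0 \<and> dot3 p a = 0 \<and> dot3 p b = 0 \<and> dot3 p c = 0)"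

text \<open>Labels of the matroid M_7: Unp i stands for i, Pri i stands for i' (i = 1..7).\<close>
datatype label = Unp nat | Pri nat

definition Labels :: "label set" where
  "Labels = Unp ` {1..7} \<union> Pri ` {1..7}"

definition nonbasis :: "label set \<Rightarrow> bool" where
  "nonbasis S \<longleftrightarrow> (\<exists>a b c. a \<in> {1..7} \<and> b \<in> {1..7} \<and> c \<in> {1..7} \<and> a \<noteq> b \<and>
      (a + b) mod 7 = (2 * c) mod 7 \<and> S = {Unp a, Unp b, Pri c})"

definition is_realization :: "(label \<Rightarrow> vec3) \<Rightarrow> bool" where
  "is_realization L \<longleftrightarrow>
     (\<forall>x\<in>Labels. L x \<noteq> 0) \<and>
     (\<forall>x\<in>Labels. \<forall>y\<in>Labels. x \<noteq> y \<longrightarrow> \<not> same_line (L x) (L y)) \<and>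
     (\<forall>x\<in>Labels. \<forall>y\<in>Labels. \<forall>z\<in>Labels. x \<noteq> y \<and> y \<noteq> z \<and> x \<noteq> z \<longrightarrow>
        (concurrent (L x) (L y) (L z) \<longleftrightarrow> nonbasis {x, y, z}))"

definition pgl_equiv :: "(label \<Rightarrow> vec3) \<Rightarrow> (label \<Rightarrow> vec3) \<Rightarrow> bool" where
  "pgl_equiv L M \<longleftrightarrow> (\<exists>A :: complex^3^3. invertible A \<and>
      (\<forall>x\<in>Labels. \<exists>c. c \<noteq> 0 \<and> M x = c *s (A *v L x)))"

text \<open>The PGL_3-orbit of a realization, i.e. a point of the moduli space R_7.\<close>
definition pgl_class :: "(label \<Rightarrow> vec3) \<Rightarrow> (label \<Rightarrow> vec3) set" where
  "pgl_class L = {M. is_realization M \<and> pgl_equiv L M}"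

text \<open>Double points of an arrangement A (a set of vectors representing pairwise
  distinct lines): points lying on exactly two lines of A.\<close>
definition double_pt :: "vec3 set \<Rightarrow> vec3 \<Rightarrow> bool" where
  "double_pt A p \<longleftrightarrow> p \<noteq> 0 \<and> card {a\<in>A. dot3 p a = 0} = 2"

definition Lambda23 :: "vec3 set \<Rightarrow> vec3 set" where
  "Lambda23 A = {l. l \<noteq> 0 \<and> card (ray ` {p. dot3 p l = 0 \<and> double_pt A p}) = 3}"

text \<open>lam_rel L N: N is the output of the construction lambda_{2},{3} applied to
  the realization L, i.e. N = (l'_1..l'_7, l''_1..l''_7) with
  l''_j = Lambda23 (sum over k /= j of l'_k), and N is again a realization.\<close>
definition lam_rel :: "(label \<Rightarrow> vec3) \<Rightarrow> (label \<Rightarrow> vec3) \<Rightarrow> bool" where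
  "lam_rel L N \<longleftrightarrow> is_realization L \<and> is_realization N \<and>
     (\<forall>j\<in>{1..7}. N (Unp j) = L (Pri j)) \<and>
     (\<forall>j\<in>{1..7}. N (Pri j) \<noteq> 0 \<and>
        Lambda23 (L ` Pri ` ({1..7} - {j})) = ray (N (Pri j)) - {0})"

inductive poly_fun :: "((label \<Rightarrow> vec3) \<Rightarrow> complex) \<Rightarrow> bool" where
  const: "poly_fun (\<lambda>L. c)"
| coord: "x \<in> Labels \<Longrightarrow> poly_fun (\<lambda>L. L x $ i)"
| add: "poly_fun f \<Longrightarrow> poly_fun g \<Longrightarrow> poly_fun (\<lambda>L. f L + g L)"
| mult: "poly_fun f \<Longrightarrow> poly_fun g \<Longrightarrow> poly_fun (\<lambda>L. f L * g L)"

end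

theory Submission
  imports Defs "HOL-Computational_Algebra.Fundamental_Theorem_Algebra"
begin

text \<open>Read dually, a realization is a family of points \<open>q\<^sub>a, r\<^sub>c\<close> indexed by integers modulo 7, with
  \<open>q\<^sub>a, q\<^sub>b, r\<^sub>c\<close> collinear iff \<open>a + b = 2 c\<close>. By Cayley--Bacharach the 14 points lie on a unique cubic,
  and a predecessor \<open>(p, q)\<close> of \<open>(q, r)\<close> lies on the same cubic. In terms of the group law
  \<open>q\<^sub>a = - 2 p\<^sub>a\<close>, so \<open>p\<^sub>0\<close> is one of the four points at which the tangent passes through \<open>q\<^sub>0\<close>, and
  \<open>p\<^sub>0\<close> determines \<open>p\<close>. Conversely each of the four tangents yields a predecessor: the required
  collinearities follow from Cayley--Bacharach on grids with a double point, and nondegeneracy is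
  free, because three collinear \<open>p\<close>'s would force three collinear \<open>q\<close>'s.\<close>

section \<open>Brackets and collinearity\<close>

text \<open>If \<open>p_a = u + a t\<close> with \<open>7 t = 0\<close> on a cubic, then
  \<open>q_c = -2 u - 2 c t\<close>, and the incidence rule \<open>a + b = 2 c\<close> says
  \<open>p_a + p_b + q_c = 0\<close>. Going back means halving \<open>-q_0\<close>, which is
  ambiguous up to the four points of order dividing 2; hence the degree 4. The group law is only a
  guide: every relation that it predicts is obtained from a 3 x 3 grid of points by bracket algebra,
  so the cubic need not be known to be smooth beforehand. The price is that grids with coinciding
  points need versions of their own, and that each grid asks for nonvanishing brackets and tangents.
  The conditions on the target are collected in \<open>m7_generic\<close> and multiplied into one
  polynomial, together with the condition that three double points are collinear only where the
  matroid forces it. One integral example shows that this polynomial is not zero on realizations.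
  Its curve is Tate's normal form \<open>y^2 + (1 - c) x y - b y = x^3 - b x^2\<close> with
  \<open>b = d^3 - d^2\<close>, \<open>c = d^2 - d\<close>, which makes the origin a point of order
  7, at \<open>d = 8\<close>.\<close>

definition det3 :: "vec3 \<Rightarrow> vec3 \<Rightarrow> vec3 \<Rightarrow> complex" where
  "det3 a b c = a$1 * (b$2 * c$3 - b$3 * c$2) - a$2 * (b$1 * c$3 - b$3 * c$1)
     + a$3 * (b$1 * c$2 - b$2 * c$1)"

definition cross :: "vec3 \<Rightarrow> vec3 \<Rightarrow> vec3" where
  "cross a b = vector [a$2 * b$3 - a$3 * b$2, a$3 * b$1 - a$1 * b$3, a$1 * b$2 - a$2 * b$1]"

lemma dot3_expand: "dot3 p a = p$1 * a$1 + p$2 * a$2 + p$3 * a$3"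
  by (simp add: dot3_def sum_3)

lemma vec3_eq_iff: "(x::vec3) = y \<longleftrightarrow> x$1 = y$1 \<and> x$2 = y$2 \<and> x$3 = y$3"
  by (simp add: vec_eq_iff forall_3)

lemma det3_rotate: "det3 b c a = det3 a b c"
  by (simp add: det3_def algebra_simps)

lemma det3_swap: "det3 b a c = - det3 a b c" "det3 a c b = - det3 a b c"
  by (simp_all add: det3_def algebra_simps)

lemma det3_same [simp]: "det3 a a b = 0" "det3 a b a = 0" "det3 b a a = 0"
  by (simp_all add: det3_def algebra_simps)

lemma det3_zero [simp]: "det3 0 a b = 0" "det3 a 0 b = 0" "det3 a b 0 = 0"
  by (simp_all add: det3_def)

lemma det3_add: "det3 (a + a') b c = det3 a b c + det3 a' b c"
  "det3 a (b + b') c = det3 a b c + det3 a b' c"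
  "det3 a b (c + c') = det3 a b c + det3 a b c'"
  by (simp_all add: det3_def algebra_simps)

lemma det3_scale: "det3 (k *s a) b c = k * det3 a b c"
  "det3 a (k *s b) c = k * det3 a b c" "det3 a b (k *s c) = k * det3 a b c"
  by (simp_all add: det3_def algebra_simps)

lemma det3_cross: "det3 a b c = dot3 (cross a b) c"
  by (simp add: det3_def cross_def dot3_expand algebra_simps)

lemma det3_coords:
  "det3 (x1 *s u + y1 *s v + z1 *s w) (x2 *s u + y2 *s v + z2 *s w) (x3 *s u + y3 *s v + z3 *s w)
    = (x1 * (y2 * z3 - z2 * y3) - y1 * (x2 * z3 - z2 * x3) + z1 * (x2 * y3 - y2 * x3)) * det3 u v w"
  by (simp add: det3_def algebra_simps)

lemma cramer: "det3 u v w *s x = det3 x v w *s u + det3 u x w *s v + det3 u v x *s w"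
  by (simp add: vec3_eq_iff det3_def algebra_simps)

lemma basis_coords:
  assumes "det3 u v w \<noteq> 0"
  obtains x y z where "X = x *s u + y *s v + z *s w"
    "x = det3 X v w / det3 u v w" "y = det3 u X w / det3 u v w" "z = det3 u v X / det3 u v w"
proof -
  have "inverse (det3 u v w) *s (det3 u v w *s X) = inverse (det3 u v w) *s
     (det3 X v w *s u + det3 u X w *s v + det3 u v X *s w)"
    using cramer by metis
  then have "X = (det3 X v w / det3 u v w) *s u + (det3 u X w / det3 u v w) *s v
     + (det3 u v X / det3 u v w) *s w"
    using assms by (simp add: vector_add_ldistrib field_simps)
  then show ?thesis using that by blast
qed

text \<open>Encodes that \<open>a\<close> and \<open>b\<close> are distinct projective points, zero
  vectors excluded. In this form any nonzero bracket containing both is a proof.\<close>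

definition indep2 :: "vec3 \<Rightarrow> vec3 \<Rightarrow> bool" where
  "indep2 a b \<longleftrightarrow> (\<exists>c. det3 a b c \<noteq> 0)"

lemma indep2I: "det3 a b c \<noteq> 0 \<Longrightarrow> indep2 a b"
  unfolding indep2_def by blast

lemma indep2_sym: "indep2 a b \<Longrightarrow> indep2 b a"
  unfolding indep2_def by (metis det3_swap(1) neg_equal_0_iff_equal)

lemma line_coords:
  assumes "indep2 a b" "det3 a b x = 0"
  obtains s t where "x = s *s a + t *s b"
proof -
  obtain c where c: "det3 a b c \<noteq> 0" using assms indep2_def by blast
  obtain x1 y1 z1 where "x = x1 *s a + y1 *s b + z1 *s c" "z1 = det3 a b x / det3 a b c"
    by (rule basis_coords[OF c])
  then show ?thesis using that assms by simp
qed

lemma det3_line: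
  "det3 (s1 *s a + t1 *s b) (s2 *s a + t2 *s b) x = (s1 * t2 - s2 * t1) * det3 a b x"
  by (simp add: det3_def algebra_simps)

lemma collinear3:
  assumes "indep2 a b" "det3 a b x = 0" "det3 a b y = 0" "det3 a b z = 0"
  shows "det3 x y z = 0"
proof -
  obtain s t where x: "x = s *s a + t *s b" using line_coords assms by blast
  obtain s' t' where y: "y = s' *s a + t' *s b" using line_coords assms by blast
  show ?thesis unfolding x y det3_line using assms by simp
qed

lemma collinear_extend:
  assumes "indep2 b c" "det3 a b c = 0" "det3 b c x = 0"
  shows "det3 a b x = 0"
  by (rule collinear3[of b c]) (use assms in \<open>simp_all add: det3_rotate\<close>)

lemma indep2_eq: "\<not> indep2 a b \<longleftrightarrow> cross a b = 0"
proof
  assume "\<not> indep2 a b"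
  then have *: "det3 a b c = 0" for c by (simp add: indep2_def)
  have "cross a b $ 1 = det3 a b (vector [1,0,0])" "cross a b $ 2 = det3 a b (vector [0,1,0])"
    "cross a b $ 3 = det3 a b (vector [0,0,1])"
    by (simp_all add: cross_def det3_def)
  then show "cross a b = 0" by (simp add: * vec3_eq_iff)
qed (simp add: indep2_def det3_cross dot3_def)

lemma not_indep2:
  assumes "\<not> indep2 a b" "a \<noteq> 0"
  obtains k where "b = k *s a"
proof -
  have c: "a$2 * b$3 = a$3 * b$2" "a$3 * b$1 = a$1 * b$3" "a$1 * b$2 = a$2 * b$1"
    using assms(1) by (auto simp: indep2_eq vec3_eq_iff cross_def)
  from assms(2) consider "a$1 \<noteq> 0" | "a$2 \<noteq> 0" | "a$3 \<noteq> 0" by (auto simp: vec3_eq_iff)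
  then show ?thesis
  proof cases
    case 1
    have "b = (b$1 / a$1) *s a" using 1 c by (auto simp: vec3_eq_iff field_simps)
    then show ?thesis using that by blast
  next
    case 2
    have "b = (b$2 / a$2) *s a" using 2 c by (auto simp: vec3_eq_iff field_simps)
    then show ?thesis using that by blast
  next
    case 3
    have "b = (b$3 / a$3) *s a" using 3 c by (auto simp: vec3_eq_iff field_simps)
    then show ?thesis using that by blast
  qed
qed

lemma indep2_scale: "indep2 a b \<Longrightarrow> b \<noteq> k *s a"
  by (auto simp: indep2_def det3_scale)

lemma concurrent_det3: "concurrent a b c \<longleftrightarrow> det3 a b c = 0"
proof
  assume "concurrent a b c"
  then obtain p where p: "p \<noteq> 0" "dot3 p a = 0" "dot3 p b = 0" "dot3 p c = 0"
    unfolding concurrent_def by blast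
  have "det3 a b c * p$1 = 0" "det3 a b c * p$2 = 0" "det3 a b c * p$3 = 0"
    using p(2-4) unfolding dot3_expand det3_def by algebra+
  then show "det3 a b c = 0" using p(1) by (auto simp: vec3_eq_iff)
next
  assume d: "det3 a b c = 0"
  have orth: "dot3 (cross x y) x = 0" "dot3 (cross x y) y = 0" for x y
    by (simp_all flip: det3_cross)
  have ex: "\<exists>p. p \<noteq> 0 \<and> dot3 p x = 0" for x
  proof (cases "x$1 = 0")
    case True
    then have "dot3 (vector [1,0,0]) x = 0" "(vector [1,0,0] :: vec3) \<noteq> 0"
      by (auto simp: dot3_expand vec3_eq_iff)
    then show ?thesis by blast
  next
    case False
    then have "dot3 (vector [x$2,-x$1,0]) x = 0" "(vector [x$2,-x$1,0] :: vec3) \<noteq> 0"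
      by (auto simp: dot3_expand vec3_eq_iff)
    then show ?thesis by blast
  qed
  have orth_scale: "dot3 p (k *s x) = k * dot3 p x" for p k x by (simp add: dot3_expand algebra_simps)
  show "concurrent a b c"
  proof (cases "cross a b = 0")
    case False
    then show ?thesis unfolding concurrent_def using d orth by (metis det3_cross)
  next
    case ab: True
    show ?thesis
    proof (cases "a = 0")
      case True
      show ?thesis
      proof (cases "cross b c = 0")
        case False
        then show ?thesis unfolding concurrent_def using True orth by (metis dot3_expand mult_zero_right add_0 zero_index)
      next
        case bc: True
        show ?thesis
        proof (cases "b = 0")
          case b0: True
          then show ?thesis unfolding concurrent_def using True ex[of c] by (auto simp: dot3_expand)
        next
          case False
          then obtain k where "c = k *s b" using bc not_indep2 indep2_eq by metis
          then show ?thesis unfolding concurrent_def using True ex[of b] orth_scale by (auto simp: dot3_def)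
        qed
      qed
    next
      case False
      then obtain k where k: "b = k *s a" using ab not_indep2 indep2_eq by metis
      show ?thesis
      proof (cases "cross a c = 0")
        case True
        then obtain l where "c = l *s a" using False not_indep2 indep2_eq by metis
        then show ?thesis unfolding concurrent_def using k ex[of a] orth_scale by auto
      next
        case False
        then show ?thesis unfolding concurrent_def using k orth orth_scale by (metis mult_zero_right)
      qed
    qed
  qed
qed

section \<open>Cubics and degenerate Cayley--Bacharach\<close>

text \<open>A cubic is carried as its polar form: the curve is \<open>B x x x = 0\<close>, and at a
  smooth point \<open>x\<close> of it the tangent line consists of the \<open>y\<close> with
  \<open>B x x y = 0\<close>.\<close>

definition sym_trilinear :: "(vec3 \<Rightarrow> vec3 \<Rightarrow> vec3 \<Rightarrow> complex) \<Rightarrow> bool" where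
  "sym_trilinear B \<longleftrightarrow> (\<forall>x y z. B x y z = B y x z) \<and> (\<forall>x y z. B x y z = B x z y) \<and>
     (\<forall>x x' y z. B (x + x') y z = B x y z + B x' y z) \<and> (\<forall>k x y z. B (k *s x) y z = k * B x y z)"

lemma sym_trilinearD:
  assumes "sym_trilinear B"
  shows "B x y z = B y x z" "B x y z = B x z y"
    "B (x + x') y z = B x y z + B x' y z" "B y (x + x') z = B y x z + B y x' z"
    "B y z (x + x') = B y z x + B y z x'"
    "B (k *s x) y z = k * B x y z" "B y (k *s x) z = k * B y x z" "B y z (k *s x) = k * B y z x"
proof -
  have s1: "B x y z = B y x z" for x y z using assms unfolding sym_trilinear_def by blast
  have s2: "B x y z = B x z y" for x y z using assms unfolding sym_trilinear_def by blast
  have a: "B (x + x') y z = B x y z + B x' y z" for x x' y z using assms unfolding sym_trilinear_def by blast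
  have k: "B (k *s x) y z = k * B x y z" for k x y z using assms unfolding sym_trilinear_def by blast
  show "B x y z = B y x z" by (rule s1)
  show "B x y z = B x z y" by (rule s2)
  show "B (x + x') y z = B x y z + B x' y z" by (rule a)
  show a2: "B y (x + x') z = B y x z + B y x' z" by (metis a s1)
  show "B y z (x + x') = B y z x + B y z x'" by (metis a s1 s2)
  show "B (k *s x) y z = k * B x y z" by (rule k)
  show "B y (k *s x) z = k * B y x z" by (metis k s1)
  show "B y z (k *s x) = k * B y z x" by (metis k s1 s2)
qed

lemma cubic_expand:
  assumes "sym_trilinear B"
  shows "B (x *s u + y *s v + z *s w) (x *s u + y *s v + z *s w) (x *s u + y *s v + z *s w) =
    x^3 * B u u u + y^3 * B v v v + z^3 * B w w w + 3 * x^2 * y * B u u v + 3 * x^2 * z * B u u w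
    + 3 * x * y^2 * B u v v + 3 * x * z^2 * B u w w + 3 * y^2 * z * B v v w + 3 * y * z^2 * B v w w
    + 6 * x * y * z * B u v w"
proof -
  note s = sym_trilinearD[OF assms]
  have e: "B v u u = B u u v" "B u v u = B u u v" "B w u u = B u u w" "B u w u = B u u w"
    "B v u v = B u v v" "B v v u = B u v v" "B w u w = B u w w" "B w w u = B u w w"
    "B v w v = B v v w" "B w v v = B v v w" "B w v w = B v w w" "B w w v = B v w w"
    "B u w v = B u v w" "B v u w = B u v w" "B v w u = B u v w" "B w u v = B u v w" "B w v u = B u v w"
    by (metis s(1,2))+
  show ?thesis by (simp add: s(3-8) e algebra_simps power2_eq_square power3_eq_cube)
qed

lemma cubic_expand2:
  assumes "sym_trilinear B"
  shows "B (x *s u + y *s v) (x *s u + y *s v) (x *s u + y *s v) =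
    x^3 * B u u u + y^3 * B v v v + 3 * x^2 * y * B u u v + 3 * x * y^2 * B u v v"
  using cubic_expand[OF assms, of x u y v 0 0] by simp

lemma quadratic_expand:
  assumes "sym_trilinear B"
  shows "B (x *s u + y *s v) (x *s u + y *s v) w =
    x^2 * B u u w + 2 * x * y * B u v w + y^2 * B v v w"
proof -
  note s = sym_trilinearD[OF assms]
  have "B v u w = B u v w" by (rule s(1))
  then show ?thesis by (simp add: s(3-8) algebra_simps power2_eq_square)
qed

text \<open>A cubic through the three base points has seven coefficients, and the five further
  points leave \<open>k3\<close> and \<open>k4\<close> free. The two products on the right are the
  rows and the columns of the grid in \<open>cubic_pencil\<close>, in normalised
  coordinates.\<close>

lemma pencil_coefficients:
  fixes k1 k2 k3 k4 k5 k6 k7 :: complex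
  assumes F: "\<And>x y z. F x y z = k1 * x^2 * y + k2 * x^2 * z + k3 * x * y^2 + k4 * x * z^2
      + k5 * y^2 * z + k6 * y * z^2 + k7 * x * y * z"
    and v: "F 1 \<gamma> 0 = 0" "F 1 0 \<epsilon> = 0" "F 1 1 1 = 0" "F 1 1 \<delta> = 0" "F 1 \<eta> 1 = 0"
    and nz: "\<gamma> \<noteq> 0" "\<epsilon> \<noteq> 0" "\<delta> \<noteq> 0" "\<delta> \<noteq> 1" "\<eta> \<noteq> 0" "\<eta> \<noteq> 1"
  shows "F x y z = - k4 / \<eta> * (z * (y - x) * (\<eta> * z - (1 - \<epsilon>) * y - \<epsilon> * \<eta> * x))
     - k3 / \<delta> * (y * (z - x) * (\<delta> * y - \<gamma> * \<delta> * x - (1 - \<gamma>) * z))"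
proof -
  have "\<gamma> * (k1 + k3 * \<gamma>) = 0" using v(1) by (simp add: F algebra_simps power2_eq_square)
  then have k1: "k1 = - k3 * \<gamma>" using nz by (auto simp: add_eq_0_iff2)
  have "\<epsilon> * (k2 + k4 * \<epsilon>) = 0" using v(2) by (simp add: F algebra_simps power2_eq_square)
  then have k2: "k2 = - k4 * \<epsilon>" using nz by (auto simp: add_eq_0_iff2)
  have "k1 + k2 + k3 + k4 + k5 + k6 + k7 = 0" using v(3) by (simp add: F)
  then have s: "k7 = - (k1 + k2 + k3 + k4 + k5 + k6)" by algebra
  \<comment> \<open>On the line x = y the cubic already vanishes at (1,1,1), which splits off the
    factor 1 - \<delta>; the distinctness of the two points on that line cancels it.\<close>
  have "(1 - \<delta>) * (k1 + k3 - \<delta> * k4 - \<delta> * k6) = 0"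
  proof -
    have "k1 + k2 * \<delta> + k3 + k4 * \<delta>^2 + k5 * \<delta> + k6 * \<delta>^2 + k7 * \<delta> = 0"
      using v(4) by (simp add: F)
    then show ?thesis using s by algebra
  qed
  then have "k1 + k3 - \<delta> * k4 - \<delta> * k6 = 0" using nz by simp
  then have k6: "k6 = (k1 + k3) / \<delta> - k4" using nz by (simp add: field_simps)
  have "(1 - \<eta>) * (k2 + k4 - \<eta> * k3 - \<eta> * k5) = 0"
  proof -
    have "k1 * \<eta> + k2 + k3 * \<eta>^2 + k4 + k5 * \<eta>^2 + k6 * \<eta> + k7 * \<eta> = 0"
      using v(5) by (simp add: F)
    then show ?thesis using s by algebra
  qed
  then have "k2 + k4 - \<eta> * k3 - \<eta> * k5 = 0" using nz by simp
  then have k5: "k5 = (k2 + k4) / \<eta> - k3" using nz by (simp add: field_simps)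
  have n: "1 / \<delta> * \<delta> = 1" "1 / \<eta> * \<eta> = 1" using nz by auto
  define i j where "i = 1 / \<delta>" and "j = 1 / \<eta>"
  have n: "i * \<delta> = 1" "j * \<eta> = 1" using nz by (auto simp: i_def j_def)
  have q: "t / \<delta> = t * i" "t / \<eta> = t * j" for t by (simp_all add: i_def j_def)
  have "k1 * x^2 * y + k2 * x^2 * z + k3 * x * y^2 + k4 * x * z^2
      + k5 * y^2 * z + k6 * y * z^2 + k7 * x * y * z = - k4 * (z * (y - x) * ((j * \<eta>) * z - (1 - \<epsilon>) * j * y - \<epsilon> * (j * \<eta>) * x))
     - k3 * (y * (z - x) * ((i * \<delta>) * y - \<gamma> * (i * \<delta>) * x - (1 - \<gamma>) * i * z))"
    unfolding n s k6 k5 k1 k2 q by (simp add: algebra_simps power2_eq_square)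
  then show ?thesis
    unfolding F q by (simp add: algebra_simps)
qed

text \<open>The \<open>pij\<close> form a 3 x 3 grid with collinear rows and columns. The corner
  \<open>p33\<close> is left out: both products of lines vanish at any common point of the third row
  and the third column, so such a point lies on every cubic through the other eight.\<close>

lemma cubic_pencil:
  assumes B: "sym_trilinear B"
    and f: "B p11 p11 p11 = 0" "B p12 p12 p12 = 0" "B p13 p13 p13 = 0" "B p21 p21 p21 = 0"
      "B p22 p22 p22 = 0" "B p23 p23 p23 = 0" "B p31 p31 p31 = 0" "B p32 p32 p32 = 0"
    and lines: "det3 p11 p12 p13 = 0" "det3 p21 p22 p23 = 0" "det3 p11 p21 p31 = 0" "det3 p12 p22 p32 = 0"
    and nz: "det3 p11 p12 p21 \<noteq> 0" "det3 p11 p12 p22 \<noteq> 0" "det3 p11 p21 p22 \<noteq> 0" "det3 p12 p21 p22 \<noteq> 0"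
    and nz13: "det3 p12 p21 p13 \<noteq> 0" "det3 p11 p21 p13 \<noteq> 0"
    and nz31: "det3 p12 p21 p31 \<noteq> 0" "det3 p11 p12 p31 \<noteq> 0"
    and nz23: "det3 p12 p21 p23 \<noteq> 0" "det3 p11 p12 p23 \<noteq> 0" "det3 p11 p22 p23 \<noteq> 0"
    and nz32: "det3 p12 p21 p32 \<noteq> 0" "det3 p11 p21 p32 \<noteq> 0" "det3 p11 p22 p32 \<noteq> 0"
  shows "\<exists>\<alpha> \<beta>. \<forall>X. B X X X = \<alpha> * (det3 p12 p13 X * det3 p21 p23 X * det3 p31 p32 X)
      + \<beta> * (det3 p21 p31 X * det3 p12 p32 X * det3 p13 p23 X)"
proof -
  note s = sym_trilinearD[OF B]
  obtain x0 y0 z0 where e22: "p22 = x0 *s p11 + y0 *s p12 + z0 *s p21"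
    and "x0 = det3 p22 p12 p21 / det3 p11 p12 p21" "y0 = det3 p11 p22 p21 / det3 p11 p12 p21"
      "z0 = det3 p11 p12 p22 / det3 p11 p12 p21"
    by (rule basis_coords[OF nz(1)])
  then have n0: "x0 \<noteq> 0" "y0 \<noteq> 0" "z0 \<noteq> 0"
    using nz det3_swap(2)[of p11 p21 p22] by (auto simp: det3_rotate[of p12 p21 p22])
  \<comment> \<open>Rescaling the three base points turns \<open>p22\<close> into the unit point of
    the frame.\<close>
  define a b c where "a = x0 *s p11" and "b = y0 *s p12" and "c = z0 *s p21"
  have p22: "p22 = a + b + c" using e22 by (simp add: a_def b_def c_def)
  define D where "D = det3 a b c"
  have D: "D \<noteq> 0" using n0 nz(1) by (simp add: D_def a_def b_def c_def det3_scale)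
  have co: "det3 a b (x *s a + y *s b + z *s c) = z * D" "det3 a c (x *s a + y *s b + z *s c) = - y * D"
    "det3 b c (x *s a + y *s b + z *s c) = x * D" for x y z
    by (simp_all add: D_def det3_def algebra_simps)
  obtain x1 y1 z1 where e1: "p13 = x1 *s a + y1 *s b + z1 *s c"
    by (rule basis_coords[OF D[unfolded D_def]])
  have z1: "z1 = 0" and nz1: "x1 \<noteq> 0" "y1 \<noteq> 0"
    using co[of x1 y1 z1] lines(1) nz13 D n0 unfolding e1[symmetric]
    by (auto simp: a_def b_def c_def det3_scale)
  obtain x2 y2 z2 where e2: "p31 = x2 *s a + y2 *s b + z2 *s c"
    by (rule basis_coords[OF D[unfolded D_def]])
  have y2: "y2 = 0" and nz2: "x2 \<noteq> 0" "z2 \<noteq> 0"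
    using co[of x2 y2 z2] lines(3) nz31 D n0 unfolding e2[symmetric]
    by (auto simp: a_def b_def c_def det3_scale)
  have co2: "det3 c p22 (x *s a + y *s b + z *s c) = (y - x) * D"
    "det3 b p22 (x *s a + y *s b + z *s c) = (x - z) * D"
    "det3 a p22 (x *s a + y *s b + z *s c) = (z - y) * D" for x y z
    by (simp_all add: p22 D_def det3_def algebra_simps)
  obtain x3 y3 z3 where e3: "p23 = x3 *s a + y3 *s b + z3 *s c"
    by (rule basis_coords[OF D[unfolded D_def]])
  have "y3 = x3" and "x3 \<noteq> 0" "z3 \<noteq> 0" "z3 \<noteq> y3"
    using co[of x3 y3 z3] co2[of x3 y3 z3] lines(2) nz23 D n0 unfolding e3[symmetric]
    by (auto simp: a_def b_def c_def det3_scale)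
  note p3 = this
  obtain x4 y4 z4 where e4: "p32 = x4 *s a + y4 *s b + z4 *s c"
    by (rule basis_coords[OF D[unfolded D_def]])
  have "x4 = z4" and "x4 \<noteq> 0" "y4 \<noteq> 0" "z4 \<noteq> y4"
    using co[of x4 y4 z4] co2[of x4 y4 z4] lines(4) nz32 D n0 unfolding e4[symmetric]
    by (auto simp: a_def b_def c_def det3_scale)
  note p4 = this
  define \<gamma> \<epsilon> \<delta> \<eta> where "\<gamma> = y1 / x1" and "\<epsilon> = z2 / x2" and "\<delta> = z3 / x3" and "\<eta> = y4 / x4"
  have q13: "p13 = x1 *s (1 *s a + \<gamma> *s b + 0 *s c)"
    using e1 z1 nz1 by (simp add: \<gamma>_def vector_add_ldistrib)
  have q31: "p31 = x2 *s (1 *s a + 0 *s b + \<epsilon> *s c)"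
    using e2 y2 nz2 by (simp add: \<epsilon>_def vector_add_ldistrib)
  have q23: "p23 = x3 *s (1 *s a + 1 *s b + \<delta> *s c)"
    using e3 p3 by (simp add: \<delta>_def vector_add_ldistrib)
  have q32: "p32 = x4 *s (1 *s a + \<eta> *s b + 1 *s c)"
    using e4 p4 by (simp add: \<eta>_def vector_add_ldistrib)
  have nn: "\<gamma> \<noteq> 0" "\<epsilon> \<noteq> 0" "\<delta> \<noteq> 0" "\<delta> \<noteq> 1" "\<eta> \<noteq> 0" "\<eta> \<noteq> 1"
    using nz1 nz2 p3 p4 by (auto simp: \<gamma>_def \<epsilon>_def \<delta>_def \<eta>_def)
  define F where "F x y z = B (x *s a + y *s b + z *s c) (x *s a + y *s b + z *s c) (x *s a + y *s b + z *s c)"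
    for x y z
  have fabc: "B a a a = 0" "B b b b = 0" "B c c c = 0"
    using f by (simp_all add: a_def b_def c_def s(6-8))
  have F: "F x y z = 3 * B a a b * x^2 * y + 3 * B a a c * x^2 * z + 3 * B a b b * x * y^2
      + 3 * B a c c * x * z^2 + 3 * B b b c * y^2 * z + 3 * B b c c * y * z^2 + 6 * B a b c * x * y * z" for x y z
    unfolding F_def cubic_expand[OF B] fabc by (simp add: algebra_simps)
  have "F 1 \<gamma> 0 = 0" "F 1 0 \<epsilon> = 0" "F 1 1 1 = 0" "F 1 1 \<delta> = 0" "F 1 \<eta> 1 = 0"
    using f(3,5,6,7,8) nz1 nz2 p3(2) p4(2) unfolding F_def q13 q31 q23 q32 s(6-8) by (auto simp: p22)
  note P = pencil_coefficients[of F, OF F this nn]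
  have db: "det3 p12 V X = det3 b V X / y0" and dc: "det3 p21 V X = det3 c V X / z0" for V X
    using n0 by (simp_all add: b_def c_def det3_scale)
  have R: "det3 p12 p13 X * det3 p21 p23 X * det3 p31 p32 X =
      - (x1 * x2 * x3 * x4 / (y0 * z0)) * D^3 * (z * (y - x) * (\<eta> * z - (1 - \<epsilon>) * y - \<epsilon> * \<eta> * x))"
    if X: "X = x *s a + y *s b + z *s c" for X x y z
  proof -
    have f1: "det3 p12 p13 X = (- x1 * z * D) / y0"
    proof -
      have e: "det3 b (1 *s a + \<gamma> *s b + 0 *s c) X = - z * D"
        unfolding X D_def by (simp add: det3_def algebra_simps)
      show ?thesis unfolding q13 det3_scale db e using n0 by (simp add: field_simps)
    qed
    have f2: "det3 p21 p23 X = (x3 * (y - x) * D) / z0"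
    proof -
      have e: "det3 c (1 *s a + 1 *s b + \<delta> *s c) X = (y - x) * D"
        unfolding X D_def by (simp add: det3_def algebra_simps)
      show ?thesis unfolding q23 det3_scale dc e using n0 by (simp add: field_simps)
    qed
    have f3: "det3 p31 p32 X = x2 * x4 * (\<eta> * z - (1 - \<epsilon>) * y - \<epsilon> * \<eta> * x) * D"
      unfolding q31 q32 X det3_scale det3_coords D_def by (simp add: algebra_simps)
    show ?thesis unfolding f1 f2 f3 using n0 by (simp add: field_simps power3_eq_cube)
  qed
  have C: "det3 p21 p31 X * det3 p12 p32 X * det3 p13 p23 X =
      (x1 * x2 * x3 * x4 / (y0 * z0)) * D^3 * (y * (z - x) * (\<delta> * y - \<gamma> * \<delta> * x - (1 - \<gamma>) * z))"
    if X: "X = x *s a + y *s b + z *s c" for X x y z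
  proof -
    have f1: "det3 p21 p31 X = (x2 * y * D) / z0"
    proof -
      have e: "det3 c (1 *s a + 0 *s b + \<epsilon> *s c) X = y * D"
        unfolding X D_def by (simp add: det3_def algebra_simps)
      show ?thesis unfolding q31 det3_scale dc e using n0 by (simp add: field_simps)
    qed
    have f2: "det3 p12 p32 X = (- x4 * (z - x) * D) / y0"
    proof -
      have e: "det3 b (1 *s a + \<eta> *s b + 1 *s c) X = - (z - x) * D"
        unfolding X D_def by (simp add: det3_def algebra_simps)
      show ?thesis unfolding q32 det3_scale db e using n0 by (simp add: field_simps)
    qed
    have f3: "det3 p13 p23 X = - x1 * x3 * (\<delta> * y - \<gamma> * \<delta> * x - (1 - \<gamma>) * z) * D"
      unfolding q13 q23 X det3_scale det3_coords D_def by (simp add: algebra_simps)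
    show ?thesis unfolding f1 f2 f3 using n0 by (simp add: field_simps power3_eq_cube)
  qed
  define \<kappa> where "\<kappa> = (x1 * x2 * x3 * x4 / (y0 * z0)) * D^3"
  have \<kappa>: "\<kappa> \<noteq> 0" using n0 nz1 nz2 p3 p4 D by (simp add: \<kappa>_def)
  show ?thesis
  proof (intro exI allI)
    fix X
    obtain x y z where X: "X = x *s a + y *s b + z *s c"
      by (rule basis_coords[OF D[unfolded D_def]])
    define U V where "U = z * (y - x) * (\<eta> * z - (1 - \<epsilon>) * y - \<epsilon> * \<eta> * x)"
      and "V = y * (z - x) * (\<delta> * y - \<gamma> * \<delta> * x - (1 - \<gamma>) * z)"
    have r: "det3 p12 p13 X * det3 p21 p23 X * det3 p31 p32 X = - \<kappa> * U"
      "det3 p21 p31 X * det3 p12 p32 X * det3 p13 p23 X = \<kappa> * V"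
      using R[OF X] C[OF X] by (simp_all add: \<kappa>_def U_def V_def)
    have "B X X X = - (3 * B a c c) / \<eta> * U - (3 * B a b b) / \<delta> * V"
      using P[of x y z] by (simp add: F_def X U_def V_def)
    then show "B X X X = (3 * B a c c / \<eta> / \<kappa>) * (det3 p12 p13 X * det3 p21 p23 X * det3 p31 p32 X)
      + (- (3 * B a b b / \<delta> / \<kappa>)) * (det3 p21 p31 X * det3 p12 p32 X * det3 p13 p23 X)"
      unfolding r using \<kappa> by (simp add: mult.assoc)
  qed
qed

text \<open>This is the grid with \<open>p11 = p21 = u\<close>, whose first column is the tangent at
  \<open>u\<close>. On the line \<open>u v\<close> the cubic and the product of the three columns
  have the same zeros \<open>u\<close>, \<open>v\<close>, \<open>p13\<close>, and on
  \<open>u w\<close> the zeros \<open>u\<close>, \<open>w\<close>, \<open>p23\<close>. Comparing the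
  first-order terms at \<open>u\<close> shows that one constant \<kappa> serves both lines, so the
  difference is divisible by both, and the quotient \<open>M\<close> is the third row.\<close>

lemma cubic_tangent_form:
  assumes B: "sym_trilinear B"
    and f: "B u u u = 0" "B v v v = 0" "B w w w = 0" "B p13 p13 p13 = 0" "B p23 p23 p23 = 0"
    and D: "det3 u v w \<noteq> 0" and a: "B u u v \<noteq> 0" and b: "B u u w \<noteq> 0"
    and p13: "det3 u v p13 = 0" "det3 u w p13 \<noteq> 0" "det3 v w p13 \<noteq> 0"
    and p23: "det3 u w p23 = 0" "det3 u v p23 \<noteq> 0" "det3 v w p23 \<noteq> 0"
  obtains \<kappa> M where "\<kappa> \<noteq> 0" "\<And>x y. M (x + y) = M x + M y" "\<And>k x. M (k *s x) = k * M x"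
    "\<And>X. B X X X = \<kappa> * B u u X * det3 v w X * det3 p13 p23 X + det3 u v X * det3 u w X * M X"
proof -
  note s = sym_trilinearD[OF B]
  obtain x1 y1 z1 where e1: "p13 = x1 *s u + y1 *s v + z1 *s w" by (rule basis_coords[OF D])
  obtain x2 y2 z2 where e2: "p23 = x2 *s u + y2 *s v + z2 *s w" by (rule basis_coords[OF D])
  have co: "det3 u v (x *s u + y *s v + z *s w) = z * det3 u v w"
    "det3 u w (x *s u + y *s v + z *s w) = - y * det3 u v w"
    "det3 v w (x *s u + y *s v + z *s w) = x * det3 u v w" for x y z
    by (simp_all add: det3_def algebra_simps)
  have n1: "z1 = 0" "y1 \<noteq> 0" "x1 \<noteq> 0" using p13 co[of x1 y1 z1] e1 by auto
  have n2: "y2 = 0" "z2 \<noteq> 0" "x2 \<noteq> 0" using p23 co[of x2 y2 z2] e2 by auto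
  have "3 * x1^2 * y1 * B u u v + 3 * x1 * y1^2 * B u v v = 0"
    using f(4) unfolding e1 cubic_expand[OF B] using f(1-3) n1 by simp
  then have "3 * x1 * y1 * (x1 * B u u v + y1 * B u v v) = 0"
    by algebra
  then have "x1 * B u u v + y1 * B u v v = 0" using n1 by simp
  then have c: "x1 = - y1 * B u v v / B u u v" using n1 a by (simp add: field_simps eq_neg_iff_add_eq_0)
  have "3 * x2^2 * z2 * B u u w + 3 * x2 * z2^2 * B u w w = 0"
    using f(5) unfolding e2 cubic_expand[OF B] using f(1-3) n2 by simp
  then have "3 * x2 * z2 * (x2 * B u u w + z2 * B u w w) = 0"
    by algebra
  then have "x2 * B u u w + z2 * B u w w = 0" using n2 by simp
  then have d: "x2 = - z2 * B u w w / B u u w" using n2 b by (simp add: field_simps eq_neg_iff_add_eq_0)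
  define D where "D = det3 u v w"
  have D0: "D \<noteq> 0" using D by (simp add: D_def)
  have chord: "det3 p13 p23 (x *s u + y *s v + z *s w)
      = D * y1 * z2 * (x + B u v v / B u u v * y + B u w w / B u u w * z)" for x y z
    unfolding e1 e2 det3_coords D_def n1(1) n2(1) c d using a b by (simp add: field_simps)
  define h where "h = 6 * B u v w - 3 * B u u v * B u w w / B u u w - 3 * B u u w * B u v v / B u u v"
  define M where "M X = - (h * det3 v w X - 3 * B v v w * det3 u w X + 3 * B v w w * det3 u v X) / D ^ 3" for X
  define \<kappa> where "\<kappa> = 3 / (D ^ 2 * y1 * z2)"
  have "B X X X = \<kappa> * B u u X * det3 v w X * det3 p13 p23 X + det3 u v X * det3 u w X * M X" for X
  proof -
    obtain x y z where X: "X = x *s u + y *s v + z *s w" by (rule basis_coords[OF D])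
    have u: "B u u X = y * B u u v + z * B u u w" unfolding X by (simp add: s f)
    have "B X X X = (3 * B u u v * y + 3 * B u u w * z) * x * (x + B u v v / B u u v * y + B u w w / B u u w * z)
        + y * z * (h * x + 3 * B v v w * y + 3 * B v w w * z)"
      unfolding X cubic_expand[OF B] h_def using a b f by (simp add: field_simps power2_eq_square)
    also have "\<dots> = 3 * B u u X * x * (x + B u v v / B u u v * y + B u w w / B u u w * z)
        + y * z * (h * x + 3 * B v v w * y + 3 * B v w w * z)"
      by (simp add: u algebra_simps)
    also have "y * z * (h * x + 3 * B v v w * y + 3 * B v w w * z) = det3 u v X * det3 u w X * M X"
      unfolding X co M_def D_def[symmetric] using D0 by (simp add: field_simps power3_eq_cube)
    also have "3 * B u u X * x * (x + B u v v / B u u v * y + B u w w / B u u w * z)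
       = \<kappa> * B u u X * det3 v w X * det3 p13 p23 X"
    proof -
      have e: "\<kappa> * k * (x * D) * (D * y1 * z2 * l) = 3 * k * x * l" for k l
        using D0 n1 n2 by (simp add: \<kappa>_def power2_eq_square)
      show ?thesis unfolding X co chord D_def[symmetric] by (rule e[symmetric])
    qed
    finally show ?thesis .
  qed
  moreover have "M (x + y) = M x + M y" "M (k *s x) = k * M x" for x y k
    unfolding M_def det3_add det3_scale using D0 by (simp_all add: field_simps)
  moreover have "\<kappa> \<noteq> 0" using D0 n1 n2 by (simp add: \<kappa>_def)
  ultimately show ?thesis using that by blast
qed

text \<open>\<open>M\<close> vanishes at \<open>p32\<close> and \<open>p33\<close>, hence on the
  third row. At \<open>p31\<close> the cubic then reduces to the column product, and of its factors
  only the tangent can vanish there.\<close>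

lemma grid_tangent:
  assumes B: "sym_trilinear B"
    and f: "B u u u = 0" "B v v v = 0" "B w w w = 0" "B p13 p13 p13 = 0" "B p23 p23 p23 = 0"
      "B p31 p31 p31 = 0" "B p32 p32 p32 = 0" "B p33 p33 p33 = 0"
    and D: "det3 u v w \<noteq> 0" and a: "B u u v \<noteq> 0" and b: "B u u w \<noteq> 0"
    and p13: "det3 u v p13 = 0" "det3 u w p13 \<noteq> 0" "det3 v w p13 \<noteq> 0"
    and p23: "det3 u w p23 = 0" "det3 u v p23 \<noteq> 0" "det3 v w p23 \<noteq> 0"
    and p32: "det3 v w p32 = 0" "det3 u v p32 \<noteq> 0" "det3 u w p32 \<noteq> 0"
    and p33: "det3 p13 p23 p33 = 0" "det3 u v p33 \<noteq> 0" "det3 u w p33 \<noteq> 0"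
    and p31: "det3 p32 p33 p31 = 0" "indep2 p32 p33" "det3 v w p31 \<noteq> 0" "det3 p13 p23 p31 \<noteq> 0"
  shows "B u u p31 = 0"
proof -
  obtain \<kappa> M where \<kappa>: "\<kappa> \<noteq> 0" and M: "\<And>x y. M (x + y) = M x + M y" "\<And>k x. M (k *s x) = k * M x"
    and F: "\<And>X. B X X X = \<kappa> * B u u X * det3 v w X * det3 p13 p23 X + det3 u v X * det3 u w X * M X"
    by (rule cubic_tangent_form[OF B f(1-5) D a b p13 p23]) blast
  have "M p33 = 0" using F[of p33] f(8) p33 by simp
  moreover have "M p32 = 0" using F[of p32] f(7) p32 by simp
  moreover obtain s t where "p31 = s *s p32 + t *s p33"
    using line_coords p31 by metis
  ultimately have "M p31 = 0" by (simp add: M)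
  then show ?thesis using F[of p31] f(6) p31 \<kappa> by simp
qed

text \<open>The same grid read in the other direction: the tangent condition at \<open>p31\<close>
  is known, and the third column is concluded.\<close>

lemma grid_chord:
  assumes B: "sym_trilinear B"
    and f: "B u u u = 0" "B v v v = 0" "B w w w = 0" "B p13 p13 p13 = 0" "B p23 p23 p23 = 0"
      "B p31 p31 p31 = 0" "B p32 p32 p32 = 0" "B p33 p33 p33 = 0"
    and D: "det3 u v w \<noteq> 0" and a: "B u u v \<noteq> 0" and b: "B u u w \<noteq> 0"
    and p13: "det3 u v p13 = 0" "det3 u w p13 \<noteq> 0" "det3 v w p13 \<noteq> 0"
    and p23: "det3 u w p23 = 0" "det3 u v p23 \<noteq> 0" "det3 v w p23 \<noteq> 0"
    and p31: "B u u p31 = 0" "det3 u v p31 \<noteq> 0" "det3 u w p31 \<noteq> 0"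
    and p32: "det3 v w p32 = 0" "det3 u v p32 \<noteq> 0" "det3 u w p32 \<noteq> 0"
    and p33: "det3 p31 p32 p33 = 0" "indep2 p31 p32" "B u u p33 \<noteq> 0" "det3 v w p33 \<noteq> 0"
  shows "det3 p13 p23 p33 = 0"
proof -
  obtain \<kappa> M where \<kappa>: "\<kappa> \<noteq> 0" and M: "\<And>x y. M (x + y) = M x + M y" "\<And>k x. M (k *s x) = k * M x"
    and F: "\<And>X. B X X X = \<kappa> * B u u X * det3 v w X * det3 p13 p23 X + det3 u v X * det3 u w X * M X"
    by (rule cubic_tangent_form[OF B f(1-5) D a b p13 p23]) blast
  have "M p31 = 0" using F[of p31] f(6) p31 by simp
  moreover have "M p32 = 0" using F[of p32] f(7) p32 by simp
  moreover obtain s t where "p33 = s *s p31 + t *s p32"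
    using line_coords p33 by metis
  ultimately have "M p33 = 0" by (simp add: M)
  then show ?thesis using F[of p33] f(8) p33 \<kappa> by simp
qed

text \<open>Degenerate case of \<open>grid_chord\<close>: \<open>p31\<close> and \<open>p33\<close> coincide and the third row is a tangent line.\<close>

lemma grid_chord_tangent:
  assumes B: "sym_trilinear B"
    and f: "B u u u = 0" "B v v v = 0" "B w w w = 0" "B p13 p13 p13 = 0" "B p23 p23 p23 = 0"
      "B k k k = 0" "B r r r = 0"
    and D: "det3 u v w \<noteq> 0" and a: "B u u v \<noteq> 0" and b: "B u u w \<noteq> 0"
    and p13: "det3 u v p13 = 0" "det3 u w p13 \<noteq> 0" "det3 v w p13 \<noteq> 0"
    and p23: "det3 u w p23 = 0" "det3 u v p23 \<noteq> 0" "det3 v w p23 \<noteq> 0"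
    and k: "B u u k = 0" "det3 u v k \<noteq> 0" "det3 u w k \<noteq> 0" "det3 v w k \<noteq> 0"
    and r: "det3 v w r = 0" "det3 u v r \<noteq> 0" "det3 u w r \<noteq> 0" "B u u r \<noteq> 0"
    and kr: "B k k r = 0"
  shows "det3 p13 p23 k = 0"
proof -
  note s = sym_trilinearD[OF B]
  obtain \<kappa> M where \<kappa>: "\<kappa> \<noteq> 0" and M: "\<And>x y. M (x + y) = M x + M y" "\<And>k x. M (k *s x) = k * M x"
    and F: "\<And>X. B X X X = \<kappa> * B u u X * det3 v w X * det3 p13 p23 X + det3 u v X * det3 u w X * M X"
    by (rule cubic_tangent_form[OF B f(1-5) D a b p13 p23]) blast
  have Mk: "M k = 0" using F[of k] f(6) k by simp
  have Mr: "M r = 0" using F[of r] f(7) r by simp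
  have e1: "B (1 *s k + t *s r) (1 *s k + t *s r) (1 *s k + t *s r) = 3 * t^2 * B k r r" for t
    unfolding cubic_expand2[OF B] using f(6,7) kr by simp
  have e2: "B (1 *s k + t *s r) (1 *s k + t *s r) (1 *s k + t *s r) =
      \<kappa> * (t * B u u r) * det3 v w k * (det3 p13 p23 k + t * det3 p13 p23 r)" for t
    unfolding F det3_add det3_scale M Mk Mr s(5) s(8) k(1) r(1) by simp
  \<comment> \<open>Along the line \<open>k r\<close> the tangency at \<open>k\<close> leaves no
    term linear in \<open>t\<close>, whereas the product form has one with coefficient proportional
    to \<open>det3 p13 p23 k\<close>. The values at 1 and -1 isolate it.\<close>
  have "\<kappa> * B u u r * det3 v w k * (det3 p13 p23 k + det3 p13 p23 r) = 3 * B k r r"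
    "- (\<kappa> * B u u r * det3 v w k * (det3 p13 p23 k - det3 p13 p23 r)) = 3 * B k r r"
    using e1[of 1] e2[of 1] e1[of "-1"] e2[of "-1"] by simp_all
  then have "2 * (\<kappa> * B u u r * det3 v w k) * det3 p13 p23 k = 0" by algebra
  then show ?thesis using \<kappa> k r by simp
qed

section \<open>The cubic of a configuration\<close>

text \<open>Integer indices read modulo 7 allow shifts and halving (multiplication by 4) without
  reduction. Side conditions become divisibility of index differences, which simplification decides
  when the indices are numeral shifts of one variable.\<close>

definition m7_config :: "(int \<Rightarrow> vec3) \<Rightarrow> (int \<Rightarrow> vec3) \<Rightarrow> bool" where
  "m7_config q r \<longleftrightarrow>
     (\<forall>a b. 7 dvd a - b \<longrightarrow> q a = q b \<and> r a = r b) \<and>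
     (\<forall>a b c. \<not> 7 dvd a - b \<and> \<not> 7 dvd b - c \<and> \<not> 7 dvd a - c \<longrightarrow> det3 (q a) (q b) (q c) \<noteq> 0) \<and>
     (\<forall>a b c. \<not> 7 dvd a - b \<longrightarrow> (det3 (q a) (q b) (r c) = 0 \<longleftrightarrow> 7 dvd a + b - 2 * c)) \<and>
     (\<forall>a b c. \<not> 7 dvd b - c \<longrightarrow> det3 (q a) (r b) (r c) \<noteq> 0) \<and>
     (\<forall>a b c. \<not> 7 dvd a - b \<and> \<not> 7 dvd b - c \<and> \<not> 7 dvd a - c \<longrightarrow> det3 (r a) (r b) (r c) \<noteq> 0)"

lemma m7_configD:
  assumes "m7_config q r"
  shows config_per: "7 dvd a - b \<Longrightarrow> q a = q b" "7 dvd a - b \<Longrightarrow> r a = r b"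
    and config_qqq: "\<not> 7 dvd a - b \<Longrightarrow> \<not> 7 dvd b - c \<Longrightarrow> \<not> 7 dvd a - c \<Longrightarrow> det3 (q a) (q b) (q c) \<noteq> 0"
    and config_rrr: "\<not> 7 dvd a - b \<Longrightarrow> \<not> 7 dvd b - c \<Longrightarrow> \<not> 7 dvd a - c \<Longrightarrow> det3 (r a) (r b) (r c) \<noteq> 0"
    and config_qqr: "\<not> 7 dvd a - b \<Longrightarrow> det3 (q a) (q b) (r c) = 0 \<longleftrightarrow> 7 dvd a + b - 2 * c"
      "\<not> 7 dvd a - b \<Longrightarrow> det3 (q a) (r c) (q b) = 0 \<longleftrightarrow> 7 dvd a + b - 2 * c"
      "\<not> 7 dvd a - b \<Longrightarrow> det3 (r c) (q a) (q b) = 0 \<longleftrightarrow> 7 dvd a + b - 2 * c"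
    and config_qrr: "\<not> 7 dvd b - c \<Longrightarrow> det3 (q a) (r b) (r c) \<noteq> 0"
      "\<not> 7 dvd b - c \<Longrightarrow> det3 (r b) (q a) (r c) \<noteq> 0" "\<not> 7 dvd b - c \<Longrightarrow> det3 (r b) (r c) (q a) \<noteq> 0"
proof -
  have "det3 (q a) (r c) (q b) = - det3 (q a) (q b) (r c)" "det3 (r b) (q a) (r c) = - det3 (q a) (r b) (r c)"
    for a b c
    by (rule det3_swap)+
  moreover have "det3 (r c) (q a) (q b) = det3 (q a) (q b) (r c)"
    "det3 (r b) (r c) (q a) = det3 (q a) (r b) (r c)" for a b c
    by (rule det3_rotate[symmetric], rule det3_rotate)
  ultimately show "7 dvd a - b \<Longrightarrow> q a = q b" "7 dvd a - b \<Longrightarrow> r a = r b"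
    "\<not> 7 dvd a - b \<Longrightarrow> \<not> 7 dvd b - c \<Longrightarrow> \<not> 7 dvd a - c \<Longrightarrow> det3 (q a) (q b) (q c) \<noteq> 0"
    "\<not> 7 dvd a - b \<Longrightarrow> \<not> 7 dvd b - c \<Longrightarrow> \<not> 7 dvd a - c \<Longrightarrow> det3 (r a) (r b) (r c) \<noteq> 0"
    "\<not> 7 dvd a - b \<Longrightarrow> det3 (q a) (q b) (r c) = 0 \<longleftrightarrow> 7 dvd a + b - 2 * c"
    "\<not> 7 dvd a - b \<Longrightarrow> det3 (q a) (r c) (q b) = 0 \<longleftrightarrow> 7 dvd a + b - 2 * c"
    "\<not> 7 dvd a - b \<Longrightarrow> det3 (r c) (q a) (q b) = 0 \<longleftrightarrow> 7 dvd a + b - 2 * c"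
    "\<not> 7 dvd b - c \<Longrightarrow> det3 (q a) (r b) (r c) \<noteq> 0"
    "\<not> 7 dvd b - c \<Longrightarrow> det3 (r b) (q a) (r c) \<noteq> 0" "\<not> 7 dvd b - c \<Longrightarrow> det3 (r b) (r c) (q a) \<noteq> 0"
    using assms unfolding m7_config_def by (simp_all only: neg_equal_0_iff_equal not_False_eq_True)
qed

text \<open>The rows and columns of the grid \<open>(r\<^sub>0, q\<^sub>1, q\<^sub>6), (q\<^sub>5, r\<^sub>4, q\<^sub>3), (q\<^sub>2, q\<^sub>0, r\<^sub>1)\<close> span the pencil of
  cubics through its nine points; the member through \<open>q\<^sub>4\<close> contains the whole configuration.\<close>

definition row_form :: "(int \<Rightarrow> vec3) \<Rightarrow> vec3 \<Rightarrow> vec3 \<Rightarrow> vec3 \<Rightarrow> complex" where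
  "row_form q x y z = det3 (q 1) (q 6) x * det3 (q 5) (q 3) y * det3 (q 2) (q 0) z"

definition col_form :: "(int \<Rightarrow> vec3) \<Rightarrow> vec3 \<Rightarrow> vec3 \<Rightarrow> vec3 \<Rightarrow> complex" where
  "col_form q x y z = det3 (q 5) (q 2) x * det3 (q 1) (q 0) y * det3 (q 6) (q 3) z"

text \<open>Polarisation without division by 6, whence the factor 6 in
  \<open>m7_cubic_diag\<close>.\<close>

definition symmetrize :: "(vec3 \<Rightarrow> vec3 \<Rightarrow> vec3 \<Rightarrow> complex) \<Rightarrow> vec3 \<Rightarrow> vec3 \<Rightarrow> vec3 \<Rightarrow> complex" where
  "symmetrize G x y z = G x y z + G x z y + G y x z + G y z x + G z x y + G z y x"

definition m7_cubic :: "(int \<Rightarrow> vec3) \<Rightarrow> vec3 \<Rightarrow> vec3 \<Rightarrow> vec3 \<Rightarrow> complex" where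
  "m7_cubic q x y z = symmetrize (row_form q) x y z * col_form q (q 4) (q 4) (q 4)
     - symmetrize (col_form q) x y z * row_form q (q 4) (q 4) (q 4)"

lemma sym_trilinear_m7_cubic: "sym_trilinear (m7_cubic q)"
  unfolding sym_trilinear_def m7_cubic_def symmetrize_def
  by (simp add: row_form_def col_form_def det3_add det3_scale algebra_simps)

lemma m7_cubic_diag:
  "m7_cubic q x x x = 6 * (row_form q x x x * col_form q (q 4) (q 4) (q 4)
     - col_form q x x x * row_form q (q 4) (q 4) (q 4))"
  by (simp add: m7_cubic_def symmetrize_def algebra_simps)

lemma residue7_cases:
  fixes a :: int
  obtains k where "k \<in> {0, 1, 2, 3, 4, 5, 6}" "7 dvd a - k"
proof
  have "0 \<le> a mod 7" "a mod 7 < 7" by simp_all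
  then show "a mod 7 \<in> {0, 1, 2, 3, 4, 5, 6}" by auto
  show "7 dvd a - a mod 7" by (simp add: dvd_minus_mod)
qed

text \<open>Congruences are settled by certificates: the multiplier \<open>k\<close> and the
  multiple \<open>7 * m\<close> given at the call leave only a ring identity. \<open>ndvd7\<close>
  is the negative counterpart.\<close>

lemma dvd7:
  fixes x y :: int
  assumes "7 dvd x" "y = k * x + 7 * m"
  shows "7 dvd y"
  using assms by simp

lemma ndvd7:
  fixes x y :: int
  assumes "\<not> 7 dvd x" "x = k * y + 7 * m"
  shows "\<not> 7 dvd y"
  using assms by auto

lemma dvd7_cong:
  fixes a b :: int
  assumes "7 dvd a - b"
  shows "7 dvd a \<longleftrightarrow> 7 dvd b"
  using dvd_diff[of 7 a "a - b"] dvd_add[of 7 "a - b" b] assms by auto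

lemma residue7_third:
  fixes i j :: int
  obtains k where "\<not> 7 dvd k - i" "\<not> 7 dvd k - j"
proof -
  have "\<not> 7 dvd (i + 1) - i \<and> \<not> 7 dvd (i + 1) - j \<or> \<not> 7 dvd (i + 2) - i \<and> \<not> 7 dvd (i + 2) - j"
    using dvd_diff[of 7 "(i + 2) - j" "(i + 1) - j"] by auto
  then show ?thesis using that by blast
qed

lemma m7_cubic_q:
  assumes "m7_config q r"
  shows "m7_cubic q (q a) (q a) (q a) = 0"
proof -
  obtain k where k: "k \<in> {0, 1, 2, 3, 4, 5, 6}" "7 dvd a - k" by (rule residue7_cases)
  have "m7_cubic q (q k) (q k) (q k) = 0"
    using k(1) by (auto simp: m7_cubic_diag row_form_def col_form_def)
  then show ?thesis using config_per(1)[OF assms k(2)] by simp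
qed

text \<open>The grid behind \<open>row_form\<close> and \<open>col_form\<close>, shifted by
  \<open>s\<close>; its ninth point is \<open>r (s + 1)\<close>.\<close>

lemma grid_q:
  assumes c: "m7_config q r" and B: "sym_trilinear B" and f: "\<And>a. B (q a) (q a) (q a) = 0"
    and r: "B (r s) (r s) (r s) = 0" "B (r (s + 4)) (r (s + 4)) (r (s + 4)) = 0"
  shows "\<exists>\<alpha> \<beta>. \<forall>X. B X X X =
     \<alpha> * (det3 (q (s + 1)) (q (s + 6)) X * det3 (q (s + 5)) (q (s + 3)) X * det3 (q (s + 2)) (q s) X)
     + \<beta> * (det3 (q (s + 5)) (q (s + 2)) X * det3 (q (s + 1)) (q s) X * det3 (q (s + 6)) (q (s + 3)) X)"
  by (rule cubic_pencil[OF B, of "r s" _ _ _ "r (s + 4)"])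
    (simp_all add: f r m7_configD[OF c])

lemma cubic_next_r:
  assumes c: "m7_config q r" and B: "sym_trilinear B" and f: "\<And>a. B (q a) (q a) (q a) = 0"
    and r: "B (r s) (r s) (r s) = 0" "B (r (s + 4)) (r (s + 4)) (r (s + 4)) = 0"
  shows "B (r (s + 1)) (r (s + 1)) (r (s + 1)) = 0"
proof -
  have "det3 (q (s + 2)) (q s) (r (s + 1)) = 0" "det3 (q (s + 6)) (q (s + 3)) (r (s + 1)) = 0"
    by (simp_all add: m7_configD[OF c])
  then show ?thesis using grid_q[OF c B f r] by auto
qed

lemma cubic_all_r:
  assumes c: "m7_config q r" and B: "sym_trilinear B" and f: "\<And>a. B (q a) (q a) (q a) = 0"
    and r: "B (r 0) (r 0) (r 0) = 0" "B (r 4) (r 4) (r 4) = 0"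
  shows "B (r a) (r a) (r a) = 0"
proof -
  note n = cubic_next_r[OF c B f]
  have p: "r 8 = r 1" "r 9 = r 2" "r 12 = r 5" by (rule config_per(2)[OF c]; simp)+
  have p': "r 6 = r (5 + 1)" by simp
  \<comment> \<open>The pairs \<open>(s, s + 4)\<close> used are (0,4), (4,1), (1,5), (5,2), (2,6),
    a chain that reaches every residue.\<close>
  have r1: "B (r 1) (r 1) (r 1) = 0" using n[of 0] r by simp
  have r5: "B (r 5) (r 5) (r 5) = 0" using n[of 4] r r1 p by simp
  have r2: "B (r 2) (r 2) (r 2) = 0" using n[of 1] r1 r5 by simp
  have r6: "B (r 6) (r 6) (r 6) = 0" using n[of 5] r2 r5 p by simp
  have r3: "B (r 3) (r 3) (r 3) = 0" using n[of 2] r2 r6 by simp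
  obtain k where k: "k \<in> {0, 1, 2, 3, 4, 5, 6}" "7 dvd a - k" by (rule residue7_cases)
  have "B (r k) (r k) (r k) = 0" using k(1) r r1 r2 r3 r5 r6 by auto
  then show ?thesis using config_per(2)[OF c k(2)] by simp
qed

lemma m7_cubic_r:
  assumes c: "m7_config q r"
  shows "m7_cubic q (r a) (r a) (r a) = 0"
proof (rule cubic_all_r[OF c sym_trilinear_m7_cubic m7_cubic_q[OF c]])
  have "det3 (q 1) (q 6) (r 0) = 0" "det3 (q 5) (q 2) (r 0) = 0"
    "det3 (q 5) (q 3) (r 4) = 0" "det3 (q 1) (q 0) (r 4) = 0"
    by (simp_all add: m7_configD[OF c])
  then show "m7_cubic q (r 0) (r 0) (r 0) = 0" "m7_cubic q (r 4) (r 4) (r 4) = 0"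
    by (simp_all add: m7_cubic_diag row_form_def col_form_def)
qed

text \<open>Among the \<open>q\<close>'s only \<open>q 4\<close> is off the grid, so passing through
  it fixes the ratio of the two coefficients of the pencil.\<close>

lemma m7_cubic_unique:
  assumes c: "m7_config q r" and B: "sym_trilinear B" and f: "\<And>a. B (q a) (q a) (q a) = 0"
    and r: "B (r 0) (r 0) (r 0) = 0" "B (r 4) (r 4) (r 4) = 0"
  shows "\<exists>\<kappa>. \<forall>X. B X X X = \<kappa> * m7_cubic q X X X"
proof -
  obtain \<alpha> \<beta> where ab: "B X X X = \<alpha> * row_form q X X X + \<beta> * col_form q X X X" for X
    using grid_q[OF c B f, of 0] r unfolding row_form_def col_form_def by auto
  have n: "col_form q (q 4) (q 4) (q 4) \<noteq> 0"
    by (simp add: col_form_def m7_configD[OF c])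
  have "\<alpha> * row_form q (q 4) (q 4) (q 4) + \<beta> * col_form q (q 4) (q 4) (q 4) = 0"
    using ab f by metis
  then have \<beta>: "\<beta> = - \<alpha> * row_form q (q 4) (q 4) (q 4) / col_form q (q 4) (q 4) (q 4)"
    using n by (simp add: field_simps eq_neg_iff_add_eq_0)
  have "B X X X = \<alpha> / (6 * col_form q (q 4) (q 4) (q 4)) * m7_cubic q X X X" for X
    unfolding ab m7_cubic_diag \<beta> using n by (simp add: field_simps)
  then show ?thesis by blast
qed

lemma m7_cubic_nonzero:
  assumes c: "m7_config q r"
  shows "\<exists>X. m7_cubic q X X X \<noteq> 0"
proof -
  have n: "det3 (q 5) (q 2) (q 6) \<noteq> 0" "det3 (q 1) (q 0) (q 6) \<noteq> 0" "det3 (q 6) (q 3) (q 1) \<noteq> 0"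
    "row_form q (q 4) (q 4) (q 4) \<noteq> 0"
    by (simp_all add: row_form_def m7_configD[OF c])
  \<comment> \<open>On the row line through \<open>q 1\<close> and \<open>q 6\<close> the row form
    vanishes. It remains to choose the point so that none of the three column lines contains it, and
    one of the values 1 and 2 of \<open>t\<close> does.\<close>
  have "\<exists>t. t \<noteq> 0 \<and> det3 (q 5) (q 2) (q 1) + t * det3 (q 5) (q 2) (q 6) \<noteq> 0"
  proof (cases "det3 (q 5) (q 2) (q 1) + 1 * det3 (q 5) (q 2) (q 6) = 0")
    case True
    then have "det3 (q 5) (q 2) (q 1) + 2 * det3 (q 5) (q 2) (q 6) \<noteq> 0"
      using n(1) by (simp add: eq_neg_iff_add_eq_0[symmetric])
    then show ?thesis by (metis zero_neq_numeral)
  qed (metis zero_neq_one)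
  then obtain t where t: "t \<noteq> 0" "det3 (q 5) (q 2) (q 1) + t * det3 (q 5) (q 2) (q 6) \<noteq> 0" by blast
  have "m7_cubic q (q 1 + t *s q 6) (q 1 + t *s q 6) (q 1 + t *s q 6) \<noteq> 0"
    unfolding m7_cubic_diag using n t
    by (simp add: row_form_def col_form_def det3_add det3_scale)
  then show ?thesis by blast
qed

text \<open>\<open>r t\<close> is the ninth point of the grid with rows
  \<open>p (t+1), p (t+2), q (t+5)\<close>, then \<open>p (t+5), p (t+6), q (t+2)\<close>, then
  \<open>q (t+3), q (t+4), r t\<close>.\<close>

lemma m7_cubic_two_steps:
  assumes c: "m7_config p q" and c': "m7_config q r"
  shows "m7_cubic p (r t) (r t) (r t) = 0"
proof -
  note f = m7_cubic_q[OF c] m7_cubic_r[OF c]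
  have "\<exists>\<alpha> \<beta>. \<forall>X. m7_cubic p X X X =
     \<alpha> * (det3 (p (t + 2)) (q (t + 5)) X * det3 (p (t + 5)) (q (t + 2)) X * det3 (q (t + 3)) (q (t + 4)) X)
     + \<beta> * (det3 (p (t + 5)) (q (t + 3)) X * det3 (p (t + 2)) (q (t + 4)) X * det3 (q (t + 5)) (q (t + 2)) X)"
    by (rule cubic_pencil[OF sym_trilinear_m7_cubic, of _ "p (t + 1)" _ _ _ "p (t + 6)"])
      (simp_all add: f m7_configD[OF c])
  moreover have "det3 (q (t + 3)) (q (t + 4)) (r t) = 0" "det3 (q (t + 5)) (q (t + 2)) (r t) = 0"
    by (simp_all add: m7_configD[OF c'])
  ultimately show ?thesis by auto
qed

text \<open>The cubic of the pair \<open>p\<close>, \<open>q\<close> contains all \<open>q\<close>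
  and all \<open>r\<close>, so uniqueness identifies it with the cubic of \<open>q\<close>,
  \<open>r\<close>.\<close>

lemma m7_cubic_back:
  assumes c: "m7_config p q" and c': "m7_config q r"
  shows "m7_cubic q (p a) (p a) (p a) = 0"
proof -
  obtain \<kappa> where l: "m7_cubic p X X X = \<kappa> * m7_cubic q X X X" for X
    using m7_cubic_unique[OF c' sym_trilinear_m7_cubic m7_cubic_r[OF c]
        m7_cubic_two_steps[OF c c'] m7_cubic_two_steps[OF c c']] by blast
  have "\<kappa> \<noteq> 0" using m7_cubic_nonzero[OF c] l by auto
  then show ?thesis using l[of "p a"] m7_cubic_q[OF c] by simp
qed

text \<open>Grid with \<open>q s\<close> doubled: its rows are
  \<open>q s, q (s+2a), r (s+a)\<close>, then \<open>q s, r (s+b), q (s+2b)\<close>, then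
  \<open>r s, q (s+2b-2a), q (s+2a-2b)\<close>. Its first column is the tangent at
  \<open>q s\<close>, ending in \<open>r s\<close>. Both admissible pairs keep the remaining entries
  distinct.\<close>

lemma config_tangent_aux:
  assumes c: "m7_config q r" and B: "sym_trilinear B"
    and f: "\<And>a. B (q a) (q a) (q a) = 0" "\<And>a. B (r a) (r a) (r a) = 0"
    and ab: "(a, b) = (4, 5) \<or> (a, b) = (1, 3)"
    and n: "B (q s) (q s) (q (s + 2 * a)) \<noteq> 0" "B (q s) (q s) (q (s + 2 * b)) \<noteq> 0"
  shows "B (q s) (q s) (r s) = 0"
proof -
  note S = sym_trilinearD[OF B]
  note cf = m7_configD[OF c]
  have "indep2 (q s) (q (s + 2 * b))"
    by (rule indep2I[of _ _ "q (s + 2 * a)"]) (use ab in \<open>auto simp: cf\<close>)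
  moreover have "det3 (q s) (q (s + 2 * b)) (r (s + b)) = 0" using ab by (auto simp: cf)
  ultimately obtain x y where rb: "r (s + b) = x *s q s + y *s q (s + 2 * b)" by (rule line_coords)
  have "det3 (q s) (r (s + b)) (q (s + 2 * a)) \<noteq> 0" using ab by (auto simp: cf)
  then have "y \<noteq> 0" unfolding rb by (auto simp: det3_add det3_scale)
  then have nb: "B (q s) (q s) (r (s + b)) \<noteq> 0" unfolding rb using n f by (simp add: S)
  have i: "indep2 (q (s + 2 * b - 2 * a)) (q (s + 2 * a - 2 * b))"
    by (rule indep2I[of _ _ "q s"]) (use ab in \<open>auto simp: cf\<close>)
  show ?thesis
    by (rule grid_tangent[OF B, where v = "q (s + 2 * a)" and w = "r (s + b)" and ?p13.0 = "r (s + a)"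
          and ?p23.0 = "q (s + 2 * b)" and ?p32.0 = "q (s + 2 * b - 2 * a)" and ?p33.0 = "q (s + 2 * a - 2 * b)"])
      (use ab n nb i in \<open>auto simp: f cf\<close>)
qed

text \<open>No genericity is assumed, because the result is also applied to an arbitrary
  predecessor. If the claim failed, the tangent form would be a nonzero linear form, and its line
  through \<open>q s\<close> would contain at most one other \<open>q\<close>, no three being
  collinear. The offsets 8, 10 and 2, 6 have four different residues, so one of the two grids
  applies.\<close>

lemma config_tangent:
  assumes c: "m7_config q r" and B: "sym_trilinear B"
    and f: "\<And>a. B (q a) (q a) (q a) = 0" "\<And>a. B (r a) (r a) (r a) = 0"
  shows "B (q s) (q s) (r s) = 0"
proof (rule ccontr)
  assume r: "B (q s) (q s) (r s) \<noteq> 0"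
  note S = sym_trilinearD[OF B]
  note cf = m7_configD[OF c]
  have two: "B (q s) (q s) (q b) \<noteq> 0"
    if "\<not> 7 dvd a - s" "\<not> 7 dvd b - s" "\<not> 7 dvd a - b" "B (q s) (q s) (q a) = 0" for a b
  proof
    assume z: "B (q s) (q s) (q b) = 0"
    have "det3 (q s) (q a) (q b) \<noteq> 0"
      using that dvd_diff_commute by (intro cf) blast+
    then obtain x y w where "r s = x *s q s + y *s q a + w *s q b"
      by (rule basis_coords) blast
    then show False using r z that f by (simp add: S)
  qed
  show False
  proof (cases "B (q s) (q s) (q (s + 8)) \<noteq> 0 \<and> B (q s) (q s) (q (s + 10)) \<noteq> 0")
    case True
    then show False using config_tangent_aux[OF c B f, of 4 5 s] r by simp
  next
    case False
    then have "B (q s) (q s) (q (s + 2)) \<noteq> 0 \<and> B (q s) (q s) (q (s + 6)) \<noteq> 0"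
      using two[of "s + 8" "s + 2"] two[of "s + 8" "s + 6"] two[of "s + 10" "s + 2"] two[of "s + 10" "s + 6"]
      by auto
    then show False using config_tangent_aux[OF c B f, of 1 3 s] r by simp
  qed
qed

section \<open>The tangents from a point of the cubic\<close>

text \<open>This is \<open>4 I^3 - J^2\<close> in the invariants \<open>I\<close>, \<open>J\<close>
  of a quartic, equal to 27 times its discriminant.\<close>

definition quartic_disc :: "complex \<Rightarrow> complex \<Rightarrow> complex \<Rightarrow> complex \<Rightarrow> complex \<Rightarrow> complex" where
  "quartic_disc a b c d e = 4 * (12 * a * e - 3 * b * d + c^2)^3
     - (72 * a * c * e + 9 * b * c * d - 27 * a * d^2 - 27 * e * b^2 - 2 * c^3)^2"

lemma quartic_double_root:
  assumes "a * w^4 + b * w^3 + c * w^2 + d * w + e = 0" "4 * a * w^3 + 3 * b * w^2 + 2 * c * w + d = 0"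
  shows "quartic_disc a b c d e = 0"
proof -
  have d: "d = - (4 * a * w^3 + 3 * b * w^2 + 2 * c * w)" using assms(2) by algebra
  have e: "e = 3 * a * w^4 + 2 * b * w^3 + c * w^2" using assms unfolding d by algebra
  \<comment> \<open>Half the second derivative at the double root; there the invariants become
    \<open>k^2\<close> and \<open>-2 k^3\<close>.\<close>
  define k where "k = 6 * a * w^2 + 3 * b * w + c"
  have "12 * a * e - 3 * b * d + c^2 = k^2"
    unfolding k_def d e by (simp add: algebra_simps power_numeral_reduce)
  moreover have "72 * a * c * e + 9 * b * c * d - 27 * a * d^2 - 27 * e * b^2 - 2 * c^3 = - 2 * k^3"
    unfolding k_def d e by (simp add: algebra_simps power_numeral_reduce)
  ultimately show ?thesis unfolding quartic_disc_def by (simp add: power_mult_distrib flip: power_mult)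
qed

lemma card_quartic_roots:
  assumes "a \<noteq> 0" "quartic_disc a b c d e \<noteq> 0"
  shows "card {w. poly [:e, d, c, b, a:] w = 0} = 4"
proof -
  define p where "p = [:e, d, c, b, a:]"
  have p0: "p \<noteq> 0" and deg: "degree p = 4" using assms by (simp_all add: p_def)
  have "rsquarefree p"
    unfolding rsquarefree_roots
  proof (intro allI notI)
    fix w assume w: "poly p w = 0 \<and> poly (pderiv p) w = 0"
    have "a * w^4 + b * w^3 + c * w^2 + d * w + e = 0" "4 * a * w^3 + 3 * b * w^2 + 2 * c * w + d = 0"
      using w by (simp_all add: p_def pderiv_pCons algebra_simps power_numeral_reduce)
    then show False using quartic_double_root assms by blast
  qed
  then have "smult (lead_coeff p) (\<Prod>z | poly p z = 0. [:-z, 1:]) = p"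
    by (rule complex_poly_decompose_rsquarefree)
  moreover have "degree (smult (lead_coeff p) (\<Prod>z | poly p z = 0. [:-z, 1:])) = card {z. poly p z = 0}"
    using p0 by (simp add: degree_prod_eq_sum_degree)
  ultimately show ?thesis using deg by (simp add: p_def)
qed

lemma det3_zero_perm:
  assumes "det3 a b c = 0"
  shows "det3 a c b = 0" "det3 b a c = 0" "det3 b c a = 0" "det3 c a b = 0" "det3 c b a = 0"
  using assms det3_swap[of a b c] det3_rotate[of b c a] det3_rotate[of c a b] det3_swap(1)[of b c a]
  by simp_all

text \<open>Modulo 7, 4 is the inverse of 2, so \<open>q (4 * (a + b))\<close> is the point
  prescribed on the chord of \<open>p a\<close> and \<open>p b\<close>. Given these incidences and
  pairwise distinctness, the general position of the \<open>q\<close>'s forces everything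
  else.\<close>

lemma config_from_lines:
  assumes c: "m7_config q r" and per: "\<And>a b. 7 dvd a - b \<Longrightarrow> p a = p b"
    and col: "\<And>a b. \<not> 7 dvd a - b \<Longrightarrow> det3 (p a) (p b) (q (4 * (a + b))) = 0"
    and pp: "\<And>a b. \<not> 7 dvd a - b \<Longrightarrow> indep2 (p a) (p b)" and pq: "\<And>a b. indep2 (p a) (q b)"
  shows "m7_config p q"
proof -
  note cf = m7_configD[OF c]
  have ppp: "det3 (p a) (p b) (p e) \<noteq> 0"
    if "\<not> 7 dvd a - b" "\<not> 7 dvd b - e" "\<not> 7 dvd a - e" for a b e
  proof
    assume z: "det3 (p a) (p b) (p e) = 0"
    have z': "det3 (p b) (p a) (p e) = 0" using det3_zero_perm(2)[OF z] .
    have 1: "det3 (p a) (p b) (q (4 * (b + e))) = 0"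
      by (rule collinear_extend[OF pp[OF that(2)] z col[OF that(2)]])
    have 2: "det3 (p b) (p a) (q (4 * (a + e))) = 0"
      by (rule collinear_extend[OF pp[OF that(3)] z' col[OF that(3)]])
    have "det3 (q (4 * (b + e))) (q (4 * (a + e))) (q (4 * (a + b))) = 0"
      by (rule collinear3[OF pp[OF that(1)] 1 det3_zero_perm(2)[OF 2] col[OF that(1)]])
    moreover have "\<not> 7 dvd 4 * (b + e) - 4 * (a + e)" "\<not> 7 dvd 4 * (a + e) - 4 * (a + b)"
      "\<not> 7 dvd 4 * (b + e) - 4 * (a + b)"
      by ((rule ndvd7[where k = "-2" and m = "b - a", OF that(1)], simp add: algebra_simps),
          (rule ndvd7[where k = "-2" and m = "e - b", OF that(2)], simp add: algebra_simps),
          (rule ndvd7[where k = "-2" and m = "e - a", OF that(3)], simp add: algebra_simps))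
    ultimately show False using cf(3) by simp
  qed
  \<comment> \<open>The lines from \<open>p e\<close> through \<open>q a\<close> and
    \<open>q b\<close> contain \<open>p (2 * a - e)\<close> and \<open>p (2 * b - e)\<close>; if
    they coincide, three \<open>p\<close>'s are collinear.\<close>
  have qqp1: "det3 (q a) (q b) (p e) \<noteq> 0"
    if "\<not> 7 dvd a - b" "\<not> 7 dvd b - e" "\<not> 7 dvd a - e" for a b e
  proof
    assume z: "det3 (q a) (q b) (p e) = 0"
    have 1: "\<not> 7 dvd e - (2 * a - e)" "\<not> 7 dvd e - (2 * b - e)" "\<not> 7 dvd (2 * a - e) - (2 * b - e)"
      by ((rule ndvd7[where k = "3" and m = "a - e", OF that(3)], simp add: algebra_simps),
          (rule ndvd7[where k = "3" and m = "b - e", OF that(2)], simp add: algebra_simps),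
          (rule ndvd7[where k = "4" and m = "b - a", OF that(1)], simp add: algebra_simps))
    have qa: "q (4 * (e + (2 * a - e))) = q a" "q (4 * (e + (2 * b - e))) = q b"
      by (rule cf(1), simp add: algebra_simps)+
    have l: "det3 (p e) (q a) (p (2 * a - e)) = 0" "det3 (p e) (q b) (p (2 * b - e)) = 0"
      using col[OF 1(1)] col[OF 1(2)] unfolding qa by (auto intro: det3_zero_perm(1))
    have z': "det3 (p e) (q a) (q b) = 0" "det3 (p e) (q b) (q a) = 0"
      using det3_zero_perm[OF z] by simp_all
    have "det3 (p e) (q a) (p (2 * b - e)) = 0"
      using collinear3[OF pq[of e b], of "p e" "q a" "p (2 * b - e)"] l z' by simp
    then have "det3 (p e) (p (2 * a - e)) (p (2 * b - e)) = 0"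
      using collinear3[OF pq[of e a], of "p e" "p (2 * a - e)" "p (2 * b - e)"] l by simp
    then show False using ppp[OF 1(1) 1(3) 1(2)] by simp
  qed
  \<comment> \<open>The partner of \<open>p a\<close> through \<open>q a\<close> would be
    \<open>p a\<close> itself. The detour goes from \<open>p a\<close> through \<open>q b\<close> to
    \<open>p (2 * b - a)\<close> and from there through \<open>q a\<close> to
    \<open>p (3 * a - 2 * b)\<close>.\<close>
  have qqp2: "det3 (q a) (q b) (p a) \<noteq> 0" if "\<not> 7 dvd a - b" for a b
  proof
    assume z: "det3 (q a) (q b) (p a) = 0"
    have 1: "\<not> 7 dvd a - (2 * b - a)" "\<not> 7 dvd (2 * b - a) - (3 * a - 2 * b)" "\<not> 7 dvd a - (3 * a - 2 * b)"
      by ((rule ndvd7[where k = "4" and m = "b - a", OF that], simp add: algebra_simps),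
          (rule ndvd7[where k = "-2" and m = "b - a", OF that], simp add: algebra_simps),
          (rule ndvd7[where k = "3" and m = "a - b", OF that], simp add: algebra_simps))
    have qe: "q (4 * (a + (2 * b - a))) = q b" "q (4 * ((2 * b - a) + (3 * a - 2 * b))) = q a"
      by (rule cf(1), simp add: algebra_simps)+
    have l: "det3 (p a) (q b) (p (2 * b - a)) = 0" "det3 (p (2 * b - a)) (q a) (p (3 * a - 2 * b)) = 0"
      using col[OF 1(1)] col[OF 1(2)] unfolding qe by (auto intro: det3_zero_perm(1))
    have z': "det3 (p a) (q b) (q a) = 0"
      using det3_zero_perm[OF z] by simp
    have "det3 (p (2 * b - a)) (q a) (p a) = 0"
      using collinear3[OF pq[of a b], of "p (2 * b - a)" "q a" "p a"] l z' by simp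
    then have "det3 (p a) (p (2 * b - a)) (p (3 * a - 2 * b)) = 0"
      using collinear3[OF pq[of "2 * b - a" a], of "p a" "p (2 * b - a)" "p (3 * a - 2 * b)"] l by simp
    then show False using ppp[OF 1] by simp
  qed
  have qqp: "det3 (q a) (q b) (p e) \<noteq> 0" if "\<not> 7 dvd a - b" for a b e
  proof -
    have "7 dvd e - a \<or> 7 dvd e - b \<or> \<not> 7 dvd b - e \<and> \<not> 7 dvd a - e"
      using dvd_diff_commute[of 7 e a] dvd_diff_commute[of 7 e b] by blast
    then consider "7 dvd e - a" | "7 dvd e - b" | "\<not> 7 dvd b - e" "\<not> 7 dvd a - e"
      by auto
    then show ?thesis
    proof cases
      case 1
      then show ?thesis using qqp2[OF that] per[OF 1] by simp
    next
      case 2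
      have "\<not> 7 dvd b - a" using that dvd_diff_commute[of 7 a b] by simp
      then show ?thesis using qqp2[of b a] per[OF 2] det3_zero_perm(2) by metis
    next
      case 3
      then show ?thesis using qqp1[OF that 3] by simp
    qed
  qed
  have ppq: "det3 (p a) (p b) (q e) = 0 \<longleftrightarrow> 7 dvd a + b - 2 * e" if "\<not> 7 dvd a - b" for a b e
  proof
    assume "7 dvd a + b - 2 * e"
    then have "7 dvd e - 4 * (a + b)"
      by (rule dvd7[where k = 3 and m = "e - a - b"]) (simp add: algebra_simps)
    then have "q e = q (4 * (a + b))" by (rule cf(1))
    then show "det3 (p a) (p b) (q e) = 0" using col[OF that] by simp
  next
    assume z: "det3 (p a) (p b) (q e) = 0"
    show "7 dvd a + b - 2 * e"
    proof (rule ccontr)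
      assume n: "\<not> 7 dvd a + b - 2 * e"
      have "det3 (q (4 * (a + b))) (q e) (p a) = 0"
        using collinear3[OF pp[OF that], of "q (4 * (a + b))" "q e" "p a"] col[OF that] z by simp
      moreover have "\<not> 7 dvd 4 * (a + b) - e"
        by (rule ndvd7[where k = "2" and m = "- a - b", OF n], simp add: algebra_simps)
      ultimately show False using qqp[OF _ , of _ _ a] by simp
    qed
  qed
  have pqq: "det3 (p a) (q b) (q e) \<noteq> 0" if "\<not> 7 dvd b - e" for a b e
    using qqp[OF that, of a] det3_zero_perm(3)[of "p a" "q b" "q e"] by auto
  show ?thesis
    unfolding m7_config_def by (simp add: per cf(1,3) ppp ppq pqq)
qed

text \<open>Lines through \<open>q 0\<close> are indexed by their point
  \<open>d = q 1 + w q 2\<close>. At \<open>d + t q 0\<close> the cubic takes the value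
  \<open>f + 3 U t + 3 V t^2\<close>, where \<open>f = B d d d\<close>,
  \<open>U = B d d (q 0)\<close>, \<open>V = B d (q 0) (q 0)\<close>; there is no cubic term because
  \<open>q 0\<close> is on the curve. The list gives the coefficients in \<open>w\<close> of
  \<open>U^2 - 4/3 f V\<close>, the discriminant in \<open>t\<close> up to the factor 9.\<close>

definition tangent_coeff :: "(int \<Rightarrow> vec3) \<Rightarrow> nat \<Rightarrow> complex" where
  "tangent_coeff q k = (let B = (\<lambda>i j k. m7_cubic q (q i) (q j) (q k)) in
     [(B 1 1 0)^2,
      4 * B 1 1 0 * B 0 1 2 - 4 * B 1 1 2 * B 1 0 0,
      4 * (B 0 1 2)^2 + 2 * B 1 1 0 * B 2 2 0 - 4 * (B 1 1 2 * B 2 0 0 + B 1 2 2 * B 1 0 0),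
      4 * B 0 1 2 * B 2 2 0 - 4 * B 1 2 2 * B 2 0 0,
      (B 2 2 0)^2] ! k)"

definition tangent_quartic :: "(int \<Rightarrow> vec3) \<Rightarrow> complex poly" where
  "tangent_quartic q = [:tangent_coeff q 0, tangent_coeff q 1, tangent_coeff q 2,
     tangent_coeff q 3, tangent_coeff q 4:]"

definition tangent_disc :: "(int \<Rightarrow> vec3) \<Rightarrow> complex" where
  "tangent_disc q = quartic_disc (tangent_coeff q 4) (tangent_coeff q 3) (tangent_coeff q 2)
     (tangent_coeff q 1) (tangent_coeff q 0)"

text \<open>The resultant in \<open>w\<close> of \<open>U\<close> and \<open>V\<close> from the
  tangent quartic. If it is nonzero, the tangent at \<open>q 0\<close> does not have triple contact
  there.\<close>

definition flex_value :: "(int \<Rightarrow> vec3) \<Rightarrow> complex" where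
  "flex_value q = (let B = (\<lambda>i j k. m7_cubic q (q i) (q j) (q k)) in
     B 1 1 0 * (B 2 0 0)^2 - 2 * B 0 1 2 * B 1 0 0 * B 2 0 0 + B 2 2 0 * (B 1 0 0)^2)"

text \<open>The tangent conditions keep a contact point of a tangent from \<open>q 0\<close> away
  from the \<open>q\<close>'s and \<open>r\<close>'s, \<open>flex\<close> keeps it away from
  \<open>q 0\<close>, and \<open>disc\<close> makes the four tangents distinct.\<close>

locale m7_generic =
  fixes q r :: "int \<Rightarrow> vec3"
  assumes config: "m7_config q r"
    and tangent_q: "\<And>i j. \<not> 7 dvd i - j \<Longrightarrow> m7_cubic q (q i) (q i) (q j) \<noteq> 0"
    and tangent_r: "\<And>i j. m7_cubic q (r i) (r i) (q j) \<noteq> 0"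
    and flex: "flex_value q \<noteq> 0"
    and disc: "tangent_disc q \<noteq> 0"
begin

abbreviation B where "B \<equiv> m7_cubic q"

lemma B: "sym_trilinear B"
  by (rule sym_trilinear_m7_cubic)

lemmas S = sym_trilinearD[OF B]
lemmas cf = m7_configD[OF config]
lemmas Bq = m7_cubic_q[OF config]
lemmas Br = m7_cubic_r[OF config]

lemma config_tangent_q: "B (q s) (q s) (r s) = 0"
  by (rule config_tangent[OF config B Bq Br])

lemma tangent_q_sym: "\<not> 7 dvd i - j \<Longrightarrow> B (q i) (q j) (q j) \<noteq> 0"
  using tangent_q[of j i] dvd_diff_commute[of 7 i j] S(1,2) by metis

definition direction :: "complex \<Rightarrow> vec3" where
  "direction w = q 1 + w *s q 2"

text \<open>The contact point: \<open>- U / (2 V)\<close> is the double root in \<open>t\<close>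
  when the discriminant vanishes.\<close>

definition base_pt :: "complex \<Rightarrow> vec3" where
  "base_pt w = direction w + (- B (direction w) (direction w) (q 0) / (2 * B (direction w) (q 0) (q 0))) *s q 0"

lemma direction_values:
  "B (direction w) (direction w) (direction w) = 3 * w * (B (q 1) (q 1) (q 2) + B (q 1) (q 2) (q 2) * w)"
  "B (direction w) (direction w) (q 0) = B (q 1) (q 1) (q 0) + 2 * B (q 0) (q 1) (q 2) * w + B (q 2) (q 2) (q 0) * w^2"
  "B (direction w) (q 0) (q 0) = B (q 1) (q 0) (q 0) + B (q 2) (q 0) (q 0) * w"
proof -
  show "B (direction w) (direction w) (direction w) = 3 * w * (B (q 1) (q 1) (q 2) + B (q 1) (q 2) (q 2) * w)"
    using cubic_expand2[OF B, of 1 "q 1" w "q 2"] Bq by (simp add: direction_def algebra_simps power2_eq_square)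
  have "B (q 1) (q 2) (q 0) = B (q 0) (q 1) (q 2)" by (metis S(1,2))
  then show "B (direction w) (direction w) (q 0) = B (q 1) (q 1) (q 0) + 2 * B (q 0) (q 1) (q 2) * w + B (q 2) (q 2) (q 0) * w^2"
    using quadratic_expand[OF B, of 1 "q 1" w "q 2" "q 0"] by (simp add: direction_def)
  show "B (direction w) (q 0) (q 0) = B (q 1) (q 0) (q 0) + B (q 2) (q 0) (q 0) * w"
    by (simp add: direction_def S(3,6) algebra_simps)
qed

lemma poly_tangent_quartic:
  "3 * poly (tangent_quartic q) w = 3 * (B (direction w) (direction w) (q 0))^2
     - 4 * B (direction w) (direction w) (direction w) * B (direction w) (q 0) (q 0)"
  unfolding direction_values tangent_quartic_def tangent_coeff_def Let_def
  by (simp add: algebra_simps power2_eq_square numeral_nat)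

lemma card_tangents: "card {w. poly (tangent_quartic q) w = 0} = 4"
  unfolding tangent_quartic_def
proof (rule card_quartic_roots)
  show "quartic_disc (tangent_coeff q 4) (tangent_coeff q 3) (tangent_coeff q 2) (tangent_coeff q 1)
     (tangent_coeff q 0) \<noteq> 0"
    using disc by (simp add: tangent_disc_def)
  show "tangent_coeff q 4 \<noteq> 0" using tangent_q[of 2 0] by (simp add: tangent_coeff_def Let_def numeral_nat)
qed

lemma simple_tangent:
  assumes "poly (tangent_quartic q) w = 0"
  shows "poly (pderiv (tangent_quartic q)) w \<noteq> 0"
proof
  assume w: "poly (pderiv (tangent_quartic q)) w = 0"
  have "tangent_coeff q 4 * w^4 + tangent_coeff q 3 * w^3 + tangent_coeff q 2 * w^2 + tangent_coeff q 1 * w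
      + tangent_coeff q 0 = 0"
    "4 * tangent_coeff q 4 * w^3 + 3 * tangent_coeff q 3 * w^2 + 2 * tangent_coeff q 2 * w + tangent_coeff q 1 = 0"
    using assms w by (simp_all add: tangent_quartic_def pderiv_pCons algebra_simps power_numeral_reduce)
  from quartic_double_root[OF this] show False using disc by (simp add: tangent_disc_def)
qed

text \<open>A root of the quartic with \<open>V = 0\<close> also has \<open>U = 0\<close>, and a
  common root annihilates the resultant \<open>flex_value\<close>.\<close>

lemma direction_q0:
  assumes "poly (tangent_quartic q) w = 0"
  shows "B (direction w) (q 0) (q 0) \<noteq> 0"
proof
  assume z: "B (direction w) (q 0) (q 0) = 0"
  have "B (direction w) (direction w) (q 0) = 0"
    using poly_tangent_quartic[of w] assms z by simp
  then have 1: "B (q 1) (q 1) (q 0) + 2 * B (q 0) (q 1) (q 2) * w + B (q 2) (q 2) (q 0) * w^2 = 0"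
    and 2: "B (q 1) (q 0) (q 0) = - B (q 2) (q 0) (q 0) * w"
    using z by (simp_all add: direction_values eq_neg_iff_add_eq_0)
  have "flex_value q = (B (q 2) (q 0) (q 0))^2 *
     (B (q 1) (q 1) (q 0) + 2 * B (q 0) (q 1) (q 2) * w + B (q 2) (q 2) (q 0) * w^2)"
    unfolding flex_value_def Let_def 2 by (simp add: algebra_simps power2_eq_square)
  then show False using 1 flex by simp
qed

lemma base_pt_eq:
  obtains t where "base_pt w = 1 *s direction w + t *s q 0"
    "t = - B (direction w) (direction w) (q 0) / (2 * B (direction w) (q 0) (q 0))"
  by (simp add: base_pt_def)

lemma det3_base_pt:
  "det3 (base_pt w) (q 0) (q 2) = det3 (q 1) (q 0) (q 2)" "det3 (base_pt w) (q 0) (q 1) = w * det3 (q 2) (q 0) (q 1)"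
  unfolding base_pt_def direction_def det3_add det3_scale by simp_all

lemma det3_base_pt_nz: "det3 (base_pt w) (q 0) (q 2) \<noteq> 0"
  unfolding det3_base_pt by (simp add: cf)

end

section \<open>A predecessor constructed from one tangent\<close>

locale m7_tangent = m7_generic +
  fixes w
  assumes root: "poly (tangent_quartic q) w = 0"
begin

abbreviation P where "P \<equiv> base_pt w"

lemma P_q0_q0: "B P (q 0) (q 0) \<noteq> 0"
  using direction_q0[OF root] unfolding base_pt_def S(3,6) by (simp add: Bq)

lemma P_nz: "P \<noteq> 0"
  using det3_base_pt_nz[of w] by (metis det3_zero(1))

text \<open>The first two express the double root in \<open>t\<close>. The third makes the contact
  point smooth: the derivative of the tangent quartic at \<open>w\<close> equals
  \<open>-4 V B P P (q 2)\<close>, and the root is simple.\<close>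

lemma P_values: "B P P P = 0" "B P P (q 0) = 0" "B P P (q 2) \<noteq> 0"
proof -
  define \<alpha> \<beta> \<gamma> \<delta> \<epsilon> \<zeta> \<eta> where d: "\<alpha> = B (q 1) (q 1) (q 0)" "\<beta> = B (q 0) (q 1) (q 2)" "\<gamma> = B (q 2) (q 2) (q 0)"
    "\<delta> = B (q 1) (q 1) (q 2)" "\<epsilon> = B (q 1) (q 2) (q 2)" "\<zeta> = B (q 1) (q 0) (q 0)" "\<eta> = B (q 2) (q 0) (q 0)"
  obtain t where P: "P = 1 *s direction w + t *s q 0"
    and t: "t = - B (direction w) (direction w) (q 0) / (2 * B (direction w) (q 0) (q 0))"
    by (rule base_pt_eq)
  define U V where "U = B (direction w) (direction w) (q 0)" and "V = B (direction w) (q 0) (q 0)"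
  have V: "V \<noteq> 0" using direction_q0[OF root] by (simp add: V_def)
  have U: "U = - 2 * t * V" using V t by (simp add: U_def V_def)
  have f: "3 * U^2 = 4 * B (direction w) (direction w) (direction w) * V"
    using poly_tangent_quartic[of w] root by (simp add: U_def V_def)
  then have "V * (B (direction w) (direction w) (direction w) - 3 * t^2 * V) = 0"
    unfolding U by algebra
  then have f': "B (direction w) (direction w) (direction w) = 3 * t^2 * V" using V by simp
  show "B P P P = 0"
    unfolding P cubic_expand2[OF B] f' using U by (simp add: Bq U_def V_def power2_eq_square)
  have V': "B (q 0) (direction w) (q 0) = V" using S(1)[of "q 0" "direction w" "q 0"] by (simp add: V_def)
  have V'': "B (direction w) (q 0) (q 0) = V" by (simp add: V_def)
  show "B P P (q 0) = 0"
    unfolding P quadratic_expand[OF B] V'' U_def[symmetric] U by (simp add: Bq)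
  have s: "B (q 1) (q 2) (q 2) = \<epsilon>" "B (q 1) (q 0) (q 2) = \<beta>" "B (q 2) (q 0) (q 2) = \<gamma>"
     "B (q 0) (q 0) (q 2) = \<eta>"
    unfolding d by (metis S(1,2))+
  have g1: "B (direction w) (direction w) (q 2) = \<delta> + 2 * \<epsilon> * w"
    using quadratic_expand[OF B, of 1 "q 1" w "q 2" "q 2"] Bq by (simp add: direction_def s d(4))
  have g2: "B (direction w) (q 0) (q 2) = \<beta> + \<gamma> * w"
    by (simp add: direction_def S(3,6) s)
  have g: "B P P (q 2) = \<delta> + 2 * \<epsilon> * w + 2 * t * (\<beta> + \<gamma> * w) + t^2 * \<eta>"
    unfolding P quadratic_expand[OF B] g1 g2 s by simp
  have dv: "U = \<alpha> + 2 * \<beta> * w + \<gamma> * w^2" "V = \<zeta> + \<eta> * w" "w * (\<delta> + \<epsilon> * w) = t^2 * V"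
    using f' unfolding U_def V_def direction_values d by simp_all
  have pd: "poly (pderiv (tangent_quartic q)) w =
     2 * (\<alpha> + 2 * \<beta> * w + \<gamma> * w^2) * (2 * \<beta> + 2 * \<gamma> * w) - 4 * (\<delta> + \<epsilon> * w) * (\<zeta> + \<eta> * w)
      - 4 * w * \<epsilon> * (\<zeta> + \<eta> * w) - 4 * (w * (\<delta> + \<epsilon> * w)) * \<eta>"
    unfolding tangent_quartic_def tangent_coeff_def Let_def d
    by (simp add: pderiv_pCons algebra_simps power2_eq_square numeral_nat)
  have "poly (pderiv (tangent_quartic q)) w = - 4 * V * B P P (q 2)"
    unfolding pd g dv(1)[symmetric] dv(2)[symmetric] dv(3) U by (simp add: algebra_simps power2_eq_square)
  then show "B P P (q 2) \<noteq> 0" using simple_tangent[OF root] by auto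
qed

text \<open>Both linear forms vanish at \<open>P\<close> and \<open>q 0\<close> but not at
  \<open>q 2\<close>, so they are proportional.\<close>

lemma P_tangent: "B P P X = 0 \<longleftrightarrow> det3 P (q 0) X = 0"
proof -
  obtain x y z where X: "X = x *s P + y *s q 0 + z *s q 2"
    by (rule basis_coords[OF det3_base_pt_nz])
  have "B P P X = z * B P P (q 2)" unfolding X by (simp add: S(3-8) P_values)
  moreover have "det3 P (q 0) X = z * det3 P (q 0) (q 2)" unfolding X by (simp add: det3_add det3_scale)
  ultimately show ?thesis using P_values(3) det3_base_pt_nz by simp
qed

lemma r_on_chord:
  assumes "\<not> 7 dvd i - j"
  obtains s u where "r (4 * (i + j)) = s *s q i + u *s q j" "s \<noteq> 0" "u \<noteq> 0"
proof -
  obtain k where k: "\<not> 7 dvd k - i" "\<not> 7 dvd k - j"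
    by (rule residue7_third)
  have k': "\<not> 7 dvd j - k" "\<not> 7 dvd i - k"
    using k dvd_diff_commute[of 7 k i] dvd_diff_commute[of 7 k j] by simp_all
  have n: "det3 (q i) (q j) (q k) \<noteq> 0" by (rule cf(3)[OF assms k'])
  have "i + j - 2 * (4 * (i + j)) = 7 * (- (i + j))" by simp
  then have z: "det3 (q i) (q j) (r (4 * (i + j))) = 0" using cf(5)[OF assms] by (metis dvd_triv_left)
  obtain s u where r: "r (4 * (i + j)) = s *s q i + u *s q j"
    by (rule line_coords[OF indep2I[OF n] z])
  have "\<not> 7 dvd i + k - 2 * (4 * (i + j))" "\<not> 7 dvd j + k - 2 * (4 * (i + j))"
    by ((rule ndvd7[where k = "1" and m = "i + j", OF k(2)], simp add: algebra_simps),
          (rule ndvd7[where k = "1" and m = "i + j", OF k(1)], simp add: algebra_simps))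
  with k' have "det3 (q i) (r (4 * (i + j))) (q k) \<noteq> 0" "det3 (q j) (r (4 * (i + j))) (q k) \<noteq> 0"
    using cf(6) by blast+
  then have "s \<noteq> 0" "u \<noteq> 0" unfolding r by (auto simp: det3_add det3_scale)
  then show ?thesis using r that by blast
qed

text \<open>On this chord the cubic has only the points \<open>q i\<close>, \<open>q j\<close> and
  \<open>r (4 * (i + j))\<close>. \<open>P\<close> is none of them: the tangent at \<open>P\<close>
  passes through \<open>q 0\<close>, which \<open>tangent_q\<close> and \<open>tangent_r\<close>
  exclude, and \<open>P\<close> is not \<open>q 0\<close> by its coordinates.\<close>

lemma P_off_chords:
  assumes ij: "\<not> 7 dvd i - j"
  shows "det3 P (q i) (q j) \<noteq> 0"
proof
  assume z: "det3 P (q i) (q j) = 0"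
  obtain s u where r: "r (4 * (i + j)) = s *s q i + u *s q j" and su: "s \<noteq> 0" "u \<noteq> 0"
    by (rule r_on_chord[OF ij])
  have on_q: "P \<noteq> k *s q m" for k m
  proof
    assume k: "P = k *s q m"
    then have "k \<noteq> 0" using P_nz by auto
    then have "B (q m) (q m) (q 0) = 0" using P_values(2) unfolding k by (simp add: S(6-8))
    then have "7 dvd m - 0" using tangent_q[of m 0] by blast
    then have "P = k *s q 0" using k cf(1)[of m 0] by simp
    then show False using det3_base_pt_nz[of w] by (metis det3_scale(1) det3_same(1) mult_zero_right)
  qed
  have "indep2 (q i) (q j)"
  proof -
    obtain k where k: "\<not> 7 dvd k - i" "\<not> 7 dvd k - j" by (rule residue7_third)
    have "\<not> 7 dvd j - k" "\<not> 7 dvd i - k"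
      using k dvd_diff_commute[of 7 k i] dvd_diff_commute[of 7 k j] by simp_all
    then show ?thesis using indep2I cf(3)[OF ij] by blast
  qed
  moreover have "det3 (q i) (q j) P = 0" using z by (rule det3_zero_perm)
  ultimately obtain x y where P: "P = x *s q i + y *s q j" by (rule line_coords)
  have x: "x \<noteq> 0" using on_q[of y j] P by auto
  have y: "y \<noteq> 0" using on_q[of x i] P by auto
  have chord: "a * B (q i) (q i) (q j) + b * B (q i) (q j) (q j) = 0"
    if "a \<noteq> 0" "b \<noteq> 0" "B (a *s q i + b *s q j) (a *s q i + b *s q j) (a *s q i + b *s q j) = 0" for a b
  proof -
    have "3 * a * b * (a * B (q i) (q i) (q j) + b * B (q i) (q j) (q j)) = 0"
      using that(3) unfolding cubic_expand2[OF B] by (simp add: Bq algebra_simps power2_eq_square)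
    then show ?thesis using that by simp
  qed
  have "x * B (q i) (q i) (q j) + y * B (q i) (q j) (q j) = 0" using chord[OF x y] P_values(1) P by simp
  moreover have "s * B (q i) (q i) (q j) + u * B (q i) (q j) (q j) = 0" using chord[OF su] Br r by metis
  ultimately have "(x * u - y * s) * B (q i) (q j) (q j) = 0" by algebra
  then have "x * u = y * s" using tangent_q_sym[OF ij] by simp
  then have "x = (y / u) * s" "y = (y / u) * u" using su by (simp_all add: field_simps)
  then have "P = (y / u) *s r (4 * (i + j))"
    unfolding P r vector_add_ldistrib vector_smult_assoc by metis
  then have "(y / u)^2 * B (r (4 * (i + j))) (r (4 * (i + j))) (q 0) = 0"
    using P_values(2) by (simp add: S(6-8) power2_eq_square)
  then show False using tangent_r y su by simp
qed

lemma P_P_q: "\<not> 7 dvd i \<Longrightarrow> B P P (q i) \<noteq> 0"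
  unfolding P_tangent by (rule P_off_chords) simp

text \<open>Otherwise the tangent from \<open>q 0\<close> to \<open>P\<close> would pass through
  \<open>r 0\<close>, hence be the tangent at \<open>q 0\<close>, contradicting
  \<open>P_q0_q0\<close>.\<close>

lemma P_P_r0: "B P P (r 0) \<noteq> 0"
proof
  assume "B P P (r 0) = 0"
  then have z: "det3 P (q 0) (r 0) = 0" by (simp add: P_tangent)
  obtain x y where r: "r 0 = x *s P + y *s q 0"
    by (rule line_coords[OF indep2I[OF det3_base_pt_nz] z])
  have "det3 (r 0) (q 0) (q 2) \<noteq> 0" by (simp add: cf)
  then have "x \<noteq> 0" unfolding r by (auto simp: det3_add det3_scale)
  moreover have "B (q 0) (q 0) (r 0) = x * B P (q 0) (q 0)"
    unfolding r using S(1,2)[of P "q 0" "q 0"] S(2)[of "q 0" P "q 0"] by (simp add: S(5,8) Bq)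
  ultimately show False using config_tangent_q[of 0] P_q0_q0 by simp
qed

text \<open>The tangent at \<open>q i\<close> meets the cubic again only in \<open>r i\<close>, so
  \<open>P\<close> on it would be \<open>q i\<close> or \<open>r i\<close>.\<close>

lemma P_q_q:
  assumes "\<not> 7 dvd i"
  shows "B P (q i) (q i) \<noteq> 0"
proof
  assume z: "B P (q i) (q i) = 0"
  have i0: "\<not> 7 dvd i - 0" "\<not> 7 dvd 0 - i" using assms by simp_all
  have D: "det3 (q i) (r i) (q 0) \<noteq> 0"
    using cf(6)[OF i0(1), of i] assms by simp
  obtain x y t where P: "P = x *s q i + y *s r i + t *s q 0"
    by (rule basis_coords[OF D])
  have "B (q i) (q i) P = t * B (q i) (q i) (q 0)"
    unfolding P by (simp add: S(5,8) Bq config_tangent_q)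
  moreover have "B (q i) (q i) P = 0" using z by (metis S(1,2))
  ultimately have "t = 0" using tangent_q[OF i0(1)] by simp
  then have P: "P = x *s q i + y *s r i" using P by simp
  have "B (q i) (r i) (r i) \<noteq> 0" using tangent_r[of i i] by (metis S(1,2))
  moreover have "3 * x * y^2 * B (q i) (r i) (r i) = 0"
    using P_values(1) unfolding P cubic_expand2[OF B] by (simp add: Bq Br config_tangent_q)
  ultimately consider "x = 0" | "y = 0" by auto
  then show False
  proof cases
    case 1
    then have "P = y *s r i" using P by simp
    moreover then have "y \<noteq> 0" using P_nz by auto
    ultimately have "B (r i) (r i) (q 0) = 0" using P_values(2) by (simp add: S(6-8))
    then show False using tangent_r by simp
  next
    case 2
    then have "det3 P (q i) (q 0) = 0" using P by (simp add: det3_scale)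
    then show False using P_off_chords[OF i0(1)] by simp
  qed
qed

text \<open>The third point of the cubic on the line through \<open>P\<close> and
  \<open>q (4 * a)\<close>. The cubic at \<open>x q + y P\<close> is
  \<open>3 x y (x B P q q + y B P P q)\<close>, and the coefficients solve for the last
  factor.\<close>

definition pt :: "int \<Rightarrow> vec3" where
  "pt a = (if 7 dvd a then P else B P P (q (4 * a)) *s q (4 * a) + (- B P (q (4 * a)) (q (4 * a))) *s P)"

lemma pt_periodic: "7 dvd a - b \<Longrightarrow> pt a = pt b"
proof -
  assume ab: "7 dvd a - b"
  then have "7 dvd 4 * a - 4 * b" by (rule dvd7[where k = 4 and m = 0]) simp
  then have "q (4 * a) = q (4 * b)" by (rule cf(1))
  moreover have "7 dvd a \<longleftrightarrow> 7 dvd b" using ab by (rule dvd7_cong)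
  ultimately show ?thesis by (simp add: pt_def)
qed

lemma B_pt: "B (pt a) (pt a) (pt a) = 0"
proof (cases "7 dvd a")
  case False
  define i where "i = 4 * a"
  have "B (q i) P P = B P P (q i)" "B (q i) (q i) P = B P (q i) (q i)" by (metis S(1,2))+
  then show ?thesis
    using False unfolding pt_def i_def[symmetric]
    by (simp only: if_False cubic_expand2[OF B]) (simp add: Bq P_values algebra_simps power2_eq_square)
qed (simp add: pt_def P_values)

lemma pt_dets:
  assumes "\<not> 7 dvd a"
  shows "det3 P (pt a) X = B P P (q (4 * a)) * det3 P (q (4 * a)) X"
    "det3 P (q (4 * a)) (pt a) = 0"
    "det3 P X (pt a) = B P P (q (4 * a)) * det3 P X (q (4 * a))"
    "det3 (q (4 * a)) X (pt a) = - B P (q (4 * a)) (q (4 * a)) * det3 P (q (4 * a)) X"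
    "det3 X (q (4 * a)) (pt a) = - B P (q (4 * a)) (q (4 * a)) * det3 P X (q (4 * a))"
proof -
  have r: "det3 (q (4 * a)) X P = det3 P (q (4 * a)) X" "det3 X (q (4 * a)) P = det3 P X (q (4 * a))"
    by (rule det3_rotate)+
  have p: "pt a = B P P (q (4 * a)) *s q (4 * a) + (- B P (q (4 * a)) (q (4 * a))) *s P"
    using assms by (simp add: pt_def)
  show "det3 P (pt a) X = B P P (q (4 * a)) * det3 P (q (4 * a)) X"
    "det3 P (q (4 * a)) (pt a) = 0"
    "det3 P X (pt a) = B P P (q (4 * a)) * det3 P X (q (4 * a))"
    "det3 (q (4 * a)) X (pt a) = - B P (q (4 * a)) (q (4 * a)) * det3 P (q (4 * a)) X"
    "det3 X (q (4 * a)) (pt a) = - B P (q (4 * a)) (q (4 * a)) * det3 P X (q (4 * a))"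
    unfolding p det3_add det3_scale r by simp_all
qed

lemma pt_collinear:
  assumes ab: "\<not> 7 dvd a - b"
  shows "det3 (pt a) (pt b) (q (4 * (a + b))) = 0"
proof -
  have base: "det3 P (pt b) (q (4 * (a + b))) = 0" if "7 dvd a" "\<not> 7 dvd b" for a b
  proof -
    have "q (4 * (a + b)) = q (4 * b)" using that by (intro cf(1)) (simp add: algebra_simps)
    then show ?thesis using pt_dets(1)[OF that(2)] by simp
  qed
  have "7 dvd a \<and> \<not> 7 dvd b \<or> 7 dvd b \<and> \<not> 7 dvd a \<or> \<not> 7 dvd a \<and> \<not> 7 dvd b"
    using ab dvd_diff[of 7 a b] by blast
  then consider (a) "7 dvd a" "\<not> 7 dvd b" | (b) "7 dvd b" "\<not> 7 dvd a" | (c) "\<not> 7 dvd a" "\<not> 7 dvd b"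
    by blast
  then show ?thesis
  proof cases
    case a
    then show ?thesis using base[OF a] by (simp add: pt_def)
  next
    case b
    have "det3 P (pt a) (q (4 * (b + a))) = 0" by (rule base[OF b])
    then have "det3 (pt a) P (q (4 * (a + b))) = 0" using det3_zero_perm(2) by (simp add: add.commute)
    then show ?thesis using b by (simp add: pt_def)
  next
    case c
    define i j where "i = 4 * a" and "j = 4 * b"
    have i: "\<not> 7 dvd i" and j: "\<not> 7 dvd j" and ij: "\<not> 7 dvd i - j" "\<not> 7 dvd j - i"
      unfolding i_def j_def
      by ((rule ndvd7[where k = "2" and m = "- a", OF c(1)], simp add: algebra_simps),
          (rule ndvd7[where k = "2" and m = "- b", OF c(2)], simp add: algebra_simps),
          (rule ndvd7[where k = "2" and m = "b - a", OF ab], simp add: algebra_simps),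
          (rule ndvd7[where k = "-2" and m = "b - a", OF ab], simp add: algebra_simps))
    note da = pt_dets[OF c(1), folded i_def] and db = pt_dets[OF c(2), folded j_def]
    have D: "det3 P (q i) (q j) \<noteq> 0" "det3 P (q j) (q i) \<noteq> 0"
      using P_off_chords ij by blast+
    have D0: "det3 P (q i) (q 0) \<noteq> 0" "det3 P (q j) (q 0) \<noteq> 0"
      using P_off_chords[of i 0] P_off_chords[of j 0] i j by simp_all
    obtain s u where r: "r (4 * (i + j)) = s *s q i + u *s q j" and su: "s \<noteq> 0" "u \<noteq> 0"
      by (rule r_on_chord[OF ij(1)])
    have R: "det3 (q i) (q j) (r (4 * (i + j))) = 0" "det3 P (q i) (r (4 * (i + j))) \<noteq> 0"
      "det3 P (q j) (r (4 * (i + j))) \<noteq> 0"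
      unfolding r using su D by (simp_all add: det3_add det3_scale)
    have A: "det3 P (q i) (pt a) = 0" "det3 P (q j) (pt a) \<noteq> 0" "det3 (q i) (q j) (pt a) \<noteq> 0"
      unfolding da using D P_P_q[OF i] P_q_q[OF i] by simp_all
    have Bb: "det3 P (q j) (pt b) = 0" "det3 P (q i) (pt b) \<noteq> 0" "det3 (q i) (q j) (pt b) \<noteq> 0"
      unfolding db using D P_P_q[OF j] P_q_q[OF j] by simp_all
    \<comment> \<open>Grid with \<open>P\<close> doubled: its rows are \<open>P, q i, pt a\<close>,
      then \<open>P, q j, pt b\<close>, then \<open>q 0, r (4 * (i + j)), q (i + j)\<close>; the
      third column is the claim. When \<open>i + j\<close> is 0 modulo 7, the last row degenerates
      to the tangent at \<open>q 0\<close>.\<close>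
    have "det3 (pt a) (pt b) (q (i + j)) = 0"
    proof (cases "7 dvd i + j")
      case False
      have n: "\<not> 7 dvd 0 - (i + j)" "\<not> 7 dvd i - (i + j)" "\<not> 7 dvd j - (i + j)" "\<not> 7 dvd i - 0" "\<not> 7 dvd 0 + i - 2 * (4 * (i + j))"
        by ((rule ndvd7[where k = "-1" and m = "0", OF False], simp add: algebra_simps),
          (rule ndvd7[where k = "-1" and m = "0", OF j], simp add: algebra_simps),
          (rule ndvd7[where k = "-1" and m = "0", OF i], simp add: algebra_simps),
          (rule ndvd7[where k = "1" and m = "0", OF i], simp add: algebra_simps),
          (rule ndvd7[where k = "-1" and m = "- i - j", OF j], simp add: algebra_simps))
      have l: "det3 (q 0) (r (4 * (i + j))) (q (i + j)) = 0"
        using cf(6)[OF n(1), of "4 * (i + j)"] dvd_triv_left[of 7 "- (i + j)"] by (simp add: algebra_simps)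
      have ind: "indep2 (q 0) (r (4 * (i + j)))"
      proof (rule indep2I)
        show "det3 (q 0) (r (4 * (i + j))) (q i) \<noteq> 0"
          using cf(6)[of 0 i "4 * (i + j)"] n i by simp
      qed
      have "det3 (q i) (q j) (q (i + j)) \<noteq> 0" by (rule cf(3)[OF ij(1) n(3,2)])
      then show ?thesis
        by (intro grid_chord[OF B P_values(1) Bq Bq B_pt B_pt Bq Br Bq D(1) P_P_q[OF i] P_P_q[OF j] A Bb
              P_values(2) D0 R l ind P_P_q[OF False]])
    next
      case True
      have r0: "r (4 * (i + j)) = r 0" using dvd_mult[OF True, of 4] by (intro cf(2)) simp
      have "\<not> 7 dvd j - 0" "\<not> 7 dvd i - 0" using i j by simp_all
      then have "det3 (q i) (q j) (q 0) \<noteq> 0" using cf(3)[OF ij(1)] by blast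
      then have "det3 (pt a) (pt b) (q 0) = 0"
        by (intro grid_chord_tangent[OF B P_values(1) Bq Bq B_pt B_pt Bq Br D(1) P_P_q[OF i] P_P_q[OF j] A Bb
              P_values(2) D0 _ R[unfolded r0] P_P_r0 config_tangent_q])
      moreover have "q (i + j) = q 0" using True by (intro cf(1)) simp
      ultimately show ?thesis by simp
    qed
    then show ?thesis by (simp add: i_def j_def algebra_simps)
  qed
qed

lemma pt_config: "m7_config pt q"
proof (rule config_from_lines[OF config pt_periodic pt_collinear])
  have base: "indep2 P (pt b)" if b: "\<not> 7 dvd b" for b
  proof -
    obtain k where k: "\<not> 7 dvd k - 4 * b" "\<not> 7 dvd k - 4 * b" by (rule residue7_third)
    have 1: "\<not> 7 dvd 4 * b - k" "\<not> 7 dvd 4 * b"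
      by ((rule ndvd7[where k = "-1" and m = "0", OF k(1)], simp add: algebra_simps),
          (rule ndvd7[where k = "2" and m = "- b", OF b], simp add: algebra_simps))
    show ?thesis
      by (rule indep2I[of _ _ "q k"]) (use P_off_chords[OF 1(1)] P_P_q[OF 1(2)] pt_dets(1)[OF b] in simp)
  qed
  show "indep2 (pt a) (pt b)" if ab: "\<not> 7 dvd a - b" for a b
  proof -
    have "7 dvd a \<and> \<not> 7 dvd b \<or> 7 dvd b \<and> \<not> 7 dvd a \<or> \<not> 7 dvd a \<and> \<not> 7 dvd b"
      using ab dvd_diff[of 7 a b] by blast
    then consider (a) "7 dvd a" "\<not> 7 dvd b" | (b) "7 dvd b" "\<not> 7 dvd a" | (c) "\<not> 7 dvd a" "\<not> 7 dvd b"
      by blast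
    then show ?thesis
    proof cases
      case a
      then show ?thesis using base[of b] by (simp add: pt_def[of a])
    next
      case b
      then show ?thesis using indep2_sym[OF base[of a]] by (simp add: pt_def[of b])
    next
      case c
      have 1: "\<not> 7 dvd 4 * a - 4 * b" "\<not> 7 dvd 4 * a" "\<not> 7 dvd 4 * b"
        by ((rule ndvd7[where k = "2" and m = "b - a", OF ab], simp add: algebra_simps),
          (rule ndvd7[where k = "2" and m = "- a", OF c(1)], simp add: algebra_simps),
          (rule ndvd7[where k = "2" and m = "- b", OF c(2)], simp add: algebra_simps))
      have "det3 P (pt a) (pt b) \<noteq> 0"
        unfolding pt_dets(1)[OF c(1)] pt_dets(3)[OF c(2)]
        using P_off_chords[OF 1(1)] P_P_q[OF 1(2)] P_P_q[OF 1(3)] by simp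
      then show ?thesis using indep2I det3_rotate by metis
    qed
  qed
  show "indep2 (pt a) (q b)" for a b
  proof -
    obtain k where k: "\<not> 7 dvd k - b" "\<not> 7 dvd k - b" by (rule residue7_third)
    have bk: "\<not> 7 dvd b - k" using k dvd_diff_commute[of 7 k b] by simp
    consider (a) "7 dvd a" | (b) "\<not> 7 dvd a" "\<not> 7 dvd 4 * a - b" | (c) "\<not> 7 dvd a" "7 dvd 4 * a - b"
      by blast
    then show ?thesis
    proof cases
      case a
      then show ?thesis using indep2I[OF P_off_chords[OF bk]] by (simp add: pt_def)
    next
      case b
      have 1: "\<not> 7 dvd 4 * a" by (rule ndvd7[where k = "2" and m = "- a", OF b(1)], simp add: algebra_simps)
      have "det3 P (pt a) (q b) \<noteq> 0"
        unfolding pt_dets(1)[OF b(1)] using P_off_chords[OF b(2)] P_P_q[OF 1] by simp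
      then show ?thesis using indep2I det3_rotate by metis
    next
      case c
      have 1: "\<not> 7 dvd 4 * a" by (rule ndvd7[where k = "2" and m = "- a", OF c(1)], simp add: algebra_simps)
      have q: "q b = q (4 * a)" using c dvd_diff_commute[of 7 b "4 * a"] by (intro cf(1)) simp
      have "det3 (q (4 * a)) (q k) (pt a) \<noteq> 0"
        unfolding pt_dets(4)[OF c(1)] using P_off_chords[OF bk] P_q_q[OF 1] q by simp
      then show ?thesis unfolding q using indep2I det3_rotate by metis
    qed
  qed
qed

end

section \<open>Every predecessor comes from a tangent\<close>

context m7_generic
begin

text \<open>General position gives \<open>p 0\<close> a nonzero coordinate along \<open>q 1\<close>,
  so it is a multiple of \<open>d + t q 0\<close>. \<open>config_tangent\<close> for
  \<open>p\<close>, used on the cubic of \<open>q\<close>, gives \<open>U = -2 t V\<close>; lying on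
  the curve then gives \<open>f = 3 t^2 V\<close>, and the discriminant vanishes.\<close>

lemma predecessor_root:
  assumes p: "m7_config p q"
  obtains w k where "poly (tangent_quartic q) w = 0" "k \<noteq> 0" "p 0 = k *s base_pt w"
proof -
  note Bp = m7_cubic_back[OF p config]
  note cp = m7_configD[OF p]
  have D: "det3 (q 1) (q 0) (q 2) \<noteq> 0" by (simp add: cf)
  obtain y x z where p0: "p 0 = y *s q 1 + x *s q 0 + z *s q 2" and y: "y = det3 (p 0) (q 0) (q 2) / det3 (q 1) (q 0) (q 2)"
    by (rule basis_coords[OF D])
  have "det3 (p 0) (q 0) (q 2) \<noteq> 0" by (rule cp) simp
  then have y: "y \<noteq> 0" using y D by simp
  define w t where "w = z / y" and "t = x / y"
  have p0: "p 0 = y *s (1 *s direction w + t *s q 0)"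
    unfolding p0 direction_def using y by (simp add: w_def t_def vector_add_ldistrib)
  define U V f where "U = B (direction w) (direction w) (q 0)" and "V = B (direction w) (q 0) (q 0)"
    and "f = B (direction w) (direction w) (direction w)"
  have "B (p 0) (p 0) (q 0) = 0" by (rule config_tangent[OF p B Bp Bq])
  then have "y^2 * B (1 *s direction w + t *s q 0) (1 *s direction w + t *s q 0) (q 0) = 0"
    unfolding p0 S(6-8) by (simp add: power2_eq_square)
  then have UV: "U = - 2 * t * V"
    unfolding quadratic_expand[OF B] using y Bq S(1)[of "q 0"] by (simp add: U_def V_def eq_neg_iff_add_eq_0)
  have "y^3 * B (1 *s direction w + t *s q 0) (1 *s direction w + t *s q 0) (1 *s direction w + t *s q 0) = 0"
    using Bp[of 0] unfolding p0 S(6-8) by (simp add: power3_eq_cube)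
  then have "f + 3 * t * U + 3 * t^2 * V = 0"
    unfolding cubic_expand2[OF B] using y Bq by (simp add: U_def V_def f_def)
  then have f: "f = 3 * t^2 * V" unfolding UV by algebra
  have "3 * poly (tangent_quartic q) w = 0"
    unfolding poly_tangent_quartic U_def[symmetric] V_def[symmetric] f_def[symmetric] f UV
    by (simp add: power2_eq_square)
  then have root: "poly (tangent_quartic q) w = 0" by simp
  have "V \<noteq> 0" using direction_q0[OF root] by (simp add: V_def)
  then have "t = - U / (2 * V)" unfolding UV by simp
  then have "p 0 = y *s base_pt w" unfolding p0 base_pt_def U_def V_def by simp
  then show ?thesis using that root y by blast
qed

lemma base_pt_inj:
  assumes "base_pt w = k *s base_pt w'"
  shows "w = w'"
proof -
  have D: "det3 (q 1) (q 0) (q 2) \<noteq> 0" "det3 (q 2) (q 0) (q 1) \<noteq> 0" by (simp_all add: cf)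
  have "det3 (q 1) (q 0) (q 2) = k * det3 (q 1) (q 0) (q 2)"
    using det3_base_pt(1)[of w] det3_base_pt(1)[of w'] assms by (simp add: det3_scale)
  then have "base_pt w = base_pt w'" using D assms by simp
  then have "w * det3 (q 2) (q 0) (q 1) = w' * det3 (q 2) (q 0) (q 1)"
    using det3_base_pt(2)[of w] det3_base_pt(2)[of w'] by auto
  then show ?thesis using D by simp
qed

end

context m7_tangent
begin

text \<open>\<open>p a\<close> is on the line of \<open>p 0\<close> and \<open>q (4 * a)\<close>, on
  the cubic, and different from both points, which leaves one possibility.\<close>

lemma predecessor_pt:
  assumes p: "m7_config p q" and k: "k \<noteq> 0" "p 0 = k *s P"
  shows "\<exists>l. l \<noteq> 0 \<and> p a = l *s pt a"
proof (cases "7 dvd a")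
  case True
  then have "p a = p 0" using config_per(1)[OF p, of a 0] by simp
  then show ?thesis using True k by (auto simp: pt_def)
next
  case a: False
  note cp = m7_configD[OF p]
  define i where "i = 4 * a"
  have i: "\<not> 7 dvd i" unfolding i_def by (rule ndvd7[where k = "2" and m = "- a", OF a], simp add: algebra_simps)
  have i0: "\<not> 7 dvd i - 0" using i by simp
  have "7 dvd 0 + a - 2 * i" "\<not> 7 dvd 0 - a" using a dvd_triv_left[of 7 "- a"] unfolding i_def by (simp_all add: algebra_simps)
  then have "det3 (p 0) (p a) (q i) = 0" using cp(5)[of 0 a i] by simp
  then have "k * det3 P (q i) (p a) = 0" using det3_zero_perm(1) unfolding k det3_scale(1)[symmetric] by blast
  then have z: "det3 P (q i) (p a) = 0" using k by simp
  obtain x y where pa: "p a = x *s P + y *s q i"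
    by (rule line_coords[OF indep2I[OF P_off_chords[OF i0]] z])
  have "det3 (p 0) (p a) (q 0) \<noteq> 0" using cp(5)[of 0 a 0] a by simp
  then have "y \<noteq> 0" unfolding pa k by (auto simp: det3_add det3_scale)
  moreover have "det3 (p a) (q i) (q 0) \<noteq> 0" using cp(8)[OF i0, of a] .
  then have "x \<noteq> 0" unfolding pa by (auto simp: det3_add det3_scale)
  moreover have "3 * x * y * (x * B P P (q i) + y * B P (q i) (q i)) = 0"
    using m7_cubic_back[OF p config, of a] unfolding pa cubic_expand2[OF B]
    by (simp add: P_values Bq algebra_simps power2_eq_square)
  ultimately have "x * B P P (q i) = - y * B P (q i) (q i)" by (simp add: eq_neg_iff_add_eq_0)
  then have x: "x = y / B P P (q i) * (- B P (q i) (q i))" using P_P_q[OF i] by (simp add: field_simps)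
  have pt: "pt a = B P P (q i) *s q i + (- B P (q i) (q i)) *s P" using a by (simp add: pt_def i_def)
  have "p a = (y / B P P (q i)) *s pt a"
    unfolding pa pt vector_add_ldistrib vector_smult_assoc x[symmetric] using P_P_q[OF i]
    by (simp add: add.commute)
  then show ?thesis using \<open>y \<noteq> 0\<close> P_P_q[OF i] by (intro exI[of _ "y / B P P (q i)"]) simp
qed

end

section \<open>Projective classes and realizations\<close>

lemma matrix_vec_basis:
  fixes A :: "complex^3^3"
  shows "A *v (x *s u + y *s v + z *s t) = x *s (A *v u) + y *s (A *v v) + z *s (A *v t)"
  by (simp add: vec.add vec.scale)

lemma det3_det: "det3 a b c = det (vector [a, b, c] :: complex^3^3)"
  by (simp add: det3_def det_3 algebra_simps)

lemma det3_matrix_mult: "det3 (A *v a) (A *v b) (A *v c) = det A * det3 a b c"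
proof -
  have "(vector [A *v a, A *v b, A *v c] :: complex^3^3) = vector [a, b, c] ** transpose A"
    by (simp add: vec_eq_iff forall_3 matrix_matrix_mult_def matrix_vector_mult_def transpose_def sum_3 mult.commute)
  then show ?thesis by (simp add: det3_det det_mul det_transpose)
qed

lemma det3_matrix:
  fixes A :: "complex^3^3"
  assumes "invertible A"
  shows "det3 (A *v a) (A *v b) (A *v c) = 0 \<longleftrightarrow> det3 a b c = 0"
  using assms by (simp add: det3_matrix_mult invertible_det_nz)

lemma m7_config_transform:
  fixes A :: "complex^3^3"
  assumes c: "m7_config p q" and A: "invertible A"
    and q': "\<And>a. \<exists>k. k \<noteq> 0 \<and> q' a = k *s (A *v q a)" and per: "\<And>a b. 7 dvd a - b \<Longrightarrow> q' a = q' b"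
  shows "m7_config (\<lambda>a. A *v p a) q'"
proof -
  obtain k where k: "\<And>a. k a \<noteq> 0" "\<And>a. q' a = k a *s (A *v q a)" using q' by metis
  have q: "\<not> 7 dvd a - b \<Longrightarrow> \<not> 7 dvd b - e \<Longrightarrow> \<not> 7 dvd a - e \<Longrightarrow> det3 (q a) (q b) (q e) \<noteq> 0" for a b e
    using config_rrr[OF c] .
  have d: "det3 (A *v x) (A *v y) (q' c) = 0 \<longleftrightarrow> det3 x y (q c) = 0"
    "det3 (A *v x) (q' b) (q' c) = 0 \<longleftrightarrow> det3 x (q b) (q c) = 0"
    "det3 (q' a) (q' b) (q' c) = 0 \<longleftrightarrow> det3 (q a) (q b) (q c) = 0" for x y a b c
    using k(1) by (simp_all add: k(2) det3_scale det3_matrix[OF A])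
  note cc = m7_configD[OF c]
  show ?thesis
    unfolding m7_config_def d det3_matrix[OF A]
    using per by (simp add: cc(1,3,5,8) q)
qed

lemma pgl_equiv_refl: "pgl_equiv L L"
  unfolding pgl_equiv_def by (intro exI[of _ "mat 1"]) (auto intro: exI[of _ 1] simp: invertible_def)

lemma pgl_equiv_trans:
  assumes "pgl_equiv L M" "pgl_equiv M N"
  shows "pgl_equiv L N"
proof -
  obtain A where A: "invertible A" "\<And>x. x \<in> Labels \<Longrightarrow> \<exists>c. c \<noteq> 0 \<and> M x = c *s (A *v L x)"
    using assms(1) unfolding pgl_equiv_def by blast
  obtain A' where A': "invertible A'" "\<And>x. x \<in> Labels \<Longrightarrow> \<exists>c. c \<noteq> 0 \<and> N x = c *s (A' *v M x)"
    using assms(2) unfolding pgl_equiv_def by blast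
  have "\<exists>c. c \<noteq> 0 \<and> N x = c *s ((A' ** A) *v L x)" if x: "x \<in> Labels" for x
  proof -
    obtain c c' where "c \<noteq> 0" "M x = c *s (A *v L x)" "c' \<noteq> 0" "N x = c' *s (A' *v M x)"
      using A(2)[OF x] A'(2)[OF x] by blast
    then show ?thesis
      by (intro exI[of _ "c' * c"]) (simp add: vec.scale matrix_vector_mul_assoc)
  qed
  then show ?thesis unfolding pgl_equiv_def using invertible_mult[OF A'(1) A(1)] by blast
qed

lemma pgl_equiv_sym:
  assumes "pgl_equiv L M"
  shows "pgl_equiv M L"
proof -
  obtain A where A: "invertible A" "\<And>x. x \<in> Labels \<Longrightarrow> \<exists>c. c \<noteq> 0 \<and> M x = c *s (A *v L x)"
    using assms(1) unfolding pgl_equiv_def by blast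
  obtain A' where A': "A ** A' = mat 1" "A' ** A = mat 1" using A(1) unfolding invertible_def by blast
  have "\<exists>c. c \<noteq> 0 \<and> L x = c *s (A' *v M x)" if x: "x \<in> Labels" for x
  proof -
    obtain c where "c \<noteq> 0" "M x = c *s (A *v L x)" using A(2)[OF x] by blast
    then show ?thesis
      using A' by (intro exI[of _ "inverse c"]) (simp add: vec.scale matrix_vector_mul_assoc)
  qed
  moreover have "invertible A'" using A' unfolding invertible_def by blast
  ultimately show ?thesis unfolding pgl_equiv_def by blast
qed

lemma pgl_class_eq: "pgl_equiv L M \<Longrightarrow> pgl_class L = pgl_class M"
  unfolding pgl_class_def using pgl_equiv_sym pgl_equiv_trans by blast

section \<open>Labels 1 to 7 as residues modulo 7\<close>

definition lab :: "int \<Rightarrow> nat" where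
  "lab a = (if 7 dvd a then 7 else nat (a mod 7))"

definition unp :: "(label \<Rightarrow> vec3) \<Rightarrow> int \<Rightarrow> vec3" where "unp L a = L (Unp (lab a))"

definition pri :: "(label \<Rightarrow> vec3) \<Rightarrow> int \<Rightarrow> vec3" where "pri L a = L (Pri (lab a))"

lemma lab_range: "lab a \<in> {1..7}"
proof -
  have "0 \<le> a mod 7" "a mod 7 < 7" by simp_all
  moreover have "a mod 7 \<noteq> 0" if "\<not> 7 dvd a" using that by (simp add: dvd_eq_mod_eq_0)
  ultimately show ?thesis by (cases "7 dvd a") (auto simp: lab_def)
qed

lemma lab_dvd: "7 dvd a - int (lab a)"
proof -
  have "0 \<le> a mod 7" by simp
  then show ?thesis by (auto simp: lab_def dvd_minus_mod)
qed

lemma dvd_in_range: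
  assumes "k \<in> {1..7}" "l \<in> {1..7}" "7 dvd int k - int l"
  shows "k = l"
proof -
  have "\<bar>int k - int l\<bar> < 7" using assms by auto
  then have "int k - int l = 0" using dvd_imp_le_int[OF _ assms(3)] by fastforce
  then show ?thesis by simp
qed

lemma lab_eq_iff: "lab a = lab b \<longleftrightarrow> 7 dvd a - b"
proof
  assume "lab a = lab b"
  then show "7 dvd a - b" using dvd_diff[OF lab_dvd[of a] lab_dvd[of b]] by simp
next
  assume "7 dvd a - b"
  then have "7 dvd int (lab a) - int (lab b)"
    using dvd_diff[OF _ dvd_diff[OF lab_dvd[of a] lab_dvd[of b]], of "a - b"] by (simp add: algebra_simps)
  then show "lab a = lab b" using dvd_in_range lab_range by blast
qed

lemma lab_int: "k \<in> {1..7} \<Longrightarrow> lab (int k) = k"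
  using dvd_in_range[of "lab (int k)" k] lab_range lab_dvd[of "int k"] dvd_diff_commute by metis

lemma nonbasis_simps:
  "\<not> nonbasis {Unp a, Unp b, Unp c}" "\<not> nonbasis {Pri a, Pri b, Pri c}"
  "b \<noteq> c \<Longrightarrow> \<not> nonbasis {Unp a, Pri b, Pri c}"
proof -
  show "\<not> nonbasis {Unp a, Unp b, Unp c}"
  proof
    assume "nonbasis {Unp a, Unp b, Unp c}"
    then obtain a' b' c' where "{Unp a, Unp b, Unp c} = {Unp a', Unp b', Pri c'}"
      unfolding nonbasis_def by blast
    then have "Pri c' \<in> {Unp a, Unp b, Unp c}" by blast
    then show False by simp
  qed
  show "\<not> nonbasis {Pri a, Pri b, Pri c}"
  proof
    assume "nonbasis {Pri a, Pri b, Pri c}"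
    then obtain a' b' c' where "{Pri a, Pri b, Pri c} = {Unp a', Unp b', Pri c'}"
      unfolding nonbasis_def by blast
    then have "Unp a' \<in> {Pri a, Pri b, Pri c}" by blast
    then show False by simp
  qed
  show "\<not> nonbasis {Unp a, Pri b, Pri c}" if "b \<noteq> c"
  proof
    assume "nonbasis {Unp a, Pri b, Pri c}"
    then obtain a' b' c' where "{Unp a, Pri b, Pri c} = {Unp a', Unp b', Pri c'}"
      unfolding nonbasis_def by blast
    then have "Pri b \<in> {Unp a', Unp b', Pri c'}" "Pri c \<in> {Unp a', Unp b', Pri c'}" by blast+
    then show False using that by simp
  qed
qed

lemma nonbasis_iff:
  assumes "a \<in> {1..7}" "b \<in> {1..7}" "c \<in> {1..7}" "a \<noteq> b"
  shows "nonbasis {Unp a, Unp b, Pri c} \<longleftrightarrow> 7 dvd int a + int b - 2 * int c"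
proof -
  have "(a + b) mod 7 = (2 * c) mod 7 \<longleftrightarrow> int ((a + b) mod 7) = int ((2 * c) mod 7)"
    by (rule of_nat_eq_iff[symmetric])
  then have e: "(a + b) mod 7 = (2 * c) mod 7 \<longleftrightarrow> 7 dvd int a + int b - 2 * int c"
    by (simp add: zmod_int mod_eq_dvd_iff)
  have s: "c = c' \<and> (a = a' \<and> b = b' \<or> a = b' \<and> b = a')"
    if "{Unp a, Unp b, Pri c} = {Unp a', Unp b', Pri c'}" for a' b' c'
  proof -
    have "Pri c \<in> {Unp a', Unp b', Pri c'}" "Unp a \<in> {Unp a', Unp b', Pri c'}" "Unp b \<in> {Unp a', Unp b', Pri c'}"
      "Unp a' \<in> {Unp a, Unp b, Pri c}"
      using that by blast+
    then show ?thesis using assms(4) by auto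
  qed
  show ?thesis
  proof
    assume "nonbasis {Unp a, Unp b, Pri c}"
    then obtain a' b' c' where "(a' + b') mod 7 = (2 * c') mod 7" "{Unp a, Unp b, Pri c} = {Unp a', Unp b', Pri c'}"
      unfolding nonbasis_def by blast
    then have "(a + b) mod 7 = (2 * c) mod 7" using s[of a' b' c'] by (auto simp: add.commute)
    then show "7 dvd int a + int b - 2 * int c" using e by simp
  next
    assume "7 dvd int a + int b - 2 * int c"
    then have "(a + b) mod 7 = (2 * c) mod 7" using e by simp
    then show "nonbasis {Unp a, Unp b, Pri c}" unfolding nonbasis_def using assms by blast
  qed
qed

lemma same_line_indep:
  assumes "same_line a b"
  shows "det3 a b c = 0"
  using assms unfolding same_line_def by (auto simp: det3_scale)

lemma realization_config:
  assumes L: "is_realization L"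
  shows "m7_config (unp L) (pri L)"
proof -
  have conc: "det3 (L x) (L y) (L z) = 0 \<longleftrightarrow> nonbasis {x, y, z}"
    if "x \<in> Labels" "y \<in> Labels" "z \<in> Labels" "x \<noteq> y" "y \<noteq> z" "x \<noteq> z" for x y z
    using L that unfolding is_realization_def concurrent_det3[symmetric] by simp
  have lb: "Unp (lab a) \<in> Labels" "Pri (lab a) \<in> Labels" for a
    using lab_range[of a] unfolding Labels_def by blast+
  show ?thesis
    unfolding m7_config_def
  proof (intro conjI allI impI)
    fix a b :: int assume "7 dvd a - b"
    then have "lab a = lab b" by (simp add: lab_eq_iff)
    then show "unp L a = unp L b" "pri L a = pri L b" by (simp_all add: unp_def pri_def)
  next
    fix a b c :: int assume "\<not> 7 dvd a - b \<and> \<not> 7 dvd b - c \<and> \<not> 7 dvd a - c"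
    then show "det3 (unp L a) (unp L b) (unp L c) \<noteq> 0" "det3 (pri L a) (pri L b) (pri L c) \<noteq> 0"
      by (simp_all add: unp_def pri_def conc lb lab_eq_iff nonbasis_simps)
  next
    fix a b c :: int assume ab: "\<not> 7 dvd a - b"
    have "7 dvd int (lab a) + int (lab b) - 2 * int (lab c) \<longleftrightarrow> 7 dvd a + b - 2 * c"
      by (rule dvd7_cong)
        (use dvd_diff[OF dvd_mult[OF lab_dvd[of c], of 2] dvd_add[OF lab_dvd[of a] lab_dvd[of b]]] in \<open>simp add: algebra_simps\<close>)
    then show "det3 (unp L a) (unp L b) (pri L c) = 0 \<longleftrightarrow> 7 dvd a + b - 2 * c"
      using ab nonbasis_iff[OF lab_range lab_range lab_range, of a b c]
      by (simp add: unp_def pri_def conc lb lab_eq_iff)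
  next
    fix a b c :: int assume "\<not> 7 dvd b - c"
    then show "det3 (unp L a) (pri L b) (pri L c) \<noteq> 0"
      by (simp add: unp_def pri_def conc lb lab_eq_iff nonbasis_simps)
  qed
qed

lemma config_realization:
  assumes c: "m7_config (unp L) (pri L)"
  shows "is_realization L"
proof -
  note cc = m7_configD[OF c]
  have u: "L (Unp k) = unp L (int k)" "L (Pri k) = pri L (int k)" if "k \<in> {1..7}" for k
    using that by (simp_all add: unp_def pri_def lab_int)
  have nd: "\<not> 7 dvd int a - int b" if "a \<in> {1..7}" "b \<in> {1..7}" "a \<noteq> b" for a b
    using dvd_in_range that by blast
  have third: "\<exists>k. \<not> 7 dvd i - k \<and> \<not> 7 dvd j - k" for i j :: int
  proof -
    obtain k where "\<not> 7 dvd k - i" "\<not> 7 dvd k - j" by (rule residue7_third)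
    then have "\<not> 7 dvd i - k" "\<not> 7 dvd j - k" using dvd_diff_commute[of 7 k i] dvd_diff_commute[of 7 k j] by simp_all
    then show ?thesis by blast
  qed
  have conc: "det3 (L x) (L y) (L z) = 0 \<longleftrightarrow> nonbasis {x, y, z}"
    if "x \<in> Labels" "y \<in> Labels" "z \<in> Labels" "x \<noteq> y" "y \<noteq> z" "x \<noteq> z" for x y z
  proof -
    note xyz = that
    have qqr: "det3 (L (Unp a)) (L (Unp b)) (L (Pri c)) = 0 \<longleftrightarrow> nonbasis {Unp a, Unp b, Pri c}"
      if "a \<in> {1..7}" "b \<in> {1..7}" "c \<in> {1..7}" "a \<noteq> b" for a b c
      using cc(5)[OF nd[OF that(1,2,4)], of "int c"] nonbasis_iff[OF that] that by (simp add: u)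
    have qrr: "det3 (L (Unp a)) (L (Pri b)) (L (Pri c)) \<noteq> 0 \<and> \<not> nonbasis {Unp a, Pri b, Pri c}"
      if "a \<in> {1..7}" "b \<in> {1..7}" "c \<in> {1..7}" "b \<noteq> c" for a b c
      using cc(8)[OF nd[OF that(2,3,4)], of "int a"] nonbasis_simps(3)[OF that(4)] that by (simp add: u)
    have xs: "\<exists>a\<in>{1..7}. x = Unp a \<or> x = Pri a" if "x \<in> Labels" for x
      using that unfolding Labels_def by blast
    obtain a b c where abc: "a \<in> {1..7}" "b \<in> {1..7}" "c \<in> {1..7}"
      and x: "x = Unp a \<or> x = Pri a" and y: "y = Unp b \<or> y = Pri b" and z: "z = Unp c \<or> z = Pri c"
      using xs[OF xyz(1)] xs[OF xyz(2)] xs[OF xyz(3)] by blast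
    have i1: "{x, y, z} = {x, z, y}" "{x, y, z} = {y, z, x}" "{x, y, z} = {z, x, y}" by auto
    have d1: "det3 (L x) (L y) (L z) = 0 \<longleftrightarrow> det3 (L x) (L z) (L y) = 0"
      by (rule iffI, erule det3_zero_perm(1), erule det3_zero_perm(1))
    have d2: "det3 (L x) (L y) (L z) = 0 \<longleftrightarrow> det3 (L y) (L z) (L x) = 0"
      by (rule iffI, erule det3_zero_perm(3), erule det3_zero_perm(4))
    have d3: "det3 (L x) (L y) (L z) = 0 \<longleftrightarrow> det3 (L z) (L x) (L y) = 0"
      by (rule iffI, erule det3_zero_perm(4), erule det3_zero_perm(3))
    consider "x = Unp a" "y = Unp b" "z = Unp c" | "x = Pri a" "y = Pri b" "z = Pri c"
      | "x = Unp a" "y = Unp b" "z = Pri c" | "x = Unp a" "y = Pri b" "z = Unp c"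
      | "x = Pri a" "y = Unp b" "z = Unp c" | "x = Unp a" "y = Pri b" "z = Pri c"
      | "x = Pri a" "y = Unp b" "z = Pri c" | "x = Pri a" "y = Pri b" "z = Unp c"
      using x y z by (elim disjE; simp)
    then show ?thesis
    proof cases
      case 1
      then have "\<not> 7 dvd int a - int b" "\<not> 7 dvd int b - int c" "\<not> 7 dvd int a - int c"
        using nd[OF abc(1,2)] nd[OF abc(2,3)] nd[OF abc(1,3)] xyz(4-6) by auto
      then show ?thesis using cc(3) abc 1 by (simp add: u nonbasis_simps)
    next
      case 2
      then have "\<not> 7 dvd int a - int b" "\<not> 7 dvd int b - int c" "\<not> 7 dvd int a - int c"
        using nd[OF abc(1,2)] nd[OF abc(2,3)] nd[OF abc(1,3)] xyz(4-6) by auto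
      then show ?thesis using cc(4) abc 2 by (simp add: u nonbasis_simps)
    next
      case 3
      then show ?thesis using qqr[of a b c] abc xyz by simp
    next
      case 4
      then show ?thesis unfolding d1 i1(1) using qqr[of a c b] abc xyz by simp
    next
      case 5
      then show ?thesis unfolding d2 i1(2) using qqr[of b c a] abc xyz by simp
    next
      case 6
      then show ?thesis using qrr[of a b c] abc xyz by simp
    next
      case 7
      then show ?thesis unfolding d2 i1(2) using qrr[of b c a] abc xyz by simp
    next
      case 8
      then show ?thesis unfolding d3 i1(3) using qrr[of c a b] abc xyz by simp
    qed
  qed
  have ind: "\<exists>z. det3 (L x) (L y) z \<noteq> 0" if xy: "x \<in> Labels" "y \<in> Labels" "x \<noteq> y" for x y
  proof -
    obtain a b where ab: "a \<in> {1..7}" "b \<in> {1..7}" and x: "x = Unp a \<or> x = Pri a" and y: "y = Unp b \<or> y = Pri b"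
      using xy unfolding Labels_def by blast
    obtain k where k: "\<not> 7 dvd int a - k" "\<not> 7 dvd int b - k" using third by blast
    consider "x = Unp a" "y = Unp b" | "x = Pri a" "y = Pri b" | "x = Unp a" "y = Pri b" | "x = Pri a" "y = Unp b"
      using x y by (elim disjE; simp)
    then show ?thesis
    proof cases
      case 1
      then have "\<not> 7 dvd int a - int b" using nd[OF ab] xy by auto
      from cc(3)[OF this k(2,1)] show ?thesis using 1 ab by (intro exI[of _ "unp L k"]) (simp add: u)
    next
      case 2
      then have "\<not> 7 dvd int a - int b" using nd[OF ab] xy by auto
      from cc(4)[OF this k(2,1)] show ?thesis using 2 ab by (intro exI[of _ "pri L k"]) (simp add: u)
    next
      case 3
      then show ?thesis using cc(8)[OF k(2), of "int a"] ab by (intro exI[of _ "pri L k"]) (simp add: u)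
    next
      case 4
      then show ?thesis using cc(9)[OF k(1), of "int b"] ab by (intro exI[of _ "pri L k"]) (simp add: u)
    qed
  qed
  show ?thesis
    unfolding is_realization_def concurrent_det3
  proof (intro conjI ballI impI)
    fix x assume x: "x \<in> Labels"
    have "Unp 1 \<in> Labels" "Unp 2 \<in> Labels" by (auto simp: Labels_def)
    moreover have "x \<noteq> Unp 1 \<or> x \<noteq> Unp 2" by auto
    ultimately obtain y where "y \<in> Labels" "x \<noteq> y" by metis
    then show "L x \<noteq> 0" using ind[OF x] by auto
  next
    fix x y assume "x \<in> Labels" "y \<in> Labels" "x \<noteq> y"
    then show "\<not> same_line (L x) (L y)" using ind same_line_indep by blast
  next
    fix x y z assume "x \<in> Labels" "y \<in> Labels" "z \<in> Labels" "x \<noteq> y \<and> y \<noteq> z \<and> x \<noteq> z"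
    then show "(det3 (L x) (L y) (L z) = 0) = nonbasis {x, y, z}" using conc by blast
  qed
qed

section \<open>Counting the preimage classes\<close>

definition predecessor :: "(label \<Rightarrow> vec3) \<Rightarrow> complex \<Rightarrow> label \<Rightarrow> vec3" where
  "predecessor L w x = (case x of Unp n \<Rightarrow> m7_tangent.pt (unp L) w (int n) | Pri n \<Rightarrow> L (Unp n))"

text \<open>\<open>s\<close> has three nonzero coordinates in the basis \<open>u\<close>,
  \<open>v\<close>, \<open>t\<close>, so being an eigenvector forces the three eigenvalues to equal
  \<open>d\<close>: fixing a projective frame leaves only scalars.\<close>

lemma eigenframe_scalar:
  fixes A :: "complex^3^3"
  assumes e: "A *v u = a *s u" "A *v v = b *s v" "A *v t = c *s t" "A *v s = d *s s"
    and D: "det3 u v t \<noteq> 0" and n: "det3 s v t \<noteq> 0" "det3 u s t \<noteq> 0" "det3 u v s \<noteq> 0"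
  shows "A *v X = d *s X"
proof -
  obtain x y z where s: "s = x *s u + y *s v + z *s t"
    and xyz: "x = det3 s v t / det3 u v t" "y = det3 u s t / det3 u v t" "z = det3 u v s / det3 u v t"
    by (rule basis_coords[OF D])
  have nz: "x \<noteq> 0" "y \<noteq> 0" "z \<noteq> 0" using n D by (simp_all add: xyz)
  have eq: "(x * a) *s u + (y * b) *s v + (z * c) *s t = (d * x) *s u + (d * y) *s v + (d * z) *s t"
    using e(4) unfolding s matrix_vec_basis e by (simp add: vec.scale_right_distrib)
  have "x * a * det3 u v t = d * x * det3 u v t"
    using arg_cong[OF eq, of "\<lambda>X. det3 X v t"] by (simp only: det3_add det3_scale det3_same) simp
  moreover have "y * b * det3 u v t = d * y * det3 u v t"
    using arg_cong[OF eq, of "\<lambda>X. det3 u X t"] by (simp only: det3_add det3_scale det3_same) simp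
  moreover have "z * c * det3 u v t = d * z * det3 u v t"
    using arg_cong[OF eq, of "\<lambda>X. det3 u v X"] by (simp only: det3_add det3_scale det3_same) simp
  ultimately have abc: "a = d" "b = d" "c = d" using nz D by simp_all
  obtain x y z where X: "X = x *s u + y *s v + z *s t" by (rule basis_coords[OF D])
  show ?thesis unfolding X matrix_vec_basis e abc by (simp add: vec.scale_right_distrib mult.commute)
qed

lemma card_preimages:
  assumes L: "is_realization L" and gen: "m7_generic (unp L) (pri L)"
    and lam: "\<And>j. j \<in> {1..7} \<Longrightarrow> Lambda23 (L ` Unp ` ({1..7} - {j})) = ray (L (Pri j)) - {0}"
  shows "card (pgl_class ` {L'. \<exists>N. lam_rel L' N \<and> pgl_equiv N L}) = 4"
proof -
  interpret m7_generic "unp L" "pri L" by (rule gen)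
  define W where "W = {w. poly (tangent_quartic (unp L)) w = 0}"
  have tan: "m7_tangent (unp L) (pri L) w" if "w \<in> W" for w
    using that gen by (simp add: W_def m7_tangent_def m7_tangent_axioms_def)
  have ul: "unp L (int n) = L (Unp n)" if "n \<in> {1..7}" for n
    using that by (simp add: unp_def lab_int)
  have Unp_Labels: "Unp n \<in> Labels \<longleftrightarrow> n \<in> {1..7}" "Pri n \<in> Labels \<longleftrightarrow> n \<in> {1..7}" for n
    by (auto simp: Labels_def)
  have real: "is_realization (predecessor L w)" if w: "w \<in> W" for w
  proof -
    interpret m7_tangent "unp L" "pri L" w by (rule tan[OF w])
    have "unp (predecessor L w) a = pt a" for a
    proof -
      have "7 dvd int (lab a) - a" using lab_dvd[of a] dvd_diff_commute[of 7 a "int (lab a)"] by simp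
      then show ?thesis using pt_periodic by (simp add: unp_def predecessor_def)
    qed
    moreover have "pri (predecessor L w) a = unp L a" for a
      by (simp add: unp_def pri_def predecessor_def)
    ultimately have "unp (predecessor L w) = pt" "pri (predecessor L w) = unp L" by auto
    then show ?thesis using config_realization pt_config by metis
  qed
  have pri_nz: "L (Pri j) \<noteq> 0" if "j \<in> {1..7}" for j
    using L that unfolding is_realization_def Labels_def by blast
  have lr: "lam_rel (predecessor L w) L" if w: "w \<in> W" for w
  proof -
    have "predecessor L w ` Pri ` S = L ` Unp ` S" for S
      by (auto simp: predecessor_def image_iff)
    then show ?thesis
      unfolding lam_rel_def using real[OF w] L lam pri_nz by (simp add: predecessor_def)
  qed
  have "pgl_class ` {L'. \<exists>N. lam_rel L' N \<and> pgl_equiv N L} = (\<lambda>w. pgl_class (predecessor L w)) ` W"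
  proof (intro equalityI subsetI)
    fix C assume "C \<in> (\<lambda>w. pgl_class (predecessor L w)) ` W"
    then obtain w where "w \<in> W" "C = pgl_class (predecessor L w)" by blast
    then show "C \<in> pgl_class ` {L'. \<exists>N. lam_rel L' N \<and> pgl_equiv N L}"
      using lr pgl_equiv_refl by blast
  next
    fix C assume "C \<in> pgl_class ` {L'. \<exists>N. lam_rel L' N \<and> pgl_equiv N L}"
    then obtain L' N where C: "C = pgl_class L'" and N: "lam_rel L' N" "pgl_equiv N L" by blast
    obtain A where A: "invertible A" "\<And>x. x \<in> Labels \<Longrightarrow> \<exists>c. c \<noteq> 0 \<and> L x = c *s (A *v N x)"
      using N(2) unfolding pgl_equiv_def by blast
    have L': "is_realization L'" and NL: "\<And>j. j \<in> {1..7} \<Longrightarrow> N (Unp j) = L' (Pri j)"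
      using N(1) unfolding lam_rel_def by blast+
    have AL: "\<exists>c. c \<noteq> 0 \<and> L (Unp n) = c *s (A *v L' (Pri n))" if "n \<in> {1..7}" for n
      using A(2)[of "Unp n"] NL[OF that] that by (simp add: Unp_Labels)
    \<comment> \<open>Transporting \<open>L'\<close> by \<open>A\<close> gives a configuration whose
      second half is \<open>unp L\<close> itself, the scalars being harmless there.\<close>
    define p where "p a = A *v unp L' a" for a
    have "\<exists>k. k \<noteq> 0 \<and> unp L a = k *s (A *v pri L' a)" for a
      unfolding unp_def pri_def by (rule AL[OF lab_range])
    then have p: "m7_config p (unp L)"
      unfolding p_def by (intro m7_config_transform[OF realization_config[OF L'] A(1)] cf(1))
    obtain w k where w: "poly (tangent_quartic (unp L)) w = 0" and k: "k \<noteq> 0" "p 0 = k *s base_pt w"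
      by (rule predecessor_root[OF p])
    have wW: "w \<in> W" using w by (simp add: W_def)
    interpret m7_tangent "unp L" "pri L" w by (rule tan[OF wW])
    have "pgl_equiv L' (predecessor L w)"
      unfolding pgl_equiv_def
    proof (intro exI[of _ A] conjI ballI A(1))
      fix x assume "x \<in> Labels"
      then consider n where "n \<in> {1..7}" "x = Unp n" | n where "n \<in> {1..7}" "x = Pri n"
        unfolding Labels_def by blast
      then show "\<exists>c. c \<noteq> 0 \<and> predecessor L w x = c *s (A *v L' x)"
      proof cases
        case 1
        obtain l where "l \<noteq> 0" "p (int n) = l *s pt (int n)" using predecessor_pt[OF p k] by blast
        then show ?thesis
          using 1 by (intro exI[of _ "inverse l"]) (simp add: predecessor_def p_def unp_def lab_int)
      next
        case 2
        then show ?thesis using AL by (simp add: predecessor_def)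
      qed
    qed
    then show "C \<in> (\<lambda>w. pgl_class (predecessor L w)) ` W" using C wW pgl_class_eq by blast
  qed
  moreover have "inj_on (\<lambda>w. pgl_class (predecessor L w)) W"
  proof (rule inj_onI)
    fix w1 w2 assume w: "w1 \<in> W" "w2 \<in> W" and e: "pgl_class (predecessor L w1) = pgl_class (predecessor L w2)"
    have "predecessor L w1 \<in> pgl_class (predecessor L w1)"
      using real[OF w(1)] pgl_equiv_refl by (simp add: pgl_class_def)
    then have "pgl_equiv (predecessor L w2) (predecessor L w1)" unfolding e by (simp add: pgl_class_def)
    then obtain A where A: "\<And>x. x \<in> Labels \<Longrightarrow> \<exists>c. c \<noteq> 0 \<and> predecessor L w1 x = c *s (A *v predecessor L w2 x)"
      unfolding pgl_equiv_def by blast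
    \<comment> \<open>Both predecessors have the same second half, so \<open>A\<close> fixes each of
      its points projectively. Four of them form a frame, which makes \<open>A\<close> scalar and
      the two contact points proportional.\<close>
    have ev: "\<exists>k. A *v unp L a = k *s unp L a" for a
    proof -
      obtain c where "c \<noteq> 0" "L (Unp (lab a)) = c *s (A *v L (Unp (lab a)))"
        using A[of "Pri (lab a)"] lab_range[of a] by (auto simp: Unp_Labels predecessor_def)
      then have "A *v L (Unp (lab a)) = inverse c *s L (Unp (lab a))"
        by (metis left_inverse vector_smult_assoc vector_smult_lid)
      then show ?thesis unfolding unp_def by blast
    qed
    obtain a b c d where "A *v unp L 0 = a *s unp L 0" "A *v unp L 1 = b *s unp L 1"
      "A *v unp L 2 = c *s unp L 2" "A *v unp L 3 = d *s unp L 3"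
      using ev by metis
    note sc = eigenframe_scalar[OF this]
    have sc: "A *v X = d *s X" for X by (rule sc) (simp_all add: cf)
    have pt7: "predecessor L w (Unp 7) = base_pt w" if "w \<in> W" for w
    proof -
      interpret m7_tangent "unp L" "pri L" w by (rule tan[OF that])
      show ?thesis by (simp add: predecessor_def pt_def)
    qed
    obtain c where "base_pt w1 = c *s (A *v base_pt w2)"
      using A[of "Unp 7"] pt7 w by (auto simp: Unp_Labels)
    then have "base_pt w1 = (c * d) *s base_pt w2" by (simp add: sc)
    then show "w1 = w2" by (rule base_pt_inj)
  qed
  ultimately show ?thesis using card_tangents by (simp add: card_image W_def)
qed

section \<open>Lines through three double points\<close>

lemma dot3_cross [simp]: "dot3 (cross a b) a = 0" "dot3 (cross a b) b = 0"
  by (simp_all flip: det3_cross)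

lemma dot3_scale: "dot3 (k *s x) y = k * dot3 x y" "dot3 x (k *s y) = k * dot3 x y"
  by (simp_all add: dot3_expand algebra_simps)

lemma dot3_commute: "dot3 x y = dot3 y x"
  by (simp add: dot3_expand mult.commute)

lemma orthogonal_cross:
  assumes "indep2 a b" "dot3 p a = 0" "dot3 p b = 0"
  obtains k where "p = k *s cross a b"
proof -
  obtain c where c: "det3 a b c \<noteq> 0" using assms(1) indep2_def by blast
  define k where "k = dot3 p c / det3 a b c"
  define p' where "p' = p + (- k) *s cross a b"
  have d: "dot3 p' x = dot3 p x - k * dot3 (cross a b) x" for x
    by (simp add: p'_def dot3_expand algebra_simps)
  have "dot3 p' a = 0" "dot3 p' b = 0" "dot3 p' c = 0"
    using assms(2,3) c by (simp_all add: d k_def flip: det3_cross)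
  then have "p' = 0" using c concurrent_det3[of a b c] unfolding concurrent_def by blast
  then have "p = k *s cross a b" by (simp add: p'_def)
  then show ?thesis using that by blast
qed

lemma ray_scale:
  assumes "k \<noteq> 0"
  shows "ray (k *s v) = ray v"
proof -
  have "c *s (k *s v) = (c * k) *s v" "c *s v = (c / k) *s (k *s v)" for c using assms by simp_all
  then have "\<exists>c'. c *s (k *s v) = c' *s v" "\<exists>c'. c *s v = c' *s (k *s v)" for c by blast+
  then show ?thesis unfolding ray_def by blast
qed

locale general_lines =
  fixes m :: "nat \<Rightarrow> vec3" and I :: "nat set"
  assumes no_concurrent: "\<And>a b c. a \<in> I \<Longrightarrow> b \<in> I \<Longrightarrow> c \<in> I \<Longrightarrow> a \<noteq> b \<Longrightarrow> b \<noteq> c \<Longrightarrow> a \<noteq> c \<Longrightarrow>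
      det3 (m a) (m b) (m c) \<noteq> 0"
    and lines_indep: "\<And>a b. a \<in> I \<Longrightarrow> b \<in> I \<Longrightarrow> a \<noteq> b \<Longrightarrow> indep2 (m a) (m b)"
begin

lemma inj_lines: "inj_on m I"
  using lines_indep indep2_scale[of _ _ 1] by (intro inj_onI) (metis vector_smult_lid)

lemma point_on_two:
  assumes "p \<noteq> 0" "a \<in> I" "b \<in> I" "c \<in> I" "a \<noteq> b" "dot3 p (m a) = 0" "dot3 p (m b) = 0" "dot3 p (m c) = 0"
  shows "c = a \<or> c = b"
  using no_concurrent[of a b c] assms concurrent_det3[of "m a" "m b" "m c"] unfolding concurrent_def by blast

lemma double_pt_iff:
  "double_pt (m ` I) p \<longleftrightarrow> p \<noteq> 0 \<and> (\<exists>a\<in>I. \<exists>b\<in>I. a < b \<and> dot3 p (m a) = 0 \<and> dot3 p (m b) = 0)"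
proof -
  define Z where "Z = {a \<in> I. dot3 p (m a) = 0}"
  have "{x \<in> m ` I. dot3 p x = 0} = m ` Z" by (auto simp: Z_def)
  moreover have "inj_on m Z" using inj_lines by (rule inj_on_subset) (auto simp: Z_def)
  ultimately have c: "card {x \<in> m ` I. dot3 p x = 0} = card Z" by (simp add: card_image)
  show ?thesis
  proof
    assume "double_pt (m ` I) p"
    then have "p \<noteq> 0" "card Z = 2" unfolding double_pt_def c by blast+
    then obtain a b where ab: "Z = {a, b}" "a \<noteq> b" unfolding card_2_iff by blast
    then have "a \<in> Z" "b \<in> Z" by blast+
    then have "a \<in> I" "b \<in> I" "dot3 p (m a) = 0" "dot3 p (m b) = 0" by (simp_all add: Z_def)
    then show "p \<noteq> 0 \<and> (\<exists>a\<in>I. \<exists>b\<in>I. a < b \<and> dot3 p (m a) = 0 \<and> dot3 p (m b) = 0)"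
      using ab \<open>p \<noteq> 0\<close> by (metis linorder_neqE_nat)
  next
    assume "p \<noteq> 0 \<and> (\<exists>a\<in>I. \<exists>b\<in>I. a < b \<and> dot3 p (m a) = 0 \<and> dot3 p (m b) = 0)"
    then obtain a b where p: "p \<noteq> 0" and ab: "a \<in> I" "b \<in> I" "a < b" "dot3 p (m a) = 0" "dot3 p (m b) = 0"
      by blast
    have "Z = {a, b}" using ab point_on_two[OF p ab(1,2)] by (auto simp: Z_def)
    then show "double_pt (m ` I) p" unfolding double_pt_def c using p ab by simp
  qed
qed

text \<open>Since no three of the lines are concurrent, double points correspond bijectively to
  pairs \<open>a < b\<close>, so \<open>Lambda23\<close> becomes a count of pairs.\<close>

lemma card_double_pts:
  assumes l: "l \<noteq> 0"
  shows "card (ray ` {p. dot3 p l = 0 \<and> double_pt (m ` I) p}) =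
    card {(a, b). a \<in> I \<and> b \<in> I \<and> a < b \<and> det3 (m a) (m b) l = 0}" (is "card ?R = card ?E")
proof -
  have cr: "cross (m a) (m b) \<noteq> 0" if "a \<in> I" "b \<in> I" "a < b" for a b
    using lines_indep[of a b] that indep2_eq by auto
  have "?R = (\<lambda>(a, b). ray (cross (m a) (m b))) ` ?E"
  proof (intro equalityI subsetI)
    fix x assume "x \<in> ?R"
    then obtain p where p: "x = ray p" "dot3 p l = 0" "double_pt (m ` I) p" by blast
    then obtain a b where ab: "a \<in> I" "b \<in> I" "a < b" "dot3 p (m a) = 0" "dot3 p (m b) = 0" "p \<noteq> 0"
      unfolding double_pt_iff by blast
    obtain k where k: "p = k *s cross (m a) (m b)"
      using orthogonal_cross lines_indep ab by (metis nat_neq_iff)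
    then have "k \<noteq> 0" using ab by auto
    then have "det3 (m a) (m b) l = 0" using p(2) unfolding k dot3_scale det3_cross by simp
    moreover have "x = ray (cross (m a) (m b))" using p k ray_scale \<open>k \<noteq> 0\<close> by simp
    ultimately show "x \<in> (\<lambda>(a, b). ray (cross (m a) (m b))) ` ?E" using ab by force
  next
    fix x assume "x \<in> (\<lambda>(a, b). ray (cross (m a) (m b))) ` ?E"
    then obtain a b where ab: "a \<in> I" "b \<in> I" "a < b" "det3 (m a) (m b) l = 0" and x: "x = ray (cross (m a) (m b))"
      by auto
    have "double_pt (m ` I) (cross (m a) (m b))"
      unfolding double_pt_iff using cr[OF ab(1-3)] ab dot3_cross by blast
    then show "x \<in> ?R" using ab x by (auto simp: det3_cross)
  qed
  moreover have "inj_on (\<lambda>(a, b). ray (cross (m a) (m b))) ?E"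
  proof (rule inj_onI)
    fix x y assume "x \<in> ?E" "y \<in> ?E" and eq: "(\<lambda>(a, b). ray (cross (m a) (m b))) x = (\<lambda>(a, b). ray (cross (m a) (m b))) y"
    then obtain a b c d where x: "x = (a, b)" "a \<in> I" "b \<in> I" "a < b" and y: "y = (c, d)" "c \<in> I" "d \<in> I" "c < d"
      by auto
    have "cross (m a) (m b) \<in> ray (cross (m a) (m b))" unfolding ray_def by (metis rangeI vector_smult_lid)
    then have "cross (m a) (m b) \<in> ray (cross (m c) (m d))" using eq x y by simp
    then obtain k where "cross (m a) (m b) = k *s cross (m c) (m d)" unfolding ray_def by blast
    then have o: "dot3 (cross (m a) (m b)) (m c) = 0" "dot3 (cross (m a) (m b)) (m d) = 0"
      by (simp_all add: dot3_scale)
    have "c = a \<or> c = b" "d = a \<or> d = b"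
      using point_on_two[OF cr[OF x(2-4)] x(2,3)] x y o by auto
    then show "x = y" using x y by auto
  qed
  ultimately show ?thesis by (simp add: card_image)
qed

lemma Lambda23_iff:
  "l \<in> Lambda23 (m ` I) \<longleftrightarrow>
     l \<noteq> 0 \<and> card {(a, b). a \<in> I \<and> b \<in> I \<and> a < b \<and> det3 (m a) (m b) l = 0} = 3"
  unfolding Lambda23_def using card_double_pts by auto

text \<open>A line meeting two double points of one \<open>m x\<close> equals \<open>m x\<close>, and so carries more than three double points.\<close>

lemma Lambda23_disjoint:
  assumes l: "l \<in> Lambda23 (m ` I)" and I: "finite I" "card I = 6"
    and xyz: "x \<in> I" "y \<in> I" "z \<in> I" "x \<noteq> y" "x \<noteq> z" "y \<noteq> z"
  shows "det3 (m x) (m y) l \<noteq> 0 \<or> det3 (m x) (m z) l \<noteq> 0"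
proof (rule ccontr)
  assume n: "\<not> ?thesis"
  obtain s t where st: "l = s *s m x + t *s m y" using n line_coords lines_indep xyz by metis
  have "t * det3 (m x) (m z) (m y) = 0" using n unfolding st by (simp add: det3_add det3_scale)
  then have "t = 0" using no_concurrent[of x z y] xyz by auto
  then have st: "l = s *s m x" using st by simp
  let ?E = "{(a, b). a \<in> I \<and> b \<in> I \<and> a < b \<and> det3 (m a) (m b) l = 0}"
  have sub: "(\<lambda>a. (min x a, max x a)) ` (I - {x}) \<subseteq> ?E"
    using xyz by (auto simp: st det3_scale min_def max_def split: if_splits)
  have inj: "inj_on (\<lambda>a. (min x a, max x a)) (I - {x})"
    by (rule inj_onI) (auto simp: min_def max_def split: if_splits)
  have fin: "finite ?E" by (rule finite_subset[of _ "I \<times> I"]) (use I in auto)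
  have "card (I - {x}) \<le> card ?E" using card_mono[OF fin sub] card_image[OF inj] by simp
  then show False using l I xyz unfolding Lambda23_iff by simp
qed

end

lemma card_pairs_sum:
  assumes "j \<in> {1..7}"
  shows "card {(a, b). a \<in> {1..7} - {j} \<and> b \<in> {1..7} - {j} \<and> a < b \<and> 7 dvd int a + int b - 2 * int j} = 3"
proof -
  have "{(a, b). a \<in> {1..7} - {j} \<and> b \<in> {1..7} - {j} \<and> a < b \<and> 7 dvd int a + int b - 2 * int j}
     = set (filter (\<lambda>(a, b). a \<noteq> j \<and> b \<noteq> j \<and> a < b \<and> 7 dvd int a + int b - 2 * int j) (List.product [1..<8] [1..<8]))"
    by auto
  moreover have "\<forall>j\<in>set [1..<8]. length (remdups (filter (\<lambda>(a, b). a \<noteq> j \<and> b \<noteq> j \<and> a < b \<and> 7 dvd int a + int b - 2 * int j) (List.product [1..<8] [1..<8]))) = 3"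
    by code_simp
  moreover have "j \<in> set [1..<8]" using assms by auto
  ultimately show ?thesis by (simp only: length_remdups_card_conv[symmetric])
qed

text \<open>Three double points on a line use disjoint pairs, hence all six lines. The hypothesis
  restricts these matchings to those with equal sums modulo 7, and this forces the three double
  points of \<open>L (Pri j)\<close>.\<close>

lemma Lambda23_six:
  assumes L: "is_realization L" and j: "j \<in> {1..7}"
    and matchings: "\<And>a b c d e f. {a, b, c, d, e, f} = {1..7} - {j} \<Longrightarrow> a < b \<Longrightarrow> c < d \<Longrightarrow> e < f \<Longrightarrow>
      det3 (cross (L (Unp a)) (L (Unp b))) (cross (L (Unp c)) (L (Unp d))) (cross (L (Unp e)) (L (Unp f))) = 0 \<Longrightarrow>
      7 dvd int a + int b - (int c + int d) \<and> 7 dvd int a + int b - (int e + int f)"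
  shows "Lambda23 (L ` Unp ` ({1..7} - {j})) = ray (L (Pri j)) - {0}"
proof -
  define m I where "m n = L (Unp n)" and "I = {1..7} - {j}" for n
  note c = realization_config[OF L]
  note cc = m7_configD[OF c]
  have u: "m k = unp L (int k)" "L (Pri k) = pri L (int k)" if "k \<in> {1..7}" for k
    using that by (simp_all add: m_def unp_def pri_def lab_int)
  have nd: "\<not> 7 dvd int a - int b" if "a \<in> I" "b \<in> I" "a \<noteq> b" for a b
    using dvd_in_range[of a b] that by (auto simp: I_def)
  interpret general_lines m I
  proof
    show *: "det3 (m a) (m b) (m c) \<noteq> 0" if "a \<in> I" "b \<in> I" "c \<in> I" "a \<noteq> b" "b \<noteq> c" "a \<noteq> c" for a b c
      using cc(3)[OF nd[OF that(1,2,4)] nd[OF that(2,3,5)] nd[OF that(1,3,6)]] that by (simp add: u I_def)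
    show "indep2 (m a) (m b)" if "a \<in> I" "b \<in> I" "a \<noteq> b" for a b
    proof -
      obtain k where k: "\<not> 7 dvd k - int a" "\<not> 7 dvd k - int b" by (rule residue7_third)
      then have "\<not> 7 dvd int a - k" "\<not> 7 dvd int b - k"
        using dvd_diff_commute[of 7 k "int a"] dvd_diff_commute[of 7 k "int b"] by simp_all
      then have "det3 (unp L (int a)) (unp L (int b)) (unp L k) \<noteq> 0" using cc(3)[OF nd[OF that]] by blast
      then show ?thesis using that indep2I by (simp add: u I_def)
    qed
  qed
  have fin: "finite I" "card I = 6" using j by (simp_all add: I_def)
  have img: "L ` Unp ` ({1..7} - {j}) = m ` I" by (auto simp: m_def I_def)
  have iff: "det3 (m a) (m b) (L (Pri j)) = 0 \<longleftrightarrow> 7 dvd int a + int b - 2 * int j"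
    if "a \<in> I" "b \<in> I" "a \<noteq> b" for a b
    using cc(5)[OF nd[OF that]] that j by (simp add: u I_def)
  have "l \<in> Lambda23 (m ` I) \<longleftrightarrow> l \<in> ray (L (Pri j)) - {0}" for l
  proof
    assume "l \<in> ray (L (Pri j)) - {0}"
    then obtain k where k: "l = k *s L (Pri j)" "l \<noteq> 0" unfolding ray_def by blast
    then have "k \<noteq> 0" by auto
    then have "{(a, b). a \<in> I \<and> b \<in> I \<and> a < b \<and> det3 (m a) (m b) l = 0} =
        {(a, b). a \<in> I \<and> b \<in> I \<and> a < b \<and> 7 dvd int a + int b - 2 * int j}"
      using iff by (auto simp: k(1) det3_scale)
    then show "l \<in> Lambda23 (m ` I)" unfolding Lambda23_iff using card_pairs_sum[OF j] k by (simp add: I_def)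
  next
    assume l: "l \<in> Lambda23 (m ` I)"
    define E where "E = {(a, b). a \<in> I \<and> b \<in> I \<and> a < b \<and> det3 (m a) (m b) l = 0}"
    have l0: "l \<noteq> 0" and "card E = 3" using l unfolding Lambda23_iff E_def by blast+
    then obtain x y z where E: "E = {x, y, z}" and xyz: "x \<noteq> y" "x \<noteq> z" "y \<noteq> z" unfolding card_3_iff by blast
    obtain a1 b1 a2 b2 a3 b3 where p: "x = (a1, b1)" "y = (a2, b2)" "z = (a3, b3)" by (metis surj_pair)
    have inE: "a \<in> I" "b \<in> I" "a < b" "det3 (m a) (m b) l = 0" if "(a, b) \<in> E" for a b
      using that by (simp_all add: E_def)
    have disj: "a \<noteq> c \<and> a \<noteq> d \<and> b \<noteq> c \<and> b \<noteq> d" if "(a, b) \<in> E" "(c, d) \<in> E" "(a, b) \<noteq> (c, d)" for a b c d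
    proof -
      note ab = inE[OF that(1)] and cd = inE[OF that(2)]
      have r: "False" if "x \<in> I" "y \<in> I" "z \<in> I" "x \<noteq> y" "x \<noteq> z" "y \<noteq> z" "det3 (m x) (m y) l = 0" "det3 (m x) (m z) l = 0" for x y z
        using Lambda23_disjoint[OF l fin that(1-6)] that(7,8) by blast
      note ab' = det3_zero_perm(2)[OF ab(4)] and cd' = det3_zero_perm(2)[OF cd(4)]
      have "a \<noteq> c" using r[of a b d] ab cd that(3) by auto
      moreover have "b \<noteq> d" using r[of b a c] ab cd ab' cd' that(3) by auto
      moreover have "a \<noteq> d" using r[of a b c] ab cd cd' by auto
      moreover have "b \<noteq> c" using r[of b a d] ab cd ab' by auto
      ultimately show ?thesis by blast
    qed
    have e: "(a1, b1) \<in> E" "(a2, b2) \<in> E" "(a3, b3) \<in> E" using E p by auto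
    note i1 = inE[OF e(1)] and i2 = inE[OF e(2)] and i3 = inE[OF e(3)]
    have d: "a1 \<noteq> a2 \<and> a1 \<noteq> b2 \<and> b1 \<noteq> a2 \<and> b1 \<noteq> b2" "a1 \<noteq> a3 \<and> a1 \<noteq> b3 \<and> b1 \<noteq> a3 \<and> b1 \<noteq> b3"
      "a2 \<noteq> a3 \<and> a2 \<noteq> b3 \<and> b2 \<noteq> a3 \<and> b2 \<noteq> b3"
      using disj[OF e(1,2)] disj[OF e(1,3)] disj[OF e(2,3)] xyz unfolding p by blast+
    have "card {a1, b1, a2, b2, a3, b3} = 6" using d i1(3) i2(3) i3(3) by auto
    moreover have "{a1, b1, a2, b2, a3, b3} \<subseteq> I" using i1 i2 i3 by simp
    ultimately have six: "{a1, b1, a2, b2, a3, b3} = I" using fin card_subset_eq by metis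
    have "dot3 l (cross (m a1) (m b1)) = 0" "dot3 l (cross (m a2) (m b2)) = 0" "dot3 l (cross (m a3) (m b3)) = 0"
      using i1 i2 i3 by (simp_all add: det3_cross dot3_commute[of l])
    then have "det3 (cross (m a1) (m b1)) (cross (m a2) (m b2)) (cross (m a3) (m b3)) = 0"
      unfolding concurrent_det3[symmetric] concurrent_def using l0 by blast
    then have s: "7 dvd int a1 + int b1 - (int a2 + int b2) \<and> 7 dvd int a1 + int b1 - (int a3 + int b3)"
      using matchings[of a1 b1 a2 b2 a3 b3] six i1 i2 i3 by (simp add: I_def m_def)
    have "\<Sum>{a1, b1, a2, b2, a3, b3} + j = \<Sum>{1..7}"
      unfolding six I_def using sum.remove[of "{1..7}" j "\<lambda>x. x"] j by simp
    moreover have "\<Sum>{1..7} = (28::nat)" by (simp add: atLeastAtMost_upt upt_rec)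
    ultimately have "a1 + b1 + (a2 + b2) + (a3 + b3) + j = 28" using d i1(3) i2(3) i3(3) by simp
    then have t: "int a1 + int b1 + (int a2 + int b2) + (int a3 + int b3) + int j = 28" by linarith
    \<comment> \<open>The labels 1 to 7 sum to 28. If the three pair sums all equal \<open>s\<close>
      modulo 7, then \<open>3 s = - k\<close>, so \<open>s = 2 k\<close>.\<close>
    have "7 dvd s1 - 2 * k" if "s1 + s2 + s3 + k = 28" "7 dvd s1 - s2" "7 dvd s1 - s3" for s1 s2 s3 k :: int
    proof -
      have "k = 28 - s1 - s2 - s3" using that(1) by simp
      then have "s1 - 2 * k = - 2 * (s1 - s2) + - 2 * (s1 - s3) + 7 * (s1 - 8)" by (simp add: algebra_simps)
      then show ?thesis using that(2,3) by (metis dvd_add dvd_mult dvd_triv_left)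
    qed
    from this[OF t] s have s1: "7 dvd int a1 + int b1 - 2 * int j" by blast
    then have s2: "7 dvd int a2 + int b2 - 2 * int j"
      using dvd_diff[OF s1 conjunct1[OF s]] by (simp add: algebra_simps)
    \<comment> \<open>Both \<open>l\<close> and \<open>n\<close> pass through the double points of
      the first two pairs, and two distinct points determine the line.\<close>
    define n where "n = L (Pri j)"
    have n: "det3 (m a1) (m b1) n = 0" "det3 (m a2) (m b2) n = 0" "n \<noteq> 0"
      using iff[of a1 b1] iff[of a2 b2] i1 i2 s1 s2 L j unfolding is_realization_def Labels_def n_def by auto
    have ind: "indep2 (m a1) (m b1)" using lines_indep i1 by auto
    obtain x y where l': "l = x *s m a1 + y *s m b1" using line_coords[OF ind i1(4)] .
    obtain x' y' where n': "n = x' *s m a1 + y' *s m b1" using line_coords[OF ind n(1)] .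
    define g h where "g = det3 (m a2) (m b2) (m a1)" and "h = det3 (m a2) (m b2) (m b1)"
    have gh: "g \<noteq> 0" "h \<noteq> 0" unfolding g_def h_def using no_concurrent i1 i2 d by auto
    have "x * g + y * h = 0" "x' * g + y' * h = 0"
      using i2(4) n(2) unfolding l' n' by (simp_all add: det3_add det3_scale g_def h_def)
    then have x: "x = y * (- h / g)" "x' = y' * (- h / g)" using gh by (simp_all add: field_simps eq_neg_iff_add_eq_0)
    then have "y' \<noteq> 0" using n(3) n' by auto
    then have "l = (y / y') *s n" unfolding l' n' x vector_add_ldistrib vector_smult_assoc by simp
    then show "l \<in> ray (L (Pri j)) - {0}" using l0 unfolding ray_def n_def by blast
  qed
  then show ?thesis unfolding img by blast
qed

section \<open>The genericity polynomial\<close>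

lemma poly_fun_diff: "poly_fun f \<Longrightarrow> poly_fun g \<Longrightarrow> poly_fun (\<lambda>L. f L - g L)"
  using poly_fun.add[OF _ poly_fun.mult[OF poly_fun.const[of "-1"]], of f g] by simp

lemma poly_fun_power: "poly_fun f \<Longrightarrow> poly_fun (\<lambda>L. f L ^ n)"
  by (induction n) (simp_all add: poly_fun.const poly_fun.mult)

lemma poly_fun_prod:
  assumes "finite A" "\<And>i. i \<in> A \<Longrightarrow> poly_fun (\<lambda>L. f L i)"
  shows "poly_fun (\<lambda>L. \<Prod>i\<in>A. f L i)"
  using assms by (induction A rule: finite_induct) (simp_all add: poly_fun.const poly_fun.mult)

lemma poly_fun_det3:
  assumes "\<And>i. poly_fun (\<lambda>L. f L $ i)" "\<And>i. poly_fun (\<lambda>L. g L $ i)" "\<And>i. poly_fun (\<lambda>L. h L $ i)"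
  shows "poly_fun (\<lambda>L. det3 (f L) (g L) (h L))"
  unfolding det3_def by (intro poly_fun.add poly_fun.mult poly_fun_diff assms)

lemma poly_fun_cross:
  assumes "\<And>i. poly_fun (\<lambda>L. f L $ i)" "\<And>i. poly_fun (\<lambda>L. g L $ i)"
  shows "poly_fun (\<lambda>L. cross (f L) (g L) $ i)"
proof -
  have "i = 1 \<or> i = 2 \<or> i = 3" using exhaust_3 by blast
  then show ?thesis by (auto simp: cross_def intro!: poly_fun.mult poly_fun_diff assms)
qed

lemma poly_fun_unp: "poly_fun (\<lambda>L. unp L a $ i)" "poly_fun (\<lambda>L. pri L a $ i)"
  unfolding unp_def pri_def by (rule poly_fun.coord; use lab_range[of a] in \<open>simp add: Labels_def\<close>)+

lemma poly_fun_m7_cubic: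
  assumes "\<And>i. poly_fun (\<lambda>L. f L $ i)" "\<And>i. poly_fun (\<lambda>L. g L $ i)" "\<And>i. poly_fun (\<lambda>L. h L $ i)"
  shows "poly_fun (\<lambda>L. m7_cubic (unp L) (f L) (g L) (h L))"
  unfolding m7_cubic_def symmetrize_def row_form_def col_form_def
  by (intro poly_fun.add poly_fun.mult poly_fun_diff poly_fun_det3 poly_fun_unp assms)

lemma tangent_coeff_simps:
  "tangent_coeff q 0 = (m7_cubic q (q 1) (q 1) (q 0))^2"
  "tangent_coeff q 1 = 4 * m7_cubic q (q 1) (q 1) (q 0) * m7_cubic q (q 0) (q 1) (q 2)
     - 4 * m7_cubic q (q 1) (q 1) (q 2) * m7_cubic q (q 1) (q 0) (q 0)"
  "tangent_coeff q 2 = 4 * (m7_cubic q (q 0) (q 1) (q 2))^2 + 2 * m7_cubic q (q 1) (q 1) (q 0) * m7_cubic q (q 2) (q 2) (q 0)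
     - 4 * (m7_cubic q (q 1) (q 1) (q 2) * m7_cubic q (q 2) (q 0) (q 0) + m7_cubic q (q 1) (q 2) (q 2) * m7_cubic q (q 1) (q 0) (q 0))"
  "tangent_coeff q 3 = 4 * m7_cubic q (q 0) (q 1) (q 2) * m7_cubic q (q 2) (q 2) (q 0)
     - 4 * m7_cubic q (q 1) (q 2) (q 2) * m7_cubic q (q 2) (q 0) (q 0)"
  "tangent_coeff q 4 = (m7_cubic q (q 2) (q 2) (q 0))^2"
  by (simp_all add: tangent_coeff_def Let_def numeral_nat)

text \<open>Equal sums are left out because then the three double points do lie on a common line,
  the primed line of the omitted label.\<close>

definition matchings :: "(nat \<times> nat \<times> nat \<times> nat \<times> nat \<times> nat) set" where
  "matchings = {(a, b, c, d, e, f). {a, b, c, d, e, f} \<subseteq> {1..7} \<and> distinct [a, b, c, d, e, f] \<and>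
     a < b \<and> c < d \<and> e < f \<and>
     \<not> (7 dvd int a + int b - (int c + int d) \<and> 7 dvd int a + int b - (int e + int f))}"

definition genericity :: "(label \<Rightarrow> vec3) \<Rightarrow> complex" where
  "genericity L = tangent_disc (unp L) * flex_value (unp L)
     * (\<Prod>x\<in>{x \<in> {0..6} \<times> {0..6}. fst x \<noteq> snd x}. m7_cubic (unp L) (unp L (fst x)) (unp L (fst x)) (unp L (snd x)))
     * (\<Prod>x\<in>{0..6} \<times> {0..6}. m7_cubic (unp L) (pri L (fst x)) (pri L (fst x)) (unp L (snd x)))
     * (\<Prod>(a, b, c, d, e, f)\<in>matchings. det3 (cross (unp L (int a)) (unp L (int b)))
          (cross (unp L (int c)) (unp L (int d))) (cross (unp L (int e)) (unp L (int f))))"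

lemma finite_matchings: "finite matchings"
proof (rule finite_subset)
  show "matchings \<subseteq> {1..7} \<times> {1..7} \<times> {1..7} \<times> {1..7} \<times> {1..7} \<times> {1..7}"
    by (auto simp: matchings_def)
qed simp

lemma poly_fun_genericity: "poly_fun genericity"
  unfolding genericity_def tangent_disc_def flex_value_def Let_def quartic_disc_def tangent_coeff_simps split_beta
  by (intro poly_fun.add poly_fun.mult poly_fun.const poly_fun_diff poly_fun_power poly_fun_prod poly_fun_m7_cubic
      poly_fun_det3 poly_fun_cross poly_fun_unp finite_matchings) auto

lemma genericity_card:
  assumes L: "is_realization L" and g: "genericity L \<noteq> 0"
  shows "card (pgl_class ` {L'. \<exists>N. lam_rel L' N \<and> pgl_equiv N L}) = 4"
proof (rule card_preimages[OF L])
  note c = realization_config[OF L]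
  note cc = m7_configD[OF c]
  have g1: "tangent_disc (unp L) \<noteq> 0" "flex_value (unp L) \<noteq> 0"
    and g2: "m7_cubic (unp L) (unp L i) (unp L i) (unp L j) \<noteq> 0" if "i \<in> {0..6}" "j \<in> {0..6}" "i \<noteq> j" for i j
    using g that unfolding genericity_def by auto
  have g3: "m7_cubic (unp L) (pri L i) (pri L i) (unp L j) \<noteq> 0" if "i \<in> {0..6}" "j \<in> {0..6}" for i j
    using g that unfolding genericity_def by auto
  have g4: "det3 (cross (unp L (int a)) (unp L (int b)))
          (cross (unp L (int c)) (unp L (int d))) (cross (unp L (int e)) (unp L (int f))) \<noteq> 0"
    if "(a, b, c, d, e, f) \<in> matchings" for a b c d e f
    using g that finite_matchings unfolding genericity_def by fastforce
  have md: "a mod 7 \<in> {0..6}" "7 dvd a - a mod 7" for a :: int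
    using pos_mod_bound[of 7 a] by (auto simp: dvd_minus_mod)
  have per: "unp L a = unp L (a mod 7)" "pri L a = pri L (a mod 7)" for a
    by (rule cc(1), rule md) (rule cc(2), rule md)
  show "m7_generic (unp L) (pri L)"
  proof
    fix i j :: int
    show "m7_cubic (unp L) (unp L i) (unp L i) (unp L j) \<noteq> 0" if "\<not> 7 dvd i - j"
    proof -
      have "i mod 7 \<noteq> j mod 7" using that by (simp add: mod_eq_dvd_iff)
      then show ?thesis unfolding per(1)[of i] per(1)[of j] using g2 md by blast
    qed
    show "m7_cubic (unp L) (pri L i) (pri L i) (unp L j) \<noteq> 0"
      unfolding per(2)[of i] per(1)[of j] using g3 md by blast
  qed (use c g1[of 0 1] in auto)
  fix j :: nat assume j: "j \<in> {1..7}"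
  have u: "L (Unp k) = unp L (int k)" if "k \<in> {1..7}" for k
    using that by (simp add: unp_def lab_int)
  show "Lambda23 (L ` Unp ` ({1..7} - {j})) = ray (L (Pri j)) - {0}"
  proof (rule Lambda23_six[OF L j])
    fix a b c d e f :: nat
    assume s: "{a, b, c, d, e, f} = {1..7} - {j}" and o: "a < b" "c < d" "e < f"
      and z: "det3 (cross (L (Unp a)) (L (Unp b))) (cross (L (Unp c)) (L (Unp d))) (cross (L (Unp e)) (L (Unp f))) = 0"
    have sub: "{a, b, c, d, e, f} \<subseteq> {1..7}" using s by blast
    have "card (set [a, b, c, d, e, f]) = length [a, b, c, d, e, f]" using s j by simp
    then have "distinct [a, b, c, d, e, f]" by (rule card_distinct)
    moreover have "L (Unp a) = unp L (int a)" "L (Unp b) = unp L (int b)" "L (Unp c) = unp L (int c)"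
      "L (Unp d) = unp L (int d)" "L (Unp e) = unp L (int e)" "L (Unp f) = unp L (int f)"
      using u sub by auto
    ultimately show "7 dvd int a + int b - (int c + int d) \<and> 7 dvd int a + int b - (int e + int f)"
      using g4[of a b c d e f] z sub o unfolding matchings_def by auto
  qed
qed

section \<open>An explicit generic realization\<close>

type_synonym ivec3 = "int \<times> int \<times> int"

text \<open>Integer triples with executable brackets allow the finite checks on the example to be
  carried out by evaluation and then transported to complex vectors.\<close>

definition cvec :: "ivec3 \<Rightarrow> vec3" where
  "cvec v = (case v of (x, y, z) \<Rightarrow> vector [of_int x, of_int y, of_int z])"

fun idet3 :: "ivec3 \<Rightarrow> ivec3 \<Rightarrow> ivec3 \<Rightarrow> int" where
  "idet3 (a1, a2, a3) (b1, b2, b3) (c1, c2, c3) =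
     a1 * (b2 * c3 - b3 * c2) - a2 * (b1 * c3 - b3 * c1) + a3 * (b1 * c2 - b2 * c1)"

fun icross :: "ivec3 \<Rightarrow> ivec3 \<Rightarrow> ivec3" where
  "icross (a1, a2, a3) (b1, b2, b3) = (a2 * b3 - a3 * b2, a3 * b1 - a1 * b3, a1 * b2 - a2 * b1)"

lemma det3_cvec: "det3 (cvec a) (cvec b) (cvec c) = of_int (idet3 a b c)"
  by (cases a; cases b; cases c) (simp add: det3_def cvec_def)

lemma cross_cvec: "cross (cvec a) (cvec b) = cvec (icross a b)"
  by (cases a; cases b) (simp add: cross_def cvec_def)

text \<open>The points are \<open>u + a t\<close> and \<open>-2 u - 2 a t\<close>, \<open>a = 0, \<dots>, 6\<close>, on the elliptic curve
  \<open>y\<^sup>2 - 55 x y - 448 y = x\<^sup>3 - 448 x\<^sup>2\<close>, where \<open>t = (0, 0)\<close> has order 7 and \<open>u = (-42, -882)\<close>.\<close>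

definition sample_q :: "nat \<Rightarrow> ivec3" where
  "sample_q k = [(-42, -882, 1), (-224, -7168, 1), (-64, -1024, 1), (-112, -3920, 1), (-140, -2352, 1),
     (-6720, -200704, 125), (-6720, -156800, 27)] ! k"

definition sample_r :: "nat \<Rightarrow> ivec3" where
  "sample_r k = [(6916, -397488, 1), (320320, 1254400, 1331), (30, 198, 1), (-25536, 200704, 6859),
     (16016, 1802416, 2197), (12320, 652288, 125), (25536, 1617280, 27)] ! k"

text \<open>Reduction modulo 7 sends the label 7 to index 0.\<close>

definition sample :: "label \<Rightarrow> vec3" where
  "sample x = (case x of Unp n \<Rightarrow> cvec (sample_q (n mod 7)) | Pri n \<Rightarrow> cvec (sample_r (n mod 7)))"

lemma lab_mod: "lab a mod 7 = nat (a mod 7)"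
  by (auto simp: lab_def nat_mod_distrib)

lemma unp_sample: "unp sample a = cvec (sample_q (nat (a mod 7)))"
  by (simp add: unp_def sample_def lab_mod)

lemma pri_sample: "pri sample a = cvec (sample_r (nat (a mod 7)))"
  by (simp add: pri_def sample_def lab_mod)

text \<open>Over natural numbers \<open>5 * c\<close> stands for \<open>- 2 * c\<close> modulo 7.
  Increasing indices suffice where the bracket is antisymmetric.\<close>

lemma sample_brackets:
  "\<forall>a\<in>set [0..<7]. \<forall>b\<in>set [0..<7]. \<forall>c\<in>set [0..<7].
     (a < b \<longrightarrow> b < c \<longrightarrow> idet3 (sample_q a) (sample_q b) (sample_q c) \<noteq> 0
        \<and> idet3 (sample_r a) (sample_r b) (sample_r c) \<noteq> 0) \<and>
     (a < b \<longrightarrow> (idet3 (sample_q a) (sample_q b) (sample_r c) = 0 \<longleftrightarrow> (a + b + 5 * c) mod 7 = 0)) \<and>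
     (b < c \<longrightarrow> idet3 (sample_q a) (sample_r b) (sample_r c) \<noteq> 0)"
  by code_simp

lemma sample_config: "m7_config (unp sample) (pri sample)"
proof -
  define i where "i a = nat (a mod 7)" for a :: int
  have i: "i a \<in> set [0..<7]" for a
    using pos_mod_bound[of 7 a] by (auto simp: i_def nat_less_iff)
  have int_i: "int (i a) = a mod 7" for a by (simp add: i_def)
  have i_eq: "i a = i b \<longleftrightarrow> 7 dvd a - b" for a b
    using int_i[of a] int_i[of b] by (metis mod_eq_dvd_iff of_nat_eq_iff)
  have i_sum: "(i a + i b + 5 * i c) mod 7 = 0 \<longleftrightarrow> 7 dvd a + b - 2 * c" for a b c
  proof -
    have "(i a + i b + 5 * i c) mod 7 = 0 \<longleftrightarrow> 7 dvd int (i a) + int (i b) + 5 * int (i c)"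
      using int_dvd_int_iff[of 7 "i a + i b + 5 * i c"] by (simp add: mod_eq_0_iff_dvd)
    also have "\<dots> \<longleftrightarrow> 7 dvd a mod 7 + b mod 7 + 5 * (c mod 7)" by (simp add: int_i)
    also have "\<dots> \<longleftrightarrow> 7 dvd a + b - 2 * c"
      by (rule dvd7_cong)
        (use dvd_diff[OF dvd_triv_left[of 7 c] dvd_add[OF dvd_add[OF dvd_minus_mod[of 7 a] dvd_minus_mod[of 7 b]]
            dvd_mult[OF dvd_minus_mod[of 7 c], of 5]]] in \<open>simp add: algebra_simps\<close>)
    finally show ?thesis .
  qed
  note br = sample_brackets[rule_format, OF i i i]
  have u: "unp sample a = cvec (sample_q (i a))" "pri sample a = cvec (sample_r (i a))" for a
    by (simp_all add: unp_sample pri_sample i_def)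
  have qqr: "det3 (unp sample a) (unp sample b) (pri sample c) = 0 \<longleftrightarrow> 7 dvd a + b - 2 * c"
    if "i a < i b" for a b c
    using br[of a b c] that i_sum by (simp add: u det3_cvec)
  have qrr: "det3 (unp sample a) (pri sample b) (pri sample c) \<noteq> 0" if "i b < i c" for a b c
    using br[of a b c] that by (simp add: u det3_cvec)
  have qqq: "det3 (unp sample a) (unp sample b) (unp sample c) \<noteq> 0
      \<and> det3 (pri sample a) (pri sample b) (pri sample c) \<noteq> 0" if "i a < i b" "i b < i c" for a b c
    using br[of a b c] that by (simp add: u det3_cvec)
  show ?thesis
    unfolding m7_config_def
  proof (intro conjI allI impI)
    fix a b :: int assume "7 dvd a - b"
    then have "i a = i b" by (simp add: i_eq)
    then show "unp sample a = unp sample b" "pri sample a = pri sample b" by (simp_all add: u)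
  next
    fix a b c :: int assume "\<not> 7 dvd a - b \<and> \<not> 7 dvd b - c \<and> \<not> 7 dvd a - c"
    then have n: "i a \<noteq> i b" "i b \<noteq> i c" "i a \<noteq> i c" by (simp_all add: i_eq)
    have p: "det3 x y z \<noteq> 0 \<Longrightarrow> det3 x z y \<noteq> 0" "det3 x y z \<noteq> 0 \<Longrightarrow> det3 y x z \<noteq> 0"
      "det3 x y z \<noteq> 0 \<Longrightarrow> det3 y z x \<noteq> 0" "det3 x y z \<noteq> 0 \<Longrightarrow> det3 z x y \<noteq> 0"
      "det3 x y z \<noteq> 0 \<Longrightarrow> det3 z y x \<noteq> 0" for x y z
      using det3_zero_perm by blast+
    consider "i a < i b" "i b < i c" | "i a < i c" "i c < i b" | "i b < i a" "i a < i c"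
      | "i b < i c" "i c < i a" | "i c < i a" "i a < i b" | "i c < i b" "i b < i a"
      using n by linarith
    then have "det3 (unp sample a) (unp sample b) (unp sample c) \<noteq> 0 \<and> det3 (pri sample a) (pri sample b) (pri sample c) \<noteq> 0"
      by cases (use qqq p in metis)+
    then show "det3 (unp sample a) (unp sample b) (unp sample c) \<noteq> 0" "det3 (pri sample a) (pri sample b) (pri sample c) \<noteq> 0"
      by blast+
  next
    fix a b c :: int assume "\<not> 7 dvd a - b"
    then consider "i a < i b" | "i b < i a" using i_eq by (metis linorder_neqE_nat)
    then show "det3 (unp sample a) (unp sample b) (pri sample c) = 0 \<longleftrightarrow> 7 dvd a + b - 2 * c"
    proof cases
      case 2
      have "det3 (unp sample a) (unp sample b) (pri sample c) = 0 \<longleftrightarrow> det3 (unp sample b) (unp sample a) (pri sample c) = 0"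
        by (rule iffI; erule det3_zero_perm(2))
      then show ?thesis using qqr[OF 2] by (simp add: add.commute)
    qed (rule qqr)
  next
    fix a b c :: int assume "\<not> 7 dvd b - c"
    then consider "i b < i c" | "i c < i b" using i_eq by (metis linorder_neqE_nat)
    then show "det3 (unp sample a) (pri sample b) (pri sample c) \<noteq> 0"
    proof cases
      case 2
      then show ?thesis using qrr[OF 2] det3_zero_perm(1) by blast
    qed (rule qrr)
  qed
qed

definition irow :: "ivec3 \<Rightarrow> ivec3 \<Rightarrow> ivec3 \<Rightarrow> int" where
  "irow x y z = idet3 (sample_q 1) (sample_q 6) x * idet3 (sample_q 5) (sample_q 3) y * idet3 (sample_q 2) (sample_q 0) z"

definition icol :: "ivec3 \<Rightarrow> ivec3 \<Rightarrow> ivec3 \<Rightarrow> int" where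
  "icol x y z = idet3 (sample_q 5) (sample_q 2) x * idet3 (sample_q 1) (sample_q 0) y * idet3 (sample_q 6) (sample_q 3) z"

definition icubic :: "ivec3 \<Rightarrow> ivec3 \<Rightarrow> ivec3 \<Rightarrow> int" where
  "icubic x y z =
     (irow x y z + irow x z y + irow y x z + irow y z x + irow z x y + irow z y x) * icol (sample_q 4) (sample_q 4) (sample_q 4)
     - (icol x y z + icol x z y + icol y x z + icol y z x + icol z x y + icol z y x) * irow (sample_q 4) (sample_q 4) (sample_q 4)"

lemma m7_cubic_sample: "m7_cubic (unp sample) (cvec x) (cvec y) (cvec z) = of_int (icubic x y z)"
  by (simp add: m7_cubic_def symmetrize_def row_form_def col_form_def unp_sample det3_cvec icubic_def irow_def icol_def)

lemma sample_tangents: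
  "\<forall>i\<in>set [0..<7]. \<forall>j\<in>set [0..<7]. (i \<noteq> j \<longrightarrow> icubic (sample_q i) (sample_q i) (sample_q j) \<noteq> 0)
     \<and> icubic (sample_r i) (sample_r i) (sample_q j) \<noteq> 0"
  by code_simp

text \<open>Conditionals instead of implications, so that evaluation skips the degenerate tuples.\<close>

lemma sample_matchings:
  "\<forall>a\<in>set [1..<8]. \<forall>b\<in>set [Suc a..<8]. \<forall>c\<in>set [1..<8]. if c = a \<or> c = b then True else
     (\<forall>d\<in>set [Suc c..<8]. if d = a \<or> d = b then True else
     (\<forall>e\<in>set [1..<8]. if e = a \<or> e = b \<or> e = c \<or> e = d then True else
     (\<forall>f\<in>set [Suc e..<8]. if f = a \<or> f = b \<or> f = c \<or> f = d then True else
       if 7 dvd int a + int b - (int c + int d) \<and> 7 dvd int a + int b - (int e + int f) then True else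
       idet3 (icross (sample_q (a mod 7)) (sample_q (b mod 7))) (icross (sample_q (c mod 7)) (sample_q (d mod 7)))
         (icross (sample_q (e mod 7)) (sample_q (f mod 7))) \<noteq> 0)))"
  by code_simp

definition sample_value :: "nat \<Rightarrow> nat \<Rightarrow> nat \<Rightarrow> int" where
  "sample_value i j k = icubic (sample_q i) (sample_q j) (sample_q k)"

text \<open>With these seven numbers as literals, the discriminant and the resultant are plain
  numeral arithmetic.\<close>

lemma sample_values:
  "sample_value 1 1 0 = -390678966886403020911615521525845721088"
  "sample_value 0 1 2 = -157690285301058233544379050191927377920"
  "sample_value 2 2 0 = -7519396022841375693822100308215463936"
  "sample_value 1 1 2 = -421086177279117038854037617260065980416"
  "sample_value 1 2 2 = -212214065533523269581201497587414204416"
  "sample_value 1 0 0 = -83257158057811532035247577116002222080"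
  "sample_value 2 0 0 = -6976410122971482516278848598675816448"
  by code_simp+

lemma sample_disc: "tangent_disc (unp sample) \<noteq> 0" and sample_flex: "flex_value (unp sample) \<noteq> 0"
proof -
  have v: "m7_cubic (unp sample) (unp sample 1) (unp sample 1) (unp sample 0) = of_int (sample_value 1 1 0)"
    "m7_cubic (unp sample) (unp sample 0) (unp sample 1) (unp sample 2) = of_int (sample_value 0 1 2)"
    "m7_cubic (unp sample) (unp sample 2) (unp sample 2) (unp sample 0) = of_int (sample_value 2 2 0)"
    "m7_cubic (unp sample) (unp sample 1) (unp sample 1) (unp sample 2) = of_int (sample_value 1 1 2)"
    "m7_cubic (unp sample) (unp sample 1) (unp sample 2) (unp sample 2) = of_int (sample_value 1 2 2)"
    "m7_cubic (unp sample) (unp sample 1) (unp sample 0) (unp sample 0) = of_int (sample_value 1 0 0)"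
    "m7_cubic (unp sample) (unp sample 2) (unp sample 0) (unp sample 0) = of_int (sample_value 2 0 0)"
    by (simp_all add: unp_sample m7_cubic_sample sample_value_def numeral_nat)
  show "flex_value (unp sample) \<noteq> 0"
    unfolding flex_value_def Let_def v sample_values by simp
  show "tangent_disc (unp sample) \<noteq> 0"
    unfolding tangent_disc_def tangent_coeff_simps v sample_values quartic_disc_def by simp
qed

lemma genericity_sample: "genericity sample \<noteq> 0"
proof -
  have q: "m7_cubic (unp sample) (unp sample i) (unp sample i) (unp sample j) \<noteq> 0"
    if "i \<in> {0..6}" "j \<in> {0..6}" "i \<noteq> j" for i j
  proof -
    have "nat i \<in> set [0..<7]" "nat j \<in> set [0..<7]" "nat i \<noteq> nat j" using that by auto
    then show ?thesis using sample_tangents that by (simp add: unp_sample m7_cubic_sample)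
  qed
  have r: "m7_cubic (unp sample) (pri sample i) (pri sample i) (unp sample j) \<noteq> 0"
    if "i \<in> {0..6}" "j \<in> {0..6}" for i j
  proof -
    have "nat i \<in> set [0..<7]" "nat j \<in> set [0..<7]" using that by auto
    then show ?thesis using sample_tangents that by (simp add: unp_sample pri_sample m7_cubic_sample)
  qed
  have m: "det3 (cross (unp sample (int a)) (unp sample (int b))) (cross (unp sample (int c)) (unp sample (int d)))
      (cross (unp sample (int e)) (unp sample (int f))) \<noteq> 0" if "(a, b, c, d, e, f) \<in> matchings" for a b c d e f
  proof -
    have t: "a \<in> set [1..<8]" "b \<in> set [Suc a..<8]" "c \<in> set [1..<8]" "d \<in> set [Suc c..<8]" "e \<in> set [1..<8]" "f \<in> set [Suc e..<8]"
      and n: "\<not> (c = a \<or> c = b)" "\<not> (d = a \<or> d = b)" "\<not> (e = a \<or> e = b \<or> e = c \<or> e = d)"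
        "\<not> (f = a \<or> f = b \<or> f = c \<or> f = d)"
        "\<not> (7 dvd int a + int b - (int c + int d) \<and> 7 dvd int a + int b - (int e + int f))"
      using that unfolding matchings_def by auto
    from sample_matchings[THEN bspec, OF t(1), THEN bspec, OF t(2), THEN bspec, OF t(3), unfolded if_not_P[OF n(1)],
        THEN bspec, OF t(4), unfolded if_not_P[OF n(2)], THEN bspec, OF t(5), unfolded if_not_P[OF n(3)],
        THEN bspec, OF t(6), unfolded if_not_P[OF n(4)] if_not_P[OF n(5)]]
    show ?thesis by (simp add: unp_sample cross_cvec det3_cvec nat_mod_distrib)
  qed
  show ?thesis
    unfolding genericity_def using sample_disc sample_flex q r m finite_matchings
    by (auto simp: prod_zero_iff)
qed

text \<open>Over the complex numbers the degree of a dominant rational map between irreducible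
  surfaces is the number of points in a generic fibre. The fibre over the class of \<open>L\<close>
  consists of the classes of those \<open>L'\<close> whose image is equivalent to \<open>L\<close>.
  The polynomial \<open>F\<close> makes "generic" explicit, and the fibres over
  \<open>F L \<noteq> 0\<close> being nonempty expresses dominance.\<close>

theorem theorem3p3:
  shows "\<exists>F. poly_fun F \<and> (\<exists>L0. is_realization L0 \<and> F L0 \<noteq> 0) \<and>
     (\<forall>L. is_realization L \<and> F L \<noteq> 0 \<longrightarrow>
        card (pgl_class ` {L'. \<exists>N. lam_rel L' N \<and> pgl_equiv N L}) = 4)"
  using poly_fun_genericity genericity_card config_realization[OF sample_config] genericity_sample by blast

end
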